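(* Let $\Lambda$ be an Artin algebra and let $P$ be an indecomposable projective $\Lambda$-module. Let $P_1\xrightarrow{g}P_0\xrightarrow{\sigma}\nu_{\Lambda^{\mathrm{op}}}P^*\to 0$ be a minimal projective presentation in $\mathrm{mod}\text{-}\Lambda^{\mathrm{op}}$, and let $e:P^*\to P_0$ be a lifting of $\alpha_{P^*}:P^*\to\nu_{\Lambda^{\mathrm{op}}}P^*$ through $\sigma$ (that is, $\sigma e=\alpha_{P^*}$). Then the almost split sequence in $\mathcal{P}(\Lambda)$ starting at $(0\to P)$ has the form $$0\to(0\to P)\to\left(P_0^*\xrightarrow{[g^*\ e^*]^t}P_1^*\oplus P\right)\to\left(P_0^*\xrightarrow{g^*}P_1^*\right)\to 0,$$ where $e^*:P_0^*\to P^{**}$ is regarded as a morphism to $P$ via the canonical isomorphism $P^{**}\simeq P$.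
   Context: $\mathrm{mod}\text{-}\Lambda$ is the category of finitely generated $\Lambda$-modules. $\mathcal{H}(\Lambda)$ is the morphism category of $\mathrm{mod}\text{-}\Lambda$: objects are morphisms $f:X\to Y$ in $\mathrm{mod}\text{-}\Lambda$, and a morphism from $(X\xrightarrow{f}Y)$ to $(X'\xrightarrow{f'}Y')$ is a pair $(\sigma_1,\sigma_2)$ with $\sigma_1:X\to X'$, $\sigma_2:Y\to Y'$ and $\sigma_2f=f'\sigma_1$. It is abelian, with exactness computed componentwise. $\mathcal{P}(\Lambda)$ is the full subcategory of $\mathcal{H}(\Lambda)$ of objects $(P\xrightarrow{f}Q)$ with $P,Q$ projective; it is extension-closed and carries the exact structure inherited from $\mathcal{H}(\Lambda)$, with respect to which almost split sequences in $\mathcal{P}(\Lambda)$ are taken. $(-)^*$ denotes $\mathrm{Hom}_\Lambda(-,\Lambda)$ and likewise $\mathrm{Hom}_{\Lambda^{\mathrm{op}}}(-,\Lambda)$; these give mutually inverse dualities between $\mathrm{prj}\text{-}\Lambda$ and $\mathrm{prj}\text{-}\Lambda^{\mathrm{op}}$. $\nu_{\Lambda^{\mathrm{op}}}=D\,\mathrm{Hom}_{\Lambda^{\mathrm{op}}}(-,\Lambda)$ is the Nakayama functor of $\Lambda^{\mathrm{op}}$. For an indecomposable projective $\Lambda^{\mathrm{op}}$-module $R$, $\alpha_R:R\to\nu_{\Lambda^{\mathrm{op}}}R$ denotes the composite $R\to\mathrm{top}(R)\simeq\mathrm{soc}(\nu_{\Lambda^{\mathrm{op}}}R)\to\nu_{\Lambda^{\mathrm{op}}}R$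 of the canonical epimorphism, an isomorphism, and the canonical inclusion. *)

theory Defs
  imports "HOL-Algebra.Module" "HOL-Algebra.Ideal"
begin

section \<open>Right modules over a not necessarily commutative ring\<close>

text \<open>
  The library locale \<open>module\<close> requires a commutative ring of scalars. We keep its record type and
  its notion of submodule, and read \<open>a \<odot> x\<close> as the right action \<open>x a\<close>; this only shows in
  the associativity law. A module over the opposite ring is thus a left module. The ring operations
  \<open>mult\<close> and \<open>one\<close> of the module record are irrelevant, as in the library.
\<close>

locale rmodule = R?: ring A + M?: abelian_group M
    for A :: "'a ring" and M :: "('a, 'm) module" +
  assumes smult_closed [simp, intro]:
      "\<lbrakk>a \<in> carrier A; x \<in> carrier M\<rbrakk> \<Longrightarrow> a \<odot>\<^bsub>M\<^esub> x \<in> carrier M"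
    and smult_l_distr:
      "\<lbrakk>a \<in> carrier A; b \<in> carrier A; x \<in> carrier M\<rbrakk>
        \<Longrightarrow> (a \<oplus>\<^bsub>A\<^esub> b) \<odot>\<^bsub>M\<^esub> x = a \<odot>\<^bsub>M\<^esub> x \<oplus>\<^bsub>M\<^esub> b \<odot>\<^bsub>M\<^esub> x"
    and smult_r_distr:
      "\<lbrakk>a \<in> carrier A; x \<in> carrier M; y \<in> carrier M\<rbrakk>
        \<Longrightarrow> a \<odot>\<^bsub>M\<^esub> (x \<oplus>\<^bsub>M\<^esub> y) = a \<odot>\<^bsub>M\<^esub> x \<oplus>\<^bsub>M\<^esub> a \<odot>\<^bsub>M\<^esub> y"
    and smult_assoc:
      "\<lbrakk>a \<in> carrier A; b \<in> carrier A; x \<in> carrier M\<rbrakk>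
        \<Longrightarrow> (a \<otimes>\<^bsub>A\<^esub> b) \<odot>\<^bsub>M\<^esub> x = b \<odot>\<^bsub>M\<^esub> (a \<odot>\<^bsub>M\<^esub> x)"
    and smult_one [simp]:
      "x \<in> carrier M \<Longrightarrow> \<one>\<^bsub>A\<^esub> \<odot>\<^bsub>M\<^esub> x = x"

lemma rmodule_iff_module:
  assumes "cring A"
  shows "rmodule A M \<longleftrightarrow> module A M"
proof -
  interpret cring A by (rule assms)
  show ?thesis
  proof
    assume "rmodule A M"
    then interpret M: rmodule A M .
    have "(a \<otimes>\<^bsub>A\<^esub> b) \<odot>\<^bsub>M\<^esub> x = a \<odot>\<^bsub>M\<^esub> (b \<odot>\<^bsub>M\<^esub> x)"
      if "a \<in> carrier A" "b \<in> carrier A" "x \<in> carrier M" for a b x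
      using that by (metis M.smult_assoc m_comm)
    then show "module A M"
      by (intro moduleI[OF assms M.abelian_group_axioms])
        (auto simp: M.smult_l_distr M.smult_r_distr)
  next
    assume "module A M"
    then interpret M: module A M .
    have "(a \<otimes>\<^bsub>A\<^esub> b) \<odot>\<^bsub>M\<^esub> x = b \<odot>\<^bsub>M\<^esub> (a \<odot>\<^bsub>M\<^esub> x)"
      if "a \<in> carrier A" "b \<in> carrier A" "x \<in> carrier M" for a b x
      using that by (metis M.smult_assoc1 m_comm)
    then show "rmodule A M"
      by unfold_locales (auto simp: M.smult_l_distr M.smult_r_distr)
  qed
qed

definition op_ring :: "'a ring \<Rightarrow> 'a ring" where
  "op_ring A = A\<lparr>mult := \<lambda>x y. y \<otimes>\<^bsub>A\<^esub> x\<rparr>"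

definition regular_module :: "'a ring \<Rightarrow> ('a, 'a) module" where
  "regular_module A = \<lparr>carrier = carrier A, mult = undefined, one = undefined,
     zero = \<zero>\<^bsub>A\<^esub>, add = add A, smult = \<lambda>a x. x \<otimes>\<^bsub>A\<^esub> a\<rparr>"

text \<open>Homomorphisms are extensional functions, so that equality of functions is equality of
  homomorphisms and composition is the library's \<open>compose\<close>.\<close>

definition mod_Hom :: "'a ring \<Rightarrow> ('a, 'm) module \<Rightarrow> ('a, 'n) module \<Rightarrow> ('m \<Rightarrow> 'n) set" where
  "mod_Hom A M N = {f \<in> carrier M \<rightarrow>\<^sub>E carrier N.
     (\<forall>x\<in>carrier M. \<forall>y\<in>carrier M. f (x \<oplus>\<^bsub>M\<^esub> y) = f x \<oplus>\<^bsub>N\<^esub> f y) \<and>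
     (\<forall>a\<in>carrier A. \<forall>x\<in>carrier M. f (a \<odot>\<^bsub>M\<^esub> x) = a \<odot>\<^bsub>N\<^esub> f x)}"

definition mod_iso :: "'a ring \<Rightarrow> ('a, 'm) module \<Rightarrow> ('a, 'n) module \<Rightarrow> ('m \<Rightarrow> 'n) set" where
  "mod_iso A M N = {f \<in> mod_Hom A M N. bij_betw f (carrier M) (carrier N)}"

definition zero_module :: "('a, unit) module" where
  "zero_module = \<lparr>carrier = {()}, mult = undefined, one = undefined,
     zero = (), add = \<lambda>_ _. (), smult = \<lambda>_ _. ()\<rparr>"

definition zero_map :: "('a, 'm) module \<Rightarrow> ('a, 'n) module \<Rightarrow> 'm \<Rightarrow> 'n" where
  "zero_map M N = (\<lambda>x\<in>carrier M. \<zero>\<^bsub>N\<^esub>)"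

definition dsum_module :: "('a, 'm) module \<Rightarrow> ('a, 'n) module \<Rightarrow> ('a, 'm \<times> 'n) module" where
  "dsum_module M N = \<lparr>carrier = carrier M \<times> carrier N, mult = undefined, one = undefined,
     zero = (\<zero>\<^bsub>M\<^esub>, \<zero>\<^bsub>N\<^esub>),
     add = \<lambda>(x, y) (x', y'). (x \<oplus>\<^bsub>M\<^esub> x', y \<oplus>\<^bsub>N\<^esub> y'),
     smult = \<lambda>a (x, y). (a \<odot>\<^bsub>M\<^esub> x, a \<odot>\<^bsub>N\<^esub> y)\<rparr>"

definition quot_module :: "('a, 'm) module \<Rightarrow> 'm set \<Rightarrow> ('a, 'm set) module" where
  "quot_module M U = \<lparr>carrier = a_rcosets\<^bsub>M\<^esub> U, mult = undefined, one = undefined,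
     zero = U, add = set_add M, smult = \<lambda>a X. (\<Union>x\<in>X. U +>\<^bsub>M\<^esub> (a \<odot>\<^bsub>M\<^esub> x))\<rparr>"

definition fg_module :: "'a ring \<Rightarrow> ('a, 'm) module \<Rightarrow> bool" where
  "fg_module A M \<longleftrightarrow> rmodule A M \<and>
     (\<exists>S\<subseteq>carrier M. finite S \<and> (\<forall>U. submodule U A M \<and> S \<subseteq> U \<longrightarrow> U = carrier M))"

definition indecomposable :: "'a ring \<Rightarrow> ('a, 'm) module \<Rightarrow> bool" where
  "indecomposable A M \<longleftrightarrow> carrier M \<noteq> {\<zero>\<^bsub>M\<^esub>} \<and>
     (\<forall>U V. submodule U A M \<and> submodule V A M \<and> U <+>\<^bsub>M\<^esub> V = carrier M \<and> U \<inter> V = {\<zero>\<^bsub>M\<^esub>}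
        \<longrightarrow> U = {\<zero>\<^bsub>M\<^esub>} \<or> V = {\<zero>\<^bsub>M\<^esub>})"


section \<open>A type carrying all finitely generated modules\<close>

text \<open>
  The universal properties below quantify over test modules, and HOL cannot quantify over their
  carrier type inside a definition. Every finitely generated module over a ring on the type \<open>'a\<close>
  has an isomorphic copy carried by the following type (the element \<open>x\<close> is represented by the
  set of all coefficient families expressing it through fixed generators), so that quantifying over
  modules on this type covers \<open>mod-A\<close> up to isomorphism.
\<close>

type_synonym 'a fgu = "(nat \<Rightarrow> 'a) set"

lemma rmodule_transport:
  fixes A :: "'a ring" and M :: "('a, 'm) module" and j :: "'m \<Rightarrow> 'n"
  assumes "rmodule A M" and inj: "inj_on j (carrier M)"
  shows "\<exists>N :: ('a, 'n) module. rmodule A N \<and> restrict j (carrier M) \<in> mod_iso A M N"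
proof -
  interpret rmodule A M by (rule assms)
  define k where "k = inv_into (carrier M) j"
  have kj [simp]: "k (j x) = x" if "x \<in> carrier M" for x
    using that inj by (simp add: k_def)
  define N :: "('a, 'n) module" where
    "N = \<lparr>carrier = j ` carrier M, mult = undefined, one = undefined, zero = j \<zero>\<^bsub>M\<^esub>,
       add = \<lambda>u v. j (k u \<oplus>\<^bsub>M\<^esub> k v), smult = \<lambda>a u. j (a \<odot>\<^bsub>M\<^esub> k u)\<rparr>"
  have "abelian_group N"
  proof (rule abelian_groupI)
    fix u assume "u \<in> carrier N"
    then obtain x where x: "x \<in> carrier M" "u = j x" by (auto simp: N_def)
    then show "\<exists>v\<in>carrier N. v \<oplus>\<^bsub>N\<^esub> u = \<zero>\<^bsub>N\<^esub>"
      by (intro bexI[of _ "j (\<ominus>\<^bsub>M\<^esub> x)"]) (auto simp: N_def M.l_neg)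
  qed (auto simp: N_def M.add.m_ac)
  moreover have "rmodule_axioms A N"
    by unfold_locales
      (auto simp: N_def smult_l_distr smult_r_distr smult_assoc)
  ultimately have "rmodule A N"
    by (simp add: rmodule_def R.ring_axioms)
  moreover have "restrict j (carrier M) \<in> mod_iso A M N"
    using inj by (auto simp: mod_iso_def mod_Hom_def N_def bij_betw_def)
  ultimately show ?thesis by blast
qed

lemma fg_module_iso:
  assumes fg: "fg_module A M" and N: "rmodule A N" and f: "f \<in> mod_iso A M N"
  shows "fg_module A N"
proof -
  interpret M: rmodule A M using fg by (simp add: fg_module_def)
  interpret N: rmodule A N by (rule N)
  from f have fM: "f x \<in> carrier N" if "x \<in> carrier M" for x
    using that by (auto simp: mod_iso_def mod_Hom_def)
  from f have fadd: "f (x \<oplus>\<^bsub>M\<^esub> y) = f x \<oplus>\<^bsub>N\<^esub> f y" if "x \<in> carrier M" "y \<in> carrier M" for x y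
    using that by (auto simp: mod_iso_def mod_Hom_def)
  from f have fsm: "f (a \<odot>\<^bsub>M\<^esub> x) = a \<odot>\<^bsub>N\<^esub> f x" if "a \<in> carrier A" "x \<in> carrier M" for a x
    using that by (auto simp: mod_iso_def mod_Hom_def)
  from f have surj: "f ` carrier M = carrier N" by (auto simp: mod_iso_def bij_betw_def)
  have f0: "f \<zero>\<^bsub>M\<^esub> = \<zero>\<^bsub>N\<^esub>"
    using fadd[of "\<zero>\<^bsub>M\<^esub>" "\<zero>\<^bsub>M\<^esub>"] fM[of "\<zero>\<^bsub>M\<^esub>"] by (simp add: N.M.add.r_cancel_one')
  have fneg: "f (\<ominus>\<^bsub>M\<^esub> x) = \<ominus>\<^bsub>N\<^esub> f x" if "x \<in> carrier M" for x
    using fadd[of "\<ominus>\<^bsub>M\<^esub> x" x] that fM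
    by (simp add: M.M.l_neg f0 N.M.minus_equality)
  obtain S where S: "S \<subseteq> carrier M" "finite S"
      "\<And>U. submodule U A M \<Longrightarrow> S \<subseteq> U \<Longrightarrow> U = carrier M"
    using fg by (auto simp: fg_module_def)
  have "V = carrier N" if V: "submodule V A N" "f ` S \<subseteq> V" for V
  proof -
    define U where "U = {x \<in> carrier M. f x \<in> V}"
    interpret V: submodule V A N by (rule V)
    have Vadd: "u \<oplus>\<^bsub>N\<^esub> v \<in> V" if "u \<in> V" "v \<in> V" for u v
      using V.m_closed that by simp
    have Vneg: "\<ominus>\<^bsub>N\<^esub> u \<in> V" if "u \<in> V" for u
      using V.m_inv_closed that by (simp add: a_inv_def)
    have V0: "\<zero>\<^bsub>N\<^esub> \<in> V"
      using V.one_closed by simp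
    have "subgroup U (add_monoid M)"
      by (rule M.M.add.subgroupI)
        (auto simp: U_def fadd fneg f0 intro: Vadd Vneg intro!: exI[of _ "\<zero>\<^bsub>M\<^esub>"] V0)
    moreover have "submodule_axioms U A M"
      by unfold_locales (auto simp: U_def fsm)
    ultimately have "submodule U A M"
      by (simp add: submodule_def)
    moreover have "S \<subseteq> U"
      using S(1) V(2) by (auto simp: U_def)
    ultimately have "U = carrier M" by (rule S(3))
    then have "f ` carrier M \<subseteq> V"
      by (auto simp: U_def)
    then have "carrier N \<subseteq> V"
      by (simp add: surj)
    then show ?thesis
      using V.subset by auto
  qed
  then show ?thesis
    unfolding fg_module_def using N S(1,2) fM by (intro conjI exI[of _ "f ` S"]) auto
qed

lemma fg_module_has_copy:
  fixes A :: "'a ring" and M :: "('a, 'm) module"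
  assumes fg: "fg_module A M"
  shows "\<exists>(N :: ('a, 'a fgu) module) f. fg_module A N \<and> f \<in> mod_iso A M N"
proof -
  interpret rmodule A M using fg by (simp add: fg_module_def)
  obtain S where S: "S \<subseteq> carrier M" "finite S"
      "\<And>U. submodule U A M \<Longrightarrow> S \<subseteq> U \<Longrightarrow> U = carrier M"
    using fg by (auto simp: fg_module_def)
  obtain n and s :: "nat \<Rightarrow> 'm" where s: "S = s ` {..<n}"
    using finite_imp_nat_seg_image_inj_on[OF S(2)] by (auto simp: lessThan_def)
  have sM [simp]: "i < n \<Longrightarrow> s i \<in> carrier M" for i using S(1) s by auto
  define ev where "ev = (\<lambda>c :: nat \<Rightarrow> 'a. \<Oplus>\<^bsub>M\<^esub>i\<in>{..<n}. c i \<odot>\<^bsub>M\<^esub> s i)"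
  define C where "C = {..<n} \<rightarrow> carrier A"
  define U where "U = ev ` C"
  have Cc [simp]: "c \<in> C \<Longrightarrow> i < n \<Longrightarrow> c i \<in> carrier A" for c i
    by (auto simp: C_def)
  have evM: "ev c \<in> carrier M" if "c \<in> C" for c
    unfolding ev_def using that by (intro M.finsum_closed) auto
  have ev_add: "ev c \<oplus>\<^bsub>M\<^esub> ev d = ev (\<lambda>i. c i \<oplus>\<^bsub>A\<^esub> d i)" if "c \<in> C" "d \<in> C" for c d
  proof -
    have "ev (\<lambda>i. c i \<oplus>\<^bsub>A\<^esub> d i)
        = (\<Oplus>\<^bsub>M\<^esub>i\<in>{..<n}. c i \<odot>\<^bsub>M\<^esub> s i \<oplus>\<^bsub>M\<^esub> d i \<odot>\<^bsub>M\<^esub> s i)"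
      unfolding ev_def using that by (intro M.finsum_cong') (auto simp: smult_l_distr)
    also have "\<dots> = ev c \<oplus>\<^bsub>M\<^esub> ev d"
      unfolding ev_def using that by (intro M.finsum_addf) auto
    finally show ?thesis by simp
  qed
  have ev_smult: "a \<odot>\<^bsub>M\<^esub> ev c = ev (\<lambda>i. c i \<otimes>\<^bsub>A\<^esub> a)" if a: "a \<in> carrier A" and c: "c \<in> C" for a c
  proof -
    have zero: "a \<odot>\<^bsub>M\<^esub> \<zero>\<^bsub>M\<^esub> = \<zero>\<^bsub>M\<^esub>"
      using smult_r_distr[OF a, of "\<zero>\<^bsub>M\<^esub>" "\<zero>\<^bsub>M\<^esub>"] a
      by (simp add: M.add.r_cancel_one')
    have "a \<odot>\<^bsub>M\<^esub> (\<Oplus>\<^bsub>M\<^esub>i\<in>I. c i \<odot>\<^bsub>M\<^esub> s i) = (\<Oplus>\<^bsub>M\<^esub>i\<in>I. (c i \<otimes>\<^bsub>A\<^esub> a) \<odot>\<^bsub>M\<^esub> s i)"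
      if "finite I" "I \<subseteq> {..<n}" for I
      using that
    proof (induction I)
      case empty
      then show ?case by (simp add: zero)
    next
      case (insert i I)
      have *: "(\<lambda>i. c i \<odot>\<^bsub>M\<^esub> s i) \<in> I \<rightarrow> carrier M"
          "(\<lambda>i. (c i \<otimes>\<^bsub>A\<^esub> a) \<odot>\<^bsub>M\<^esub> s i) \<in> I \<rightarrow> carrier M"
        using insert.prems a c by auto
      show ?case
        using insert a c * by (simp add: smult_r_distr M.finsum_closed smult_assoc)
    qed
    then show ?thesis by (simp add: ev_def)
  qed
  have "subgroup U (add_monoid M)"
  proof (rule M.add.subgroupI)
    show "U \<subseteq> carrier M" by (auto simp: U_def evM)
    have "(\<lambda>i. \<zero>\<^bsub>A\<^esub>) \<in> C" by (auto simp: C_def)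
    then show "U \<noteq> {}" by (auto simp: U_def)
    show "u \<oplus>\<^bsub>M\<^esub> v \<in> U" if "u \<in> U" "v \<in> U" for u v
    proof -
      from that obtain c d where "c \<in> C" "d \<in> C" "u = ev c" "v = ev d" by (auto simp: U_def)
      moreover then have "(\<lambda>i. c i \<oplus>\<^bsub>A\<^esub> d i) \<in> C" by (auto simp: C_def)
      ultimately show ?thesis by (auto simp: U_def ev_add)
    qed
    show "\<ominus>\<^bsub>M\<^esub> u \<in> U" if "u \<in> U" for u
    proof -
      from that obtain c where c: "c \<in> C" "u = ev c" by (auto simp: U_def)
      then have d: "(\<lambda>i. \<ominus>\<^bsub>A\<^esub> c i) \<in> C" by (auto simp: C_def)
      have z: "\<zero>\<^bsub>A\<^esub> \<odot>\<^bsub>M\<^esub> x = \<zero>\<^bsub>M\<^esub>" if "x \<in> carrier M" for x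
        using smult_l_distr[of "\<zero>\<^bsub>A\<^esub>" "\<zero>\<^bsub>A\<^esub>" x] that
        by (simp add: M.add.r_cancel_one')
      have "ev (\<lambda>i. \<ominus>\<^bsub>A\<^esub> c i) \<oplus>\<^bsub>M\<^esub> u = ev (\<lambda>i. \<ominus>\<^bsub>A\<^esub> c i \<oplus>\<^bsub>A\<^esub> c i)"
        using c d by (simp add: ev_add)
      also have "\<dots> = (\<Oplus>\<^bsub>M\<^esub>i\<in>{..<n}. \<zero>\<^bsub>M\<^esub>)"
        unfolding ev_def using c by (intro M.finsum_cong') (auto simp: R.l_neg z)
      finally have "\<ominus>\<^bsub>M\<^esub> u = ev (\<lambda>i. \<ominus>\<^bsub>A\<^esub> c i)"
        using c d by (simp add: M.minus_equality evM)
      then show ?thesis using d by (auto simp: U_def)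
    qed
  qed
  moreover have "a \<odot>\<^bsub>M\<^esub> u \<in> U" if "a \<in> carrier A" "u \<in> U" for a u
  proof -
    from that obtain c where c: "c \<in> C" "u = ev c" by (auto simp: U_def)
    moreover from c that have "(\<lambda>i. c i \<otimes>\<^bsub>A\<^esub> a) \<in> C" by (auto simp: C_def)
    ultimately show ?thesis using that by (auto simp: U_def ev_smult)
  qed
  ultimately have "submodule U A M"
    by (simp add: submodule_def submodule_axioms_def)
  moreover have "S \<subseteq> U"
  proof
    fix x assume "x \<in> S"
    then obtain k where k: "k < n" "x = s k" by (auto simp: s)
    define c where "c = (\<lambda>i. if i = k then \<one>\<^bsub>A\<^esub> else \<zero>\<^bsub>A\<^esub>)"
    have z: "\<zero>\<^bsub>A\<^esub> \<odot>\<^bsub>M\<^esub> x = \<zero>\<^bsub>M\<^esub>" if "x \<in> carrier M" for x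
      using smult_l_distr[of "\<zero>\<^bsub>A\<^esub>" "\<zero>\<^bsub>A\<^esub>" x] that
      by (simp add: M.add.r_cancel_one')
    have "ev c = (\<Oplus>\<^bsub>M\<^esub>i\<in>{..<n}. if k = i then s i else \<zero>\<^bsub>M\<^esub>)"
      unfolding ev_def by (intro M.finsum_cong') (auto simp: c_def z)
    also have "\<dots> = s k"
      using k by (intro M.finsum_singleton) auto
    finally have "ev c = x" using k by simp
    moreover have "c \<in> C" by (auto simp: C_def c_def)
    ultimately show "x \<in> U" by (auto simp: U_def)
  qed
  ultimately have U: "U = carrier M" by (rule S(3))
  define j where "j = (\<lambda>x. {c \<in> C. ev c = x})"
  have "inj_on j (carrier M)"
  proof (rule inj_onI)
    fix x y assume "x \<in> carrier M" "y \<in> carrier M" "j x = j y"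
    moreover obtain c where "c \<in> C" "ev c = x"
      using \<open>x \<in> carrier M\<close> unfolding U[symmetric] U_def by blast
    ultimately show "x = y" by (auto simp: j_def)
  qed
  from rmodule_transport[OF rmodule_axioms this] fg_module_iso[OF fg]
  show ?thesis by blast
qed


section \<open>Projective and injective modules\<close>

text \<open>Used for finitely generated \<open>P\<close> only: such a \<open>P\<close> is a quotient of some \<open>A\<^sup>n\<close>,
  and test modules on \<open>'a fgu\<close> suffice.\<close>

definition projective :: "'a ring \<Rightarrow> ('a, 'm) module \<Rightarrow> bool" where
  "projective A P \<longleftrightarrow> rmodule A P \<and>
     (\<forall>(B :: ('a, 'a fgu) module) (C :: ('a, 'a fgu) module) p h.
        rmodule A B \<and> rmodule A C \<and> p \<in> mod_Hom A B C \<and> p ` carrier B = carrier C \<and>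
        h \<in> mod_Hom A P C
        \<longrightarrow> (\<exists>k\<in>mod_Hom A P B. compose (carrier P) p k = h))"

text \<open>By Baer's criterion, test modules on \<open>'a fgu\<close>, which contains copies of the regular
  module and of its right ideals, suffice for arbitrary \<open>E\<close>.\<close>

definition injective :: "'a ring \<Rightarrow> ('a, 'm) module \<Rightarrow> bool" where
  "injective A E \<longleftrightarrow> rmodule A E \<and>
     (\<forall>(B :: ('a, 'a fgu) module) (C :: ('a, 'a fgu) module) i h.
        rmodule A B \<and> rmodule A C \<and> i \<in> mod_Hom A B C \<and> inj_on i (carrier B) \<and>
        h \<in> mod_Hom A B E
        \<longrightarrow> (\<exists>k\<in>mod_Hom A C E. compose (carrier B) k i = h))"

definition injective_envelope ::
    "'a ring \<Rightarrow> ('a, 'm) module \<Rightarrow> ('a, 'n) module \<Rightarrow> ('m \<Rightarrow> 'n) \<Rightarrow> bool" where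
  "injective_envelope A M E i \<longleftrightarrow> injective A E \<and> i \<in> mod_Hom A M E \<and> inj_on i (carrier M) \<and>
     (\<forall>U. submodule U A E \<and> U \<inter> i ` carrier M = {\<zero>\<^bsub>E\<^esub>} \<longrightarrow> U = {\<zero>\<^bsub>E\<^esub>})"

definition superfluous :: "'a ring \<Rightarrow> ('a, 'm) module \<Rightarrow> 'm set \<Rightarrow> bool" where
  "superfluous A M K \<longleftrightarrow> (\<forall>U. submodule U A M \<and> U <+>\<^bsub>M\<^esub> K = carrier M \<longrightarrow> U = carrier M)"

definition projective_cover ::
    "'a ring \<Rightarrow> ('a, 'p) module \<Rightarrow> ('a, 'm) module \<Rightarrow> ('p \<Rightarrow> 'm) \<Rightarrow> bool" where
  "projective_cover A P M p \<longleftrightarrow> fg_module A P \<and> projective A P \<and>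
     p \<in> mod_Hom A P M \<and> p ` carrier P = carrier M \<and> superfluous A P (a_kernel P M p)"

definition minimal_projective_presentation ::
    "'a ring \<Rightarrow> ('a, 'k) module \<Rightarrow> ('a, 'n) module \<Rightarrow> ('a, 'm) module
      \<Rightarrow> ('k \<Rightarrow> 'n) \<Rightarrow> ('n \<Rightarrow> 'm) \<Rightarrow> bool" where
  "minimal_projective_presentation A P\<^sub>1 P\<^sub>0 M g \<sigma> \<longleftrightarrow>
     projective_cover A P\<^sub>0 M \<sigma> \<and>
     projective_cover A P\<^sub>1 (P\<^sub>0\<lparr>carrier := a_kernel P\<^sub>0 M \<sigma>\<rparr>) g"


section \<open>Radical, top and socle\<close>

definition maximal_submodule :: "'a ring \<Rightarrow> ('a, 'm) module \<Rightarrow> 'm set \<Rightarrow> bool" where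
  "maximal_submodule A M U \<longleftrightarrow> submodule U A M \<and> U \<noteq> carrier M \<and>
     (\<forall>V. submodule V A M \<and> U \<subseteq> V \<longrightarrow> V = U \<or> V = carrier M)"

definition simple_submodule :: "'a ring \<Rightarrow> ('a, 'm) module \<Rightarrow> 'm set \<Rightarrow> bool" where
  "simple_submodule A M U \<longleftrightarrow> submodule U A M \<and> U \<noteq> {\<zero>\<^bsub>M\<^esub>} \<and>
     (\<forall>V. submodule V A M \<and> V \<subseteq> U \<longrightarrow> V = {\<zero>\<^bsub>M\<^esub>} \<or> V = U)"

definition radical :: "'a ring \<Rightarrow> ('a, 'm) module \<Rightarrow> 'm set" where
  "radical A M = carrier M \<inter> \<Inter>{U. maximal_submodule A M U}"

definition top_module :: "'a ring \<Rightarrow> ('a, 'm) module \<Rightarrow> ('a, 'm set) module" where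
  "top_module A M = quot_module M (radical A M)"

text \<open>The sum of all simple submodules, as the smallest submodule containing them.\<close>

definition socle :: "'a ring \<Rightarrow> ('a, 'm) module \<Rightarrow> 'm set" where
  "socle A M = \<Inter>{U. submodule U A M \<and> (\<forall>S. simple_submodule A M S \<longrightarrow> S \<subseteq> U)}"

definition soc_module :: "'a ring \<Rightarrow> ('a, 'm) module \<Rightarrow> ('a, 'm) module" where
  "soc_module A M = M\<lparr>carrier := socle A M\<rparr>"

text \<open>The composite \<open>M \<rightarrow> top M \<rightarrow> soc N \<rightarrow> N\<close> for a map \<open>\<theta>\<close> from
  \<open>top M\<close> to \<open>soc N\<close>.\<close>

definition via_top_soc :: "'a ring \<Rightarrow> ('a, 'm) module \<Rightarrow> ('m set \<Rightarrow> 'n) \<Rightarrow> 'm \<Rightarrow> 'n" where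
  "via_top_soc A M \<theta> = (\<lambda>x\<in>carrier M. \<theta> (radical A M +>\<^bsub>M\<^esub> x))"


section \<open>Artin algebras and their dualities\<close>

definition artinian_cring :: "'r ring \<Rightarrow> bool" where
  "artinian_cring R \<longleftrightarrow> cring R \<and>
     (\<forall>I :: nat \<Rightarrow> 'r set. (\<forall>n. ideal (I n) R \<and> I (Suc n) \<subseteq> I n) \<longrightarrow> (\<exists>N. \<forall>n\<ge>N. I n = I N))"

definition restrict_scalars ::
    "('r \<Rightarrow> 'a) \<Rightarrow> ('a, 'm) module \<Rightarrow> ('r, 'm) module" where
  "restrict_scalars \<phi> M = \<lparr>carrier = carrier M, mult = undefined, one = undefined,
     zero = \<zero>\<^bsub>M\<^esub>, add = add M, smult = \<lambda>r x. \<phi> r \<odot>\<^bsub>M\<^esub> x\<rparr>"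

definition artin_algebra :: "'r ring \<Rightarrow> ('r \<Rightarrow> 'a) \<Rightarrow> 'a ring \<Rightarrow> bool" where
  "artin_algebra R \<phi> A \<longleftrightarrow> artinian_cring R \<and> ring A \<and> \<phi> \<in> ring_hom R A \<and>
     (\<forall>r\<in>carrier R. \<forall>a\<in>carrier A. \<phi> r \<otimes>\<^bsub>A\<^esub> a = a \<otimes>\<^bsub>A\<^esub> \<phi> r) \<and>
     fg_module R (restrict_scalars \<phi> (regular_module A))"

text \<open>\<open>Hom\<^sub>A(M, A)\<close> with its natural left \<open>A\<close>-action, i.e. as a module over
  \<open>op_ring A\<close>, and its action on homomorphisms.\<close>

definition dual_module :: "'a ring \<Rightarrow> ('a, 'm) module \<Rightarrow> ('a, 'm \<Rightarrow> 'a) module" where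
  "dual_module A M = \<lparr>carrier = mod_Hom A M (regular_module A), mult = undefined, one = undefined,
     zero = (\<lambda>x\<in>carrier M. \<zero>\<^bsub>A\<^esub>),
     add = \<lambda>f g. \<lambda>x\<in>carrier M. f x \<oplus>\<^bsub>A\<^esub> g x,
     smult = \<lambda>a f. \<lambda>x\<in>carrier M. a \<otimes>\<^bsub>A\<^esub> f x\<rparr>"

definition dual_map ::
    "'a ring \<Rightarrow> ('a, 'm) module \<Rightarrow> ('a, 'n) module \<Rightarrow> ('m \<Rightarrow> 'n) \<Rightarrow> ('n \<Rightarrow> 'a) \<Rightarrow> ('m \<Rightarrow> 'a)" where
  "dual_map A M N h = (\<lambda>f\<in>carrier (dual_module A N). compose (carrier M) f h)"

text \<open>The canonical map \<open>M \<rightarrow> M\<^sup>*\<^sup>*\<close>.\<close>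

definition bidual_map :: "'a ring \<Rightarrow> ('a, 'm) module \<Rightarrow> 'm \<Rightarrow> ('m \<Rightarrow> 'a) \<Rightarrow> 'a" where
  "bidual_map A M = (\<lambda>x\<in>carrier M. \<lambda>f\<in>carrier (dual_module A M). f x)"

text \<open>\<open>D M = Hom\<^sub>R(M, E)\<close>, where \<open>(f a)(x) = f (x a)\<close>. In the applications \<open>E\<close>
  is an injective envelope of \<open>R / rad R\<close>.\<close>

definition D_module ::
    "'r ring \<Rightarrow> ('r \<Rightarrow> 'a) \<Rightarrow> ('r, 'e) module \<Rightarrow> ('a, 'm) module \<Rightarrow> ('a, 'm \<Rightarrow> 'e) module" where
  "D_module R \<phi> E M = \<lparr>carrier = mod_Hom R (restrict_scalars \<phi> M) E,
     mult = undefined, one = undefined,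
     zero = (\<lambda>x\<in>carrier M. \<zero>\<^bsub>E\<^esub>),
     add = \<lambda>f g. \<lambda>x\<in>carrier M. f x \<oplus>\<^bsub>E\<^esub> g x,
     smult = \<lambda>a f. \<lambda>x\<in>carrier M. f (a \<odot>\<^bsub>M\<^esub> x)\<rparr>"

definition nakayama ::
    "'r ring \<Rightarrow> ('r \<Rightarrow> 'a) \<Rightarrow> ('r, 'e) module \<Rightarrow> 'a ring \<Rightarrow> ('a, 'm) module
      \<Rightarrow> ('a, ('m \<Rightarrow> 'a) \<Rightarrow> 'e) module" where
  "nakayama R \<phi> E A M = D_module R \<phi> E (dual_module A M)"


section \<open>The morphism category and almost split sequences\<close>

record ('a, 'x, 'y) mobj =
  src :: "('a, 'x) module"
  tgt :: "('a, 'y) module"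
  arr :: "'x \<Rightarrow> 'y"

definition H_obj :: "'a ring \<Rightarrow> ('a, 'x, 'y) mobj \<Rightarrow> bool" where
  "H_obj A F \<longleftrightarrow> fg_module A (src F) \<and> fg_module A (tgt F) \<and> arr F \<in> mod_Hom A (src F) (tgt F)"

definition P_obj :: "'a ring \<Rightarrow> ('a, 'x, 'y) mobj \<Rightarrow> bool" where
  "P_obj A F \<longleftrightarrow> H_obj A F \<and> projective A (src F) \<and> projective A (tgt F)"

definition H_mor :: "'a ring \<Rightarrow> ('a, 'x, 'y) mobj \<Rightarrow> ('a, 'x', 'y') mobj
    \<Rightarrow> (('x \<Rightarrow> 'x') \<times> ('y \<Rightarrow> 'y')) set" where
  "H_mor A F G = {(s\<^sub>1, s\<^sub>2). s\<^sub>1 \<in> mod_Hom A (src F) (src G) \<and> s\<^sub>2 \<in> mod_Hom A (tgt F) (tgt G) \<and>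
     compose (carrier (src F)) s\<^sub>2 (arr F) = compose (carrier (src F)) (arr G) s\<^sub>1}"

text \<open>\<open>H_comp F t s\<close> is the composite of \<open>s\<close>, whose domain is \<open>F\<close>, followed by
  \<open>t\<close>.\<close>

definition H_comp :: "('a, 'x, 'y) mobj \<Rightarrow> ('x' \<Rightarrow> 'x'') \<times> ('y' \<Rightarrow> 'y'')
    \<Rightarrow> ('x \<Rightarrow> 'x') \<times> ('y \<Rightarrow> 'y') \<Rightarrow> ('x \<Rightarrow> 'x'') \<times> ('y \<Rightarrow> 'y'')" where
  "H_comp F t s = (compose (carrier (src F)) (fst t) (fst s),
                   compose (carrier (tgt F)) (snd t) (snd s))"

definition H_id :: "('a, 'x, 'y) mobj \<Rightarrow> ('x \<Rightarrow> 'x) \<times> ('y \<Rightarrow> 'y)" where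
  "H_id F = (\<lambda>x\<in>carrier (src F). x, \<lambda>y\<in>carrier (tgt F). y)"

definition H_iso :: "'a ring \<Rightarrow> ('a, 'x, 'y) mobj \<Rightarrow> ('a, 'x', 'y') mobj
    \<Rightarrow> (('x \<Rightarrow> 'x') \<times> ('y \<Rightarrow> 'y')) set" where
  "H_iso A F G = {s \<in> H_mor A F G.
     \<exists>t\<in>H_mor A G F. H_comp F t s = H_id F \<and> H_comp G s t = H_id G}"

definition split_mono :: "'a ring \<Rightarrow> ('a, 'x, 'y) mobj \<Rightarrow> ('a, 'x', 'y') mobj
    \<Rightarrow> ('x \<Rightarrow> 'x') \<times> ('y \<Rightarrow> 'y') \<Rightarrow> bool" where
  "split_mono A F G s \<longleftrightarrow> (\<exists>t\<in>H_mor A G F. H_comp F t s = H_id F)"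

definition split_epi :: "'a ring \<Rightarrow> ('a, 'x, 'y) mobj \<Rightarrow> ('a, 'x', 'y') mobj
    \<Rightarrow> ('x \<Rightarrow> 'x') \<times> ('y \<Rightarrow> 'y') \<Rightarrow> bool" where
  "split_epi A F G t \<longleftrightarrow> (\<exists>s\<in>H_mor A G F. H_comp G t s = H_id G)"

definition left_almost_split :: "'a ring \<Rightarrow> ('a, 'x, 'y) mobj \<Rightarrow> ('a, 'x', 'y') mobj
    \<Rightarrow> ('x \<Rightarrow> 'x') \<times> ('y \<Rightarrow> 'y') \<Rightarrow> bool" where
  "left_almost_split A F G s \<longleftrightarrow> s \<in> H_mor A F G \<and> \<not> split_mono A F G s \<and>
     (\<forall>(K :: ('a, 'a fgu, 'a fgu) mobj) h.
        P_obj A K \<and> h \<in> H_mor A F K \<and> \<not> split_mono A F K h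
        \<longrightarrow> (\<exists>k\<in>H_mor A G K. H_comp F k s = h))"

definition right_almost_split :: "'a ring \<Rightarrow> ('a, 'x, 'y) mobj \<Rightarrow> ('a, 'x', 'y') mobj
    \<Rightarrow> ('x \<Rightarrow> 'x') \<times> ('y \<Rightarrow> 'y') \<Rightarrow> bool" where
  "right_almost_split A F G t \<longleftrightarrow> t \<in> H_mor A F G \<and> \<not> split_epi A F G t \<and>
     (\<forall>(K :: ('a, 'a fgu, 'a fgu) mobj) h.
        P_obj A K \<and> h \<in> H_mor A K G \<and> \<not> split_epi A K G h
        \<longrightarrow> (\<exists>k\<in>H_mor A K F. H_comp K t k = h))"

definition short_exact_mod :: "'a ring \<Rightarrow> ('a, 'x) module \<Rightarrow> ('a, 'y) module \<Rightarrow> ('a, 'z) module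
    \<Rightarrow> ('x \<Rightarrow> 'y) \<Rightarrow> ('y \<Rightarrow> 'z) \<Rightarrow> bool" where
  "short_exact_mod A X Y Z f g \<longleftrightarrow> f \<in> mod_Hom A X Y \<and> g \<in> mod_Hom A Y Z \<and>
     inj_on f (carrier X) \<and> f ` carrier X = a_kernel Y Z g \<and> g ` carrier Y = carrier Z"

definition short_exact_H :: "'a ring \<Rightarrow> ('a, 'x, 'y) mobj \<Rightarrow> ('a, 'x', 'y') mobj
    \<Rightarrow> ('a, 'x'', 'y'') mobj \<Rightarrow> ('x \<Rightarrow> 'x') \<times> ('y \<Rightarrow> 'y') \<Rightarrow> ('x' \<Rightarrow> 'x'') \<times> ('y' \<Rightarrow> 'y'') \<Rightarrow> bool" where
  "short_exact_H A F G K s t \<longleftrightarrow> s \<in> H_mor A F G \<and> t \<in> H_mor A G K \<and>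
     short_exact_mod A (src F) (src G) (src K) (fst s) (fst t) \<and>
     short_exact_mod A (tgt F) (tgt G) (tgt K) (snd s) (snd t)"

text \<open>The exact structure on \<open>\<P>(A)\<close> is inherited from \<open>\<H>(A)\<close>: its conflations
  are the short exact sequences of \<open>\<H>(A)\<close> with all three terms in \<open>\<P>(A)\<close>.\<close>

definition almost_split_sequence :: "'a ring \<Rightarrow> ('a, 'x, 'y) mobj \<Rightarrow> ('a, 'x', 'y') mobj
    \<Rightarrow> ('a, 'x'', 'y'') mobj \<Rightarrow> ('x \<Rightarrow> 'x') \<times> ('y \<Rightarrow> 'y') \<Rightarrow> ('x' \<Rightarrow> 'x'') \<times> ('y' \<Rightarrow> 'y'') \<Rightarrow> bool" where
  "almost_split_sequence A F G K s t \<longleftrightarrow> P_obj A F \<and> P_obj A G \<and> P_obj A K \<and>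
     short_exact_H A F G K s t \<and> left_almost_split A F G s \<and> right_almost_split A G K t"

definition isomorphic_sequences where
  "isomorphic_sequences A F G K s t F' G' K' s' t' \<longleftrightarrow>
     (\<exists>u\<in>H_iso A F F'. \<exists>v\<in>H_iso A G G'. \<exists>w\<in>H_iso A K K'.
        H_comp F v s = H_comp F s' u \<and> H_comp G w t = H_comp G t' v)"

end

theory Submission
  imports Defs
begin

text \<open>
  Write \<open>Q = P\<^sup>*\<close>. Dualizing, a morphism from \<open>(0 \<rightarrow> P)\<close> to \<open>(k : K\<^sub>1 \<rightarrow> K\<^sub>2)\<close> given by
  \<open>h : P \<rightarrow> K\<^sub>2\<close> extends along the sequence iff \<open>e h\<^sup>*\<close> is of the form \<open>\<delta> k\<^sup>* - g \<zeta>\<close>, that is, iff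
  \<open>\<alpha> h\<^sup>* : K\<^sub>2\<^sup>* \<rightarrow> \<nu> Q\<close> factors through \<open>k\<^sup>*\<close>. Since \<open>\<nu> Q = D P\<^sup>*\<^sup>*\<close> is injective, this means that
  \<open>h\<^sup>*\<close> maps the kernel of \<open>k\<^sup>*\<close> into \<open>ker \<alpha> = rad Q\<close>. Otherwise it maps the kernel onto \<open>Q\<close>, as
  \<open>Q\<close> is local, and \<open>h\<close> splits. Dually, a morphism \<open>(h\<^sub>1, h\<^sub>2)\<close> from \<open>(k : K\<^sub>1 \<rightarrow> K\<^sub>2)\<close> to
  \<open>(P\<^sub>0\<^sup>* \<rightarrow> P\<^sub>1\<^sup>*)\<close> lifts iff the map \<open>\<nu> Q \<rightarrow> coker k\<^sup>*\<close> induced by \<open>h\<^sub>1\<^sup>*\<close> kills the simple essential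
  socle of \<open>\<nu> Q\<close>; otherwise it is a split monomorphism, and minimality of the presentation makes
  \<open>(h\<^sub>1, h\<^sub>2)\<close> a split epimorphism. Uniqueness holds because an endomorphism of the middle term of
  an almost split sequence that fixes the left map is an automorphism.
\<close>

section \<open>Modules and homomorphisms\<close>

text \<open>The presentation lives over the opposite ring and the sequence over \<Lambda>, so every
  map is built on the dual side and then brought back. Dual bases make this computable: lifting,
  reflexivity and transposition of maps become formulas in a finite family of elements and
  functionals, and an identity in a projective module is checked by applying all functionals to it.
  Two obstacles shape the rest. The definitions of projectivity, injectivity and almost split maps
  test only against modules on one fixed type, so objects on other types are replaced by copies
  there. And the locality of P*, the bijectivity of certain endomorphisms and the existence of
  simple submodules have to come out of the descending chain condition; they are all obtained by
  picking minimal submodules among suitable images, kernels or supplements, without composition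
  series or lifting of idempotents. The injectivity of \<nu> Q is in turn reduced to that of
  \<open>E\<close> over \<open>R\<close>, one coordinate of the dual basis at a time.\<close>

lemma mem_set_add: "x \<in> U <+>\<^bsub>M\<^esub> V \<longleftrightarrow> (\<exists>u\<in>U. \<exists>v\<in>V. x = u \<oplus>\<^bsub>M\<^esub> v)"
  by (auto simp: set_add_def')

section \<open>Arithmetic and submodules of a single module\<close>

context rmodule
begin

lemma smult_l_null [simp]:
  assumes "x \<in> carrier M"
  shows "\<zero>\<^bsub>A\<^esub> \<odot>\<^bsub>M\<^esub> x = \<zero>\<^bsub>M\<^esub>"
  using smult_l_distr[of "\<zero>\<^bsub>A\<^esub>" "\<zero>\<^bsub>A\<^esub>" x] assms by (simp add: M.add.r_cancel_one')

lemma smult_r_null [simp]: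
  assumes "a \<in> carrier A"
  shows "a \<odot>\<^bsub>M\<^esub> \<zero>\<^bsub>M\<^esub> = \<zero>\<^bsub>M\<^esub>"
  using smult_r_distr[OF assms, of "\<zero>\<^bsub>M\<^esub>" "\<zero>\<^bsub>M\<^esub>"] assms by (simp add: M.add.r_cancel_one')

lemma smult_minus_one:
  assumes x: "x \<in> carrier M"
  shows "(\<ominus>\<^bsub>A\<^esub> \<one>\<^bsub>A\<^esub>) \<odot>\<^bsub>M\<^esub> x = \<ominus>\<^bsub>M\<^esub> x"
proof -
  have "(\<ominus>\<^bsub>A\<^esub> \<one>\<^bsub>A\<^esub>) \<odot>\<^bsub>M\<^esub> x \<oplus>\<^bsub>M\<^esub> x = (\<ominus>\<^bsub>A\<^esub> \<one>\<^bsub>A\<^esub> \<oplus>\<^bsub>A\<^esub> \<one>\<^bsub>A\<^esub>) \<odot>\<^bsub>M\<^esub> x"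
    using x by (simp only: smult_l_distr smult_one R.one_closed R.a_inv_closed)
  also have "\<dots> = \<zero>\<^bsub>M\<^esub>"
    using x by (simp add: R.l_neg)
  finally show ?thesis
    using x M.minus_equality by auto
qed

lemma smult_finsum:
  assumes "finite I" "a \<in> carrier A" "c \<in> I \<rightarrow> carrier M"
  shows "a \<odot>\<^bsub>M\<^esub> (\<Oplus>\<^bsub>M\<^esub>i\<in>I. c i) = (\<Oplus>\<^bsub>M\<^esub>i\<in>I. a \<odot>\<^bsub>M\<^esub> c i)"
  using assms
proof (induction I)
  case (insert i I)
  then have "(\<lambda>i. a \<odot>\<^bsub>M\<^esub> c i) \<in> I \<rightarrow> carrier M" by auto
  with insert show ?case by (simp add: smult_r_distr)
qed simp

text \<open>Negation is the action of minus one, so closure under it is automatic. From here on a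
  submodule is verified through zero, sums and scalars alone.\<close>

lemma submodule_iff:
  "submodule U A M \<longleftrightarrow> U \<subseteq> carrier M \<and> \<zero>\<^bsub>M\<^esub> \<in> U \<and> (\<forall>x\<in>U. \<forall>y\<in>U. x \<oplus>\<^bsub>M\<^esub> y \<in> U) \<and>
     (\<forall>a\<in>carrier A. \<forall>x\<in>U. a \<odot>\<^bsub>M\<^esub> x \<in> U)"
proof
  assume "submodule U A M"
  then interpret U: submodule U A M .
  show "U \<subseteq> carrier M \<and> \<zero>\<^bsub>M\<^esub> \<in> U \<and> (\<forall>x\<in>U. \<forall>y\<in>U. x \<oplus>\<^bsub>M\<^esub> y \<in> U) \<and>
     (\<forall>a\<in>carrier A. \<forall>x\<in>U. a \<odot>\<^bsub>M\<^esub> x \<in> U)"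
    using U.subset U.one_closed U.m_closed by auto
next
  assume *: "U \<subseteq> carrier M \<and> \<zero>\<^bsub>M\<^esub> \<in> U \<and> (\<forall>x\<in>U. \<forall>y\<in>U. x \<oplus>\<^bsub>M\<^esub> y \<in> U) \<and>
     (\<forall>a\<in>carrier A. \<forall>x\<in>U. a \<odot>\<^bsub>M\<^esub> x \<in> U)"
  then have neg: "\<ominus>\<^bsub>M\<^esub> x \<in> U" if "x \<in> U" for x
    using that smult_minus_one[of x] by (metis R.a_inv_closed R.one_closed subsetD)
  have "subgroup U (add_monoid M)"
    by (rule M.add.subgroupI) (use * neg in auto)
  then show "submodule U A M"
    using * by (simp add: submodule_def submodule_axioms_def)
qed

lemma submodule_minus:
  assumes "submodule U A M" "x \<in> U"
  shows "\<ominus>\<^bsub>M\<^esub> x \<in> U"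
proof -
  have "x \<in> carrier M" "(\<ominus>\<^bsub>A\<^esub> \<one>\<^bsub>A\<^esub>) \<odot>\<^bsub>M\<^esub> x \<in> U"
    using assms by (auto simp: submodule_iff)
  then show ?thesis by (simp add: smult_minus_one)
qed

lemma submodule_diff:
  assumes "submodule U A M" "x \<in> U" "y \<in> U"
  shows "x \<ominus>\<^bsub>M\<^esub> y \<in> U"
  using assms submodule_minus[of U y] by (simp add: a_minus_def submodule_iff)

lemma submodule_diff_cancel:
  assumes U: "submodule U A M" and x: "x \<in> carrier M" and y: "y \<in> U" and d: "x \<ominus>\<^bsub>M\<^esub> y \<in> U"
  shows "x \<in> U"
proof -
  have "y \<in> carrier M" using U y by (auto simp: submodule_iff)
  then have "(x \<ominus>\<^bsub>M\<^esub> y) \<oplus>\<^bsub>M\<^esub> y = x"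
    using x by (simp add: a_minus_def M.a_assoc M.l_neg)
  moreover have "(x \<ominus>\<^bsub>M\<^esub> y) \<oplus>\<^bsub>M\<^esub> y \<in> U" using U y d by (simp add: submodule_iff)
  ultimately show ?thesis by (rule back_subst[of "\<lambda>z. z \<in> U", rotated])
qed

lemma diff_eq_zero_iff:
  assumes "x \<in> carrier M" "y \<in> carrier M"
  shows "x \<ominus>\<^bsub>M\<^esub> y = \<zero>\<^bsub>M\<^esub> \<longleftrightarrow> x = y"
proof
  assume "x \<ominus>\<^bsub>M\<^esub> y = \<zero>\<^bsub>M\<^esub>"
  then have "\<ominus>\<^bsub>M\<^esub> (\<ominus>\<^bsub>M\<^esub> y) = x"
    using assms by (intro M.minus_equality) (auto simp: a_minus_def)
  then show "x = y" using assms by simp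
qed (use assms in \<open>simp add: a_minus_def M.r_neg\<close>)

lemma smult_minus:
  assumes "a \<in> carrier A" "y \<in> carrier M"
  shows "a \<odot>\<^bsub>M\<^esub> (\<ominus>\<^bsub>M\<^esub> y) = \<ominus>\<^bsub>M\<^esub> (a \<odot>\<^bsub>M\<^esub> y)"
proof -
  have "a \<odot>\<^bsub>M\<^esub> (\<ominus>\<^bsub>M\<^esub> y) \<oplus>\<^bsub>M\<^esub> a \<odot>\<^bsub>M\<^esub> y = \<zero>\<^bsub>M\<^esub>"
    using assms by (simp add: M.l_neg flip: smult_r_distr)
  then show ?thesis using assms M.minus_equality by auto
qed

lemma add_diff_cancel:
  assumes "x \<in> carrier M" "y \<in> carrier M"
  shows "(x \<oplus>\<^bsub>M\<^esub> y) \<ominus>\<^bsub>M\<^esub> x = y"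
  using assms M.a_comm[of x y] by (simp add: a_minus_def M.a_assoc M.r_neg)

lemma add_diff:
  assumes "x \<in> carrier M" "y \<in> carrier M"
  shows "x \<oplus>\<^bsub>M\<^esub> (y \<ominus>\<^bsub>M\<^esub> x) = y"
  using assms M.a_comm[of y "\<ominus>\<^bsub>M\<^esub> x"] by (simp add: a_minus_def M.r_neg2)

lemma diff_zero: "x \<in> carrier M \<Longrightarrow> x \<ominus>\<^bsub>M\<^esub> \<zero>\<^bsub>M\<^esub> = x"
  using add_diff[of "\<zero>\<^bsub>M\<^esub>" x] M.minus_closed[of x "\<zero>\<^bsub>M\<^esub>"] by simp

lemma submodule_finsum:
  assumes U: "submodule U A M" and "finite I" "c \<in> I \<rightarrow> U"
  shows "(\<Oplus>\<^bsub>M\<^esub>i\<in>I. c i) \<in> U"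
  using assms(2,3)
proof (induction I)
  case empty
  then show ?case using U by (simp add: submodule_iff)
next
  case (insert i I)
  then have "c \<in> I \<rightarrow> carrier M" "c i \<in> carrier M" using U by (auto simp: submodule_iff)
  with insert show ?case using U by (simp add: submodule_iff)
qed

lemma rmodule_submodule:
  assumes "submodule U A M"
  shows "rmodule A (M\<lparr>carrier := U\<rparr>)"
proof -
  have U: "U \<subseteq> carrier M" "\<zero>\<^bsub>M\<^esub> \<in> U" "\<And>x y. x \<in> U \<Longrightarrow> y \<in> U \<Longrightarrow> x \<oplus>\<^bsub>M\<^esub> y \<in> U"
    "\<And>a x. a \<in> carrier A \<Longrightarrow> x \<in> U \<Longrightarrow> a \<odot>\<^bsub>M\<^esub> x \<in> U"
    using assms by (auto simp: submodule_iff)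
  then have [simp]: "x \<in> carrier M" if "x \<in> U" for x using that by auto
  have "abelian_group (M\<lparr>carrier := U\<rparr>)"
  proof (rule abelian_groupI)
    fix x assume "x \<in> carrier (M\<lparr>carrier := U\<rparr>)"
    then show "\<exists>y\<in>carrier (M\<lparr>carrier := U\<rparr>). y \<oplus>\<^bsub>M\<lparr>carrier := U\<rparr>\<^esub> x = \<zero>\<^bsub>M\<lparr>carrier := U\<rparr>\<^esub>"
      using submodule_minus[OF assms] by (auto simp: M.l_neg intro!: bexI[of _ "\<ominus>\<^bsub>M\<^esub> x"])
  qed (use U in \<open>auto simp: M.add.m_ac\<close>)
  moreover have "rmodule_axioms A (M\<lparr>carrier := U\<rparr>)"
    by unfold_locales (use U in \<open>auto simp: smult_l_distr smult_r_distr smult_assoc\<close>)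
  ultimately show ?thesis by (simp add: rmodule_def R.ring_axioms)
qed

lemma submodule_carrier: "submodule (carrier M) A M"
  by (auto simp: submodule_iff)

lemma submodule_zero: "submodule {\<zero>\<^bsub>M\<^esub>} A M"
  by (auto simp: submodule_iff)

lemma submodule_Int:
  assumes "submodule U A M" "submodule V A M"
  shows "submodule (U \<inter> V) A M"
  using assms by (auto simp: submodule_iff)

lemma submodule_Inter:
  assumes "\<And>U. U \<in> \<U> \<Longrightarrow> submodule U A M" "\<U> \<noteq> {}"
  shows "submodule (\<Inter>\<U>) A M"
proof -
  obtain V where "V \<in> \<U>" using assms(2) by auto
  then show ?thesis using assms(1) unfolding submodule_iff by blast
qed

lemma submodule_set_add:
  assumes "submodule U A M" "submodule V A M"
  shows "submodule (U <+>\<^bsub>M\<^esub> V) A M"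
proof -
  have U: "U \<subseteq> carrier M" "\<zero>\<^bsub>M\<^esub> \<in> U" "\<And>x y. x \<in> U \<Longrightarrow> y \<in> U \<Longrightarrow> x \<oplus>\<^bsub>M\<^esub> y \<in> U"
    "\<And>a x. a \<in> carrier A \<Longrightarrow> x \<in> U \<Longrightarrow> a \<odot>\<^bsub>M\<^esub> x \<in> U"
    and V: "V \<subseteq> carrier M" "\<zero>\<^bsub>M\<^esub> \<in> V" "\<And>x y. x \<in> V \<Longrightarrow> y \<in> V \<Longrightarrow> x \<oplus>\<^bsub>M\<^esub> y \<in> V"
    "\<And>a x. a \<in> carrier A \<Longrightarrow> x \<in> V \<Longrightarrow> a \<odot>\<^bsub>M\<^esub> x \<in> V"
    using assms by (auto simp: submodule_iff)
  have add: "(u \<oplus>\<^bsub>M\<^esub> v) \<oplus>\<^bsub>M\<^esub> (u' \<oplus>\<^bsub>M\<^esub> v') = (u \<oplus>\<^bsub>M\<^esub> u') \<oplus>\<^bsub>M\<^esub> (v \<oplus>\<^bsub>M\<^esub> v')"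
    if "u \<in> U" "u' \<in> U" "v \<in> V" "v' \<in> V" for u v u' v'
  proof -
    have "u \<in> carrier M" "u' \<in> carrier M" "v \<in> carrier M" "v' \<in> carrier M"
      using that U V by auto
    then show ?thesis by (simp add: M.add.m_ac)
  qed
  have sm: "a \<odot>\<^bsub>M\<^esub> (u \<oplus>\<^bsub>M\<^esub> v) = a \<odot>\<^bsub>M\<^esub> u \<oplus>\<^bsub>M\<^esub> a \<odot>\<^bsub>M\<^esub> v"
    if "a \<in> carrier A" "u \<in> U" "v \<in> V" for a u v
    using that U V by (intro smult_r_distr) auto
  show ?thesis
    unfolding submodule_iff
  proof (intro conjI ballI subsetI)
    fix x assume "x \<in> U <+>\<^bsub>M\<^esub> V"
    then show "x \<in> carrier M" using U(1) V(1) by (auto simp: mem_set_add)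
  next
    show "\<zero>\<^bsub>M\<^esub> \<in> U <+>\<^bsub>M\<^esub> V"
      unfolding mem_set_add using U(2) V(2) by (intro bexI[of _ "\<zero>\<^bsub>M\<^esub>"]) auto
  next
    fix x y assume "x \<in> U <+>\<^bsub>M\<^esub> V" "y \<in> U <+>\<^bsub>M\<^esub> V"
    then obtain u v u' v' where *: "u \<in> U" "v \<in> V" "u' \<in> U" "v' \<in> V"
      "x = u \<oplus>\<^bsub>M\<^esub> v" "y = u' \<oplus>\<^bsub>M\<^esub> v'" by (auto simp: mem_set_add)
    then show "x \<oplus>\<^bsub>M\<^esub> y \<in> U <+>\<^bsub>M\<^esub> V"
      unfolding mem_set_add
      by (intro bexI[of _ "u \<oplus>\<^bsub>M\<^esub> u'"] bexI[of _ "v \<oplus>\<^bsub>M\<^esub> v'"]) (simp_all add: add U(3) V(3))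
  next
    fix a x assume a: "a \<in> carrier A" and "x \<in> U <+>\<^bsub>M\<^esub> V"
    then obtain u v where *: "u \<in> U" "v \<in> V" "x = u \<oplus>\<^bsub>M\<^esub> v" by (auto simp: mem_set_add)
    then show "a \<odot>\<^bsub>M\<^esub> x \<in> U <+>\<^bsub>M\<^esub> V"
      unfolding mem_set_add using a
      by (intro bexI[of _ "a \<odot>\<^bsub>M\<^esub> u"] bexI[of _ "a \<odot>\<^bsub>M\<^esub> v"]) (simp_all add: sm U(4) V(4))
  qed
qed

end

section \<open>Homomorphisms, their images, kernels and differences\<close>

lemma mem_a_kernel: "x \<in> a_kernel M N f \<longleftrightarrow> x \<in> carrier M \<and> f x = \<zero>\<^bsub>N\<^esub>"
  by (auto simp: a_kernel_def kernel_def)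

lemma mod_Hom_closed: "f \<in> mod_Hom A M N \<Longrightarrow> x \<in> carrier M \<Longrightarrow> f x \<in> carrier N"
  by (auto simp: mod_Hom_def)

lemma mod_Hom_add:
  "f \<in> mod_Hom A M N \<Longrightarrow> x \<in> carrier M \<Longrightarrow> y \<in> carrier M \<Longrightarrow> f (x \<oplus>\<^bsub>M\<^esub> y) = f x \<oplus>\<^bsub>N\<^esub> f y"
  by (auto simp: mod_Hom_def)

lemma mod_Hom_smult:
  "f \<in> mod_Hom A M N \<Longrightarrow> a \<in> carrier A \<Longrightarrow> x \<in> carrier M \<Longrightarrow> f (a \<odot>\<^bsub>M\<^esub> x) = a \<odot>\<^bsub>N\<^esub> f x"
  by (auto simp: mod_Hom_def)

lemma mod_Hom_eqI:
  assumes "f \<in> mod_Hom A M N" "f' \<in> mod_Hom A M N'" "\<And>x. x \<in> carrier M \<Longrightarrow> f x = f' x"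
  shows "f = f'"
  using assms by (intro extensionalityI[of _ "carrier M"]) (auto simp: mod_Hom_def PiE_def)

lemma mod_HomI:
  assumes "rmodule A M" "\<And>x. x \<in> carrier M \<Longrightarrow> f x \<in> carrier N"
    "\<And>x y. x \<in> carrier M \<Longrightarrow> y \<in> carrier M \<Longrightarrow> f (x \<oplus>\<^bsub>M\<^esub> y) = f x \<oplus>\<^bsub>N\<^esub> f y"
    "\<And>a x. a \<in> carrier A \<Longrightarrow> x \<in> carrier M \<Longrightarrow> f (a \<odot>\<^bsub>M\<^esub> x) = a \<odot>\<^bsub>N\<^esub> f x"
  shows "(\<lambda>x\<in>carrier M. f x) \<in> mod_Hom A M N"
proof -
  interpret M: rmodule A M by fact
  show ?thesis using assms(2-) by (auto simp: mod_Hom_def)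
qed

lemma mod_Hom_compose:
  assumes "f \<in> mod_Hom A L M" "g \<in> mod_Hom A M N" "rmodule A L"
  shows "compose (carrier L) g f \<in> mod_Hom A L N"
proof -
  have "f x \<in> carrier M" if "x \<in> carrier L" for x
    using that assms(1) by (rule mod_Hom_closed[rotated])
  then show ?thesis
    unfolding compose_def using assms
    by (intro mod_HomI) (simp_all add: mod_Hom_add mod_Hom_smult mod_Hom_closed)
qed

lemma mod_Hom_id: "rmodule A M \<Longrightarrow> (\<lambda>x\<in>carrier M. x) \<in> mod_Hom A M M"
  by (rule mod_HomI) auto

lemma mod_Hom_zero_map:
  assumes "rmodule A M" "rmodule A N"
  shows "zero_map M N \<in> mod_Hom A M N"
proof -
  interpret N: rmodule A N by fact
  show ?thesis unfolding zero_map_def by (rule mod_HomI[OF assms(1)]) auto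
qed

text \<open>An extensional function records its domain but not its codomain, so a map into a
  submodule is literally a map into the whole module.\<close>

lemma mod_Hom_mono:
  assumes "f \<in> mod_Hom A M (N\<lparr>carrier := U\<rparr>)" "U \<subseteq> carrier N"
  shows "f \<in> mod_Hom A M N"
  using assms by (auto simp: mod_Hom_def PiE_def)

lemma mod_Hom_restrict:
  assumes "f \<in> mod_Hom A M N" "submodule U A M" "rmodule A M"
  shows "restrict f U \<in> mod_Hom A (M\<lparr>carrier := U\<rparr>) N"
proof -
  interpret M: rmodule A M by fact
  show ?thesis using assms(1,2) by (auto simp: mod_Hom_def M.submodule_iff subset_iff)
qed

locale rmodule_hom = M: rmodule A M + N: rmodule A N
  for A :: "'a ring" and M :: "('a, 'm) module" and N :: "('a, 'n) module" +
  fixes f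
  assumes hom: "f \<in> mod_Hom A M N"
begin

lemmas closed [simp, intro] = mod_Hom_closed[OF hom]
lemmas add = mod_Hom_add[OF hom]
lemmas smult = mod_Hom_smult[OF hom]

lemma zero [simp]: "f \<zero>\<^bsub>M\<^esub> = \<zero>\<^bsub>N\<^esub>"
  using add[of "\<zero>\<^bsub>M\<^esub>" "\<zero>\<^bsub>M\<^esub>"] closed[of "\<zero>\<^bsub>M\<^esub>"] by (simp add: N.M.add.r_cancel_one')

lemma minus: "x \<in> carrier M \<Longrightarrow> f (\<ominus>\<^bsub>M\<^esub> x) = \<ominus>\<^bsub>N\<^esub> f x"
  using add[of "\<ominus>\<^bsub>M\<^esub> x" x] by (simp add: M.M.l_neg N.M.minus_equality)

lemma diff: "x \<in> carrier M \<Longrightarrow> y \<in> carrier M \<Longrightarrow> f (x \<ominus>\<^bsub>M\<^esub> y) = f x \<ominus>\<^bsub>N\<^esub> f y"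
  by (simp add: a_minus_def add minus)

lemma finsum:
  assumes "finite I" "c \<in> I \<rightarrow> carrier M"
  shows "f (\<Oplus>\<^bsub>M\<^esub>i\<in>I. c i) = (\<Oplus>\<^bsub>N\<^esub>i\<in>I. f (c i))"
  using assms
proof (induction I)
  case (insert i I)
  then have "(\<lambda>i. f (c i)) \<in> I \<rightarrow> carrier N" by auto
  with insert show ?case by (simp add: add)
qed simp

lemma submodule_image:
  assumes "submodule U A M"
  shows "submodule (f ` U) A N"
proof -
  have U: "U \<subseteq> carrier M" "\<zero>\<^bsub>M\<^esub> \<in> U" "\<And>x y. x \<in> U \<Longrightarrow> y \<in> U \<Longrightarrow> x \<oplus>\<^bsub>M\<^esub> y \<in> U"
    "\<And>a x. a \<in> carrier A \<Longrightarrow> x \<in> U \<Longrightarrow> a \<odot>\<^bsub>M\<^esub> x \<in> U"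
    using assms by (auto simp: M.submodule_iff)
  show ?thesis
    unfolding N.submodule_iff
  proof (intro conjI ballI)
    show "f ` U \<subseteq> carrier N" using U by auto
    show "\<zero>\<^bsub>N\<^esub> \<in> f ` U" using U(2) zero by (metis imageI)
  next
    fix x y assume "x \<in> f ` U" "y \<in> f ` U"
    then obtain u v where *: "u \<in> U" "v \<in> U" "x = f u" "y = f v" by auto
    then have "x \<oplus>\<^bsub>N\<^esub> y = f (u \<oplus>\<^bsub>M\<^esub> v)" using U(1) by (simp add: add subset_iff)
    then show "x \<oplus>\<^bsub>N\<^esub> y \<in> f ` U" using * U by auto
  next
    fix a x assume a: "a \<in> carrier A" and "x \<in> f ` U"
    then obtain u where *: "u \<in> U" "x = f u" by auto
    then have "a \<odot>\<^bsub>N\<^esub> x = f (a \<odot>\<^bsub>M\<^esub> u)" using a U(1) by (simp add: smult subset_iff)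
    then show "a \<odot>\<^bsub>N\<^esub> x \<in> f ` U" using * a U by auto
  qed
qed

lemma submodule_preimage:
  assumes "submodule V A N"
  shows "submodule {x \<in> carrier M. f x \<in> V} A M"
  using assms by (auto simp: M.submodule_iff N.submodule_iff add smult)

lemma submodule_kernel: "submodule (a_kernel M N f) A M"
  using submodule_preimage[OF N.submodule_zero] by (simp add: a_kernel_def kernel_def)

lemma inj_iff: "inj_on f (carrier M) \<longleftrightarrow> (\<forall>x\<in>carrier M. f x = \<zero>\<^bsub>N\<^esub> \<longrightarrow> x = \<zero>\<^bsub>M\<^esub>)"
proof
  assume *: "\<forall>x\<in>carrier M. f x = \<zero>\<^bsub>N\<^esub> \<longrightarrow> x = \<zero>\<^bsub>M\<^esub>"
  show "inj_on f (carrier M)"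
  proof (rule inj_onI)
    fix x y assume xy: "x \<in> carrier M" "y \<in> carrier M" "f x = f y"
    then have "f (x \<ominus>\<^bsub>M\<^esub> y) = \<zero>\<^bsub>N\<^esub>" by (simp add: diff N.diff_eq_zero_iff)
    then have "x \<ominus>\<^bsub>M\<^esub> y = \<zero>\<^bsub>M\<^esub>" using * xy by (simp add: M.M.minus_closed)
    then show "x = y" using xy by (simp add: M.diff_eq_zero_iff)
  qed
next
  assume "inj_on f (carrier M)"
  then show "\<forall>x\<in>carrier M. f x = \<zero>\<^bsub>N\<^esub> \<longrightarrow> x = \<zero>\<^bsub>M\<^esub>"
    by (metis M.M.zero_closed inj_onD zero)
qed

end

lemma rmodule_homI:
  "rmodule A M \<Longrightarrow> rmodule A N \<Longrightarrow> f \<in> mod_Hom A M N \<Longrightarrow> rmodule_hom A M N f"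
  by (simp add: rmodule_hom_def rmodule_hom_axioms_def)

lemma mod_Hom_plus:
  assumes M: "rmodule A M" and N: "rmodule A N" and f: "f \<in> mod_Hom A M N" and f': "f' \<in> mod_Hom A M N"
  shows "(\<lambda>x\<in>carrier M. f x \<oplus>\<^bsub>N\<^esub> f' x) \<in> mod_Hom A M N"
proof -
  interpret f: rmodule_hom A M N f using M N f by (rule rmodule_homI)
  interpret f': rmodule_hom A M N f' using M N f' by (rule rmodule_homI)
  show ?thesis
    by (rule mod_HomI[OF M])
      (simp_all add: f.add f'.add f.smult f'.smult f.N.smult_r_distr f.N.M.add.m_ac)
qed

lemma mod_Hom_minus:
  assumes M: "rmodule A M" and N: "rmodule A N" and f: "f \<in> mod_Hom A M N"
  shows "(\<lambda>x\<in>carrier M. \<ominus>\<^bsub>N\<^esub> f x) \<in> mod_Hom A M N"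
proof -
  interpret f: rmodule_hom A M N f using M N f by (rule rmodule_homI)
  show ?thesis
    by (rule mod_HomI[OF M])
      (simp_all add: f.add f.smult f.N.smult_minus f.N.M.minus_add)
qed

lemma mod_Hom_diff:
  assumes M: "rmodule A M" and N: "rmodule A N" and f: "f \<in> mod_Hom A M N" and f': "f' \<in> mod_Hom A M N"
  shows "(\<lambda>x\<in>carrier M. f x \<ominus>\<^bsub>N\<^esub> f' x) \<in> mod_Hom A M N"
  using mod_Hom_plus[OF M N f mod_Hom_minus[OF M N f']]
  by (simp add: a_minus_def cong: restrict_cong)

lemma mod_iso_inverse:
  assumes "f \<in> mod_iso A M N" "rmodule A M" "rmodule A N"
  shows "(\<lambda>y\<in>carrier N. inv_into (carrier M) f y) \<in> mod_iso A N M"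
proof -
  have f: "f \<in> mod_Hom A M N" and bij: "bij_betw f (carrier M) (carrier N)"
    using assms(1) by (auto simp: mod_iso_def)
  interpret rmodule_hom A M N f using assms f by (intro rmodule_homI)
  let ?h = "inv_into (carrier M) f"
  have h: "?h y \<in> carrier M" "f (?h y) = y" if "y \<in> carrier N" for y
    using that bij by (auto simp: bij_betw_def inv_into_into f_inv_into_f)
  have hf: "?h (f x) = x" if "x \<in> carrier M" for x
    using that bij by (simp add: bij_betw_def)
  have "(\<lambda>y\<in>carrier N. ?h y) \<in> mod_Hom A N M"
  proof (rule mod_HomI[OF assms(3)])
    fix x y assume "x \<in> carrier N" "y \<in> carrier N"
    then show "?h (x \<oplus>\<^bsub>N\<^esub> y) = ?h x \<oplus>\<^bsub>M\<^esub> ?h y"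
      using hf[of "?h x \<oplus>\<^bsub>M\<^esub> ?h y"] by (simp add: h add)
  next
    fix a x assume "a \<in> carrier A" "x \<in> carrier N"
    then show "?h (a \<odot>\<^bsub>N\<^esub> x) = a \<odot>\<^bsub>M\<^esub> ?h x"
      using hf[of "a \<odot>\<^bsub>M\<^esub> ?h x"] by (simp add: h smult)
  qed (simp add: h)
  moreover have "bij_betw ?h (carrier N) (carrier M)"
    using bij by (rule bij_betw_inv_into)
  ultimately show ?thesis
    by (auto simp: mod_iso_def cong: bij_betw_cong)
qed

section \<open>Opposite rings, regular modules, direct sums and duals\<close>

lemma op_ring_simps [simp]:
  "carrier (op_ring A) = carrier A" "x \<otimes>\<^bsub>op_ring A\<^esub> y = y \<otimes>\<^bsub>A\<^esub> x"
  "\<one>\<^bsub>op_ring A\<^esub> = \<one>\<^bsub>A\<^esub>" "\<zero>\<^bsub>op_ring A\<^esub> = \<zero>\<^bsub>A\<^esub>" "x \<oplus>\<^bsub>op_ring A\<^esub> y = x \<oplus>\<^bsub>A\<^esub> y"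
  by (simp_all add: op_ring_def)

lemma op_op_ring [simp]: "op_ring (op_ring A) = A"
  by (simp add: op_ring_def)

lemma ring_op_ring:
  assumes "ring A"
  shows "ring (op_ring A)"
proof -
  interpret ring A by (rule assms)
  show ?thesis
  proof (rule ringI)
    show "abelian_group (op_ring A)"
    proof (rule abelian_groupI)
      fix x assume "x \<in> carrier (op_ring A)"
      then show "\<exists>y\<in>carrier (op_ring A). y \<oplus>\<^bsub>op_ring A\<^esub> x = \<zero>\<^bsub>op_ring A\<^esub>"
        by (auto simp: l_neg intro!: bexI[of _ "\<ominus>\<^bsub>A\<^esub> x"])
    qed (auto simp: add.m_ac)
    show "monoid (op_ring A)"
      by (rule monoidI) (auto simp: m_assoc)
  qed (auto simp: l_distr r_distr)
qed

lemma regular_module_simps [simp]: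
  "carrier (regular_module A) = carrier A" "\<zero>\<^bsub>regular_module A\<^esub> = \<zero>\<^bsub>A\<^esub>"
  "x \<oplus>\<^bsub>regular_module A\<^esub> y = x \<oplus>\<^bsub>A\<^esub> y" "a \<odot>\<^bsub>regular_module A\<^esub> x = x \<otimes>\<^bsub>A\<^esub> a"
  by (simp_all add: regular_module_def)

lemma rmodule_regular_module:
  assumes "ring A"
  shows "rmodule A (regular_module A)"
proof -
  interpret ring A by (rule assms)
  have "abelian_group (regular_module A)"
  proof (rule abelian_groupI)
    fix x assume "x \<in> carrier (regular_module A)"
    then show "\<exists>y\<in>carrier (regular_module A). y \<oplus>\<^bsub>regular_module A\<^esub> x = \<zero>\<^bsub>regular_module A\<^esub>"
      by (auto simp: l_neg intro!: bexI[of _ "\<ominus>\<^bsub>A\<^esub> x"])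
  qed (auto simp: add.m_ac)
  moreover have "rmodule_axioms A (regular_module A)"
    by unfold_locales (auto simp: l_distr r_distr m_assoc)
  ultimately show ?thesis by (simp add: rmodule_def assms)
qed

lemma zero_module_simps [simp]:
  "carrier zero_module = {()}" "\<zero>\<^bsub>zero_module\<^esub> = ()"
  by (simp_all add: zero_module_def)

lemma rmodule_zero_module:
  assumes "ring A"
  shows "rmodule A zero_module"
proof -
  have "abelian_group zero_module"
    by (rule abelian_groupI) (auto simp: zero_module_def)
  moreover have "rmodule_axioms A zero_module"
    by unfold_locales (auto simp: zero_module_def)
  ultimately show ?thesis by (simp add: rmodule_def assms)
qed

lemma dsum_module_simps [simp]:
  "carrier (dsum_module M N) = carrier M \<times> carrier N"
  "\<zero>\<^bsub>dsum_module M N\<^esub> = (\<zero>\<^bsub>M\<^esub>, \<zero>\<^bsub>N\<^esub>)"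
  "(x, y) \<oplus>\<^bsub>dsum_module M N\<^esub> (x', y') = (x \<oplus>\<^bsub>M\<^esub> x', y \<oplus>\<^bsub>N\<^esub> y')"
  "a \<odot>\<^bsub>dsum_module M N\<^esub> (x, y) = (a \<odot>\<^bsub>M\<^esub> x, a \<odot>\<^bsub>N\<^esub> y)"
  by (simp_all add: dsum_module_def)

lemma rmodule_dsum_module:
  assumes "rmodule A M" "rmodule A N"
  shows "rmodule A (dsum_module M N)"
proof -
  interpret M: rmodule A M by fact
  interpret N: rmodule A N by fact
  have "abelian_group (dsum_module M N)"
  proof (rule abelian_groupI)
    fix p assume "p \<in> carrier (dsum_module M N)"
    then show "\<exists>q\<in>carrier (dsum_module M N). q \<oplus>\<^bsub>dsum_module M N\<^esub> p = \<zero>\<^bsub>dsum_module M N\<^esub>"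
      by (auto simp: M.M.l_neg N.M.l_neg
          intro!: bexI[of _ "\<ominus>\<^bsub>M\<^esub> fst p"] bexI[of _ "\<ominus>\<^bsub>N\<^esub> snd p"])
  qed (auto simp: M.M.add.m_ac N.M.add.m_ac)
  moreover have "rmodule_axioms A (dsum_module M N)"
    by unfold_locales
      (auto simp: M.smult_l_distr N.smult_l_distr M.smult_r_distr N.smult_r_distr
        M.smult_assoc N.smult_assoc)
  ultimately show ?thesis by (simp add: rmodule_def M.R.ring_axioms)
qed

lemma dsum_fst_hom: "rmodule A M \<Longrightarrow> rmodule A N \<Longrightarrow>
  (\<lambda>z\<in>carrier (dsum_module M N). fst z) \<in> mod_Hom A (dsum_module M N) M"
  by (rule mod_HomI[OF rmodule_dsum_module]) auto

lemma dsum_snd_hom: "rmodule A M \<Longrightarrow> rmodule A N \<Longrightarrow>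
  (\<lambda>z\<in>carrier (dsum_module M N). snd z) \<in> mod_Hom A (dsum_module M N) N"
  by (rule mod_HomI[OF rmodule_dsum_module]) auto

lemma dsum_pair_hom:
  assumes "rmodule A L" "f \<in> mod_Hom A L M" "f' \<in> mod_Hom A L N"
  shows "(\<lambda>x\<in>carrier L. (f x, f' x)) \<in> mod_Hom A L (dsum_module M N)"
  by (rule mod_HomI[OF assms(1)])
    (use assms(2,3) in \<open>simp_all add: mod_Hom_closed mod_Hom_add mod_Hom_smult\<close>)

lemma dsum_case_hom:
  assumes M: "rmodule A M" and N: "rmodule A N" and L: "rmodule A L"
    and f: "f \<in> mod_Hom A M L" and f': "f' \<in> mod_Hom A N L"
  shows "(\<lambda>z\<in>carrier (dsum_module M N). f (fst z) \<oplus>\<^bsub>L\<^esub> f' (snd z)) \<in> mod_Hom A (dsum_module M N) L"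
proof -
  interpret L: rmodule A L by (rule L)
  have "compose (carrier (dsum_module M N)) f (\<lambda>z\<in>carrier (dsum_module M N). fst z)
      \<in> mod_Hom A (dsum_module M N) L"
    by (rule mod_Hom_compose[OF dsum_fst_hom[OF M N] f rmodule_dsum_module[OF M N]])
  moreover have "compose (carrier (dsum_module M N)) f' (\<lambda>z\<in>carrier (dsum_module M N). snd z)
      \<in> mod_Hom A (dsum_module M N) L"
    by (rule mod_Hom_compose[OF dsum_snd_hom[OF M N] f' rmodule_dsum_module[OF M N]])
  ultimately show ?thesis
    using mod_Hom_plus[OF rmodule_dsum_module[OF M N] L]
    by (fastforce simp: compose_def cong: restrict_cong)
qed

lemma dual_module_simps [simp]:
  "carrier (dual_module A M) = mod_Hom A M (regular_module A)"
  "\<zero>\<^bsub>dual_module A M\<^esub> = (\<lambda>x\<in>carrier M. \<zero>\<^bsub>A\<^esub>)"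
  "f \<oplus>\<^bsub>dual_module A M\<^esub> f' = (\<lambda>x\<in>carrier M. f x \<oplus>\<^bsub>A\<^esub> f' x)"
  "a \<odot>\<^bsub>dual_module A M\<^esub> f = (\<lambda>x\<in>carrier M. a \<otimes>\<^bsub>A\<^esub> f x)"
  by (simp_all add: dual_module_def)

text \<open>The action multiplies values on the left, where it is compatible with right linearity by
  associativity. Additive inverses come from the action of minus one.\<close>

lemma rmodule_dual_module:
  assumes "rmodule A M"
  shows "rmodule (op_ring A) (dual_module A M)"
proof -
  interpret M: rmodule A M by fact
  interpret Reg: rmodule A "regular_module A" by (rule rmodule_regular_module[OF M.R.ring_axioms])
  let ?D = "dual_module A M"
  have cl: "f x \<in> carrier A" if "f \<in> mod_Hom A M (regular_module A)" "x \<in> carrier M" for f x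
    using mod_Hom_closed[OF that] by simp
  have hom: "f (x \<oplus>\<^bsub>M\<^esub> y) = f x \<oplus>\<^bsub>A\<^esub> f y"
    if "f \<in> mod_Hom A M (regular_module A)" "x \<in> carrier M" "y \<in> carrier M" for f x y
    using mod_Hom_add[OF that] by simp
  have hom': "f (a \<odot>\<^bsub>M\<^esub> x) = f x \<otimes>\<^bsub>A\<^esub> a"
    if "f \<in> mod_Hom A M (regular_module A)" "a \<in> carrier A" "x \<in> carrier M" for f a x
    using mod_Hom_smult[OF that] by simp
  have zero: "(\<lambda>x\<in>carrier M. \<zero>\<^bsub>A\<^esub>) \<in> mod_Hom A M (regular_module A)"
    by (rule mod_HomI[OF assms]) auto
  have add: "(\<lambda>x\<in>carrier M. f x \<oplus>\<^bsub>A\<^esub> f' x) \<in> mod_Hom A M (regular_module A)"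
    if "f \<in> mod_Hom A M (regular_module A)" "f' \<in> mod_Hom A M (regular_module A)" for f f'
    by (rule mod_HomI[OF assms])
      (use that in \<open>auto simp: cl hom hom' M.R.add.m_ac M.R.l_distr\<close>)
  have smult: "(\<lambda>x\<in>carrier M. a \<otimes>\<^bsub>A\<^esub> f x) \<in> mod_Hom A M (regular_module A)"
    if "f \<in> mod_Hom A M (regular_module A)" "a \<in> carrier A" for f a
    by (rule mod_HomI[OF assms])
      (use that in \<open>auto simp: cl hom hom' M.R.r_distr M.R.m_assoc\<close>)
  have ext: "(\<lambda>x\<in>carrier M. f x) = f" if "f \<in> mod_Hom A M (regular_module A)" for f
    using that by (auto simp: mod_Hom_def PiE_def extensional_restrict)
  have "abelian_group ?D"
  proof (rule abelian_groupI)
    fix f assume f: "f \<in> carrier ?D"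
    have "(\<ominus>\<^bsub>A\<^esub> \<one>\<^bsub>A\<^esub>) \<odot>\<^bsub>?D\<^esub> f \<in> carrier ?D" using f smult by simp
    moreover have "(\<ominus>\<^bsub>A\<^esub> \<one>\<^bsub>A\<^esub>) \<odot>\<^bsub>?D\<^esub> f \<oplus>\<^bsub>?D\<^esub> f = \<zero>\<^bsub>?D\<^esub>"
      using f by (auto simp: cl M.R.l_minus M.R.l_neg intro!: restrict_ext)
    ultimately show "\<exists>f'\<in>carrier ?D. f' \<oplus>\<^bsub>?D\<^esub> f = \<zero>\<^bsub>?D\<^esub>" by blast
  next
    fix f assume f: "f \<in> carrier ?D"
    have "\<zero>\<^bsub>?D\<^esub> \<oplus>\<^bsub>?D\<^esub> f = (\<lambda>x\<in>carrier M. f x)"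
      using f by (auto simp: cl intro!: restrict_ext)
    then show "\<zero>\<^bsub>?D\<^esub> \<oplus>\<^bsub>?D\<^esub> f = f" using f ext by simp
  qed (auto simp: cl zero add M.R.add.m_ac intro!: restrict_ext)
  moreover have "rmodule_axioms (op_ring A) ?D"
  proof
    fix f assume f: "f \<in> carrier ?D"
    have "\<one>\<^bsub>op_ring A\<^esub> \<odot>\<^bsub>?D\<^esub> f = (\<lambda>x\<in>carrier M. f x)"
      using f by (auto simp: cl intro!: restrict_ext)
    then show "\<one>\<^bsub>op_ring A\<^esub> \<odot>\<^bsub>?D\<^esub> f = f" using f ext by simp
  qed (auto simp: cl smult M.R.l_distr M.R.r_distr M.R.m_assoc intro!: restrict_ext)
  ultimately show ?thesis by (simp add: rmodule_def ring_op_ring M.R.ring_axioms)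
qed

section \<open>Restriction of scalars to \<open>R\<close> and the duality \<open>D\<close>\<close>

lemma restrict_scalars_simps [simp]:
  "carrier (restrict_scalars \<phi> M) = carrier M" "\<zero>\<^bsub>restrict_scalars \<phi> M\<^esub> = \<zero>\<^bsub>M\<^esub>"
  "x \<oplus>\<^bsub>restrict_scalars \<phi> M\<^esub> y = x \<oplus>\<^bsub>M\<^esub> y" "r \<odot>\<^bsub>restrict_scalars \<phi> M\<^esub> x = \<phi> r \<odot>\<^bsub>M\<^esub> x"
  by (simp_all add: restrict_scalars_def)

text \<open>The part of an Artin algebra structure that mentions no finiteness. It suffices to form
  \<open>D\<close>, and it is inherited by the opposite ring.\<close>

locale central_ring_map = R: cring R + A: ring A
  for R :: "'r ring" and \<phi> :: "'r \<Rightarrow> 'a" and A :: "'a ring" +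
  assumes hom: "\<phi> \<in> ring_hom R A"
    and central: "\<lbrakk>r \<in> carrier R; a \<in> carrier A\<rbrakk> \<Longrightarrow> \<phi> r \<otimes>\<^bsub>A\<^esub> a = a \<otimes>\<^bsub>A\<^esub> \<phi> r"
begin

lemma \<phi>_closed [simp]: "r \<in> carrier R \<Longrightarrow> \<phi> r \<in> carrier A"
  using hom by (auto simp: ring_hom_def)

lemma \<phi>_simps [simp]:
  "r \<in> carrier R \<Longrightarrow> s \<in> carrier R \<Longrightarrow> \<phi> (r \<oplus>\<^bsub>R\<^esub> s) = \<phi> r \<oplus>\<^bsub>A\<^esub> \<phi> s"
  "r \<in> carrier R \<Longrightarrow> s \<in> carrier R \<Longrightarrow> \<phi> (r \<otimes>\<^bsub>R\<^esub> s) = \<phi> r \<otimes>\<^bsub>A\<^esub> \<phi> s"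
  "\<phi> \<one>\<^bsub>R\<^esub> = \<one>\<^bsub>A\<^esub>"
  using hom by (auto simp: ring_hom_def)

text \<open>A ring homomorphism with central image is multiplicative for the reversed product as
  well.\<close>

lemma central_ring_map_op: "central_ring_map R \<phi> (op_ring A)"
proof -
  interpret Aop: ring "op_ring A" by (rule ring_op_ring[OF A.ring_axioms])
  show ?thesis
  proof
    show "\<phi> \<in> ring_hom R (op_ring A)"
      using central[OF _ \<phi>_closed] by (intro ring_hom_memI) simp_all
    show "\<phi> r \<otimes>\<^bsub>op_ring A\<^esub> a = a \<otimes>\<^bsub>op_ring A\<^esub> \<phi> r"
      if "r \<in> carrier R" "a \<in> carrier (op_ring A)" for r a
      using that central[of r a] by simp
  qed
qed

lemma rmodule_restrict_scalars:
  assumes "rmodule A M"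
  shows "rmodule R (restrict_scalars \<phi> M)"
proof -
  interpret M: rmodule A M by fact
  have "abelian_group (restrict_scalars \<phi> M)"
  proof (rule abelian_groupI)
    fix x assume "x \<in> carrier (restrict_scalars \<phi> M)"
    then show "\<exists>y\<in>carrier (restrict_scalars \<phi> M). y \<oplus>\<^bsub>restrict_scalars \<phi> M\<^esub> x = \<zero>\<^bsub>restrict_scalars \<phi> M\<^esub>"
      by (auto simp: M.M.l_neg intro!: bexI[of _ "\<ominus>\<^bsub>M\<^esub> x"])
  qed (auto simp: M.M.add.m_ac)
  moreover have "rmodule_axioms R (restrict_scalars \<phi> M)"
    by unfold_locales (auto simp: M.smult_l_distr M.smult_r_distr M.smult_assoc)
  ultimately show ?thesis by (simp add: rmodule_def R.ring_axioms)
qed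

lemma mod_Hom_restrict_scalars:
  assumes "f \<in> mod_Hom A M N"
  shows "f \<in> mod_Hom R (restrict_scalars \<phi> M) (restrict_scalars \<phi> N)"
  using assms by (auto simp: mod_Hom_def)

lemma submodule_restrict_scalars:
  assumes "rmodule A M" "submodule U A M"
  shows "submodule U R (restrict_scalars \<phi> M)"
proof -
  interpret M: rmodule A M by fact
  interpret RM: rmodule R "restrict_scalars \<phi> M" by (rule rmodule_restrict_scalars[OF assms(1)])
  show ?thesis using assms(2) unfolding M.submodule_iff RM.submodule_iff by auto
qed

end

lemma D_module_simps [simp]:
  "carrier (D_module R \<phi> E M) = mod_Hom R (restrict_scalars \<phi> M) E"
  "\<zero>\<^bsub>D_module R \<phi> E M\<^esub> = (\<lambda>x\<in>carrier M. \<zero>\<^bsub>E\<^esub>)"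
  "f \<oplus>\<^bsub>D_module R \<phi> E M\<^esub> f' = (\<lambda>x\<in>carrier M. f x \<oplus>\<^bsub>E\<^esub> f' x)"
  "a \<odot>\<^bsub>D_module R \<phi> E M\<^esub> f = (\<lambda>x\<in>carrier M. f (a \<odot>\<^bsub>M\<^esub> x))"
  by (simp_all add: D_module_def)

context central_ring_map
begin

lemma rmodule_D_module:
  assumes M: "rmodule A M" and E: "rmodule R E"
  shows "rmodule (op_ring A) (D_module R \<phi> E M)"
proof -
  interpret M: rmodule A M by fact
  interpret RM: rmodule R "restrict_scalars \<phi> M" by (rule rmodule_restrict_scalars[OF M])
  interpret E: rmodule R E by fact
  let ?D = "D_module R \<phi> E M"
  let ?H = "mod_Hom R (restrict_scalars \<phi> M) E"
  note HI = mod_HomI[OF RM.rmodule_axioms, of _ E, simplified]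
  have cl: "f x \<in> carrier E" if "f \<in> ?H" "x \<in> carrier M" for f x
    using mod_Hom_closed[of f, OF that(1)] that(2) by simp
  have hom: "f (x \<oplus>\<^bsub>M\<^esub> y) = f x \<oplus>\<^bsub>E\<^esub> f y"
    if "f \<in> ?H" "x \<in> carrier M" "y \<in> carrier M" for f x y
    using mod_Hom_add[of f, OF that(1)] that(2,3) by simp
  have hom': "f (\<phi> r \<odot>\<^bsub>M\<^esub> x) = r \<odot>\<^bsub>E\<^esub> f x"
    if "f \<in> ?H" "r \<in> carrier R" "x \<in> carrier M" for f r x
    using mod_Hom_smult[of f, OF that(1)] that(2,3) by simp
  have zero: "(\<lambda>x\<in>carrier M. \<zero>\<^bsub>E\<^esub>) \<in> ?H"
    by (rule HI) auto
  have add: "(\<lambda>x\<in>carrier M. f x \<oplus>\<^bsub>E\<^esub> f' x) \<in> ?H" if "f \<in> ?H" "f' \<in> ?H" for f f'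
    by (rule HI) (use that in \<open>auto simp: cl hom hom' E.M.add.m_ac E.smult_r_distr\<close>)
  have smult: "(\<lambda>x\<in>carrier M. f (a \<odot>\<^bsub>M\<^esub> x)) \<in> ?H" if "f \<in> ?H" "a \<in> carrier A" for f a
  proof (rule HI)
    fix r x assume rx: "r \<in> carrier R" "x \<in> carrier M"
    \<comment> \<open>Centrality moves \<open>\<phi> r\<close> past \<open>a\<close>, so
      precomposition with the action of \<open>a\<close> keeps \<open>R\<close>-linearity.\<close>
    then have "a \<odot>\<^bsub>M\<^esub> (\<phi> r \<odot>\<^bsub>M\<^esub> x) = \<phi> r \<odot>\<^bsub>M\<^esub> (a \<odot>\<^bsub>M\<^esub> x)"
      using that central[of r a] by (simp add: M.smult_assoc[symmetric])
    then show "f (a \<odot>\<^bsub>M\<^esub> (\<phi> r \<odot>\<^bsub>M\<^esub> x)) = r \<odot>\<^bsub>E\<^esub> f (a \<odot>\<^bsub>M\<^esub> x)"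
      using that rx by (simp add: hom')
  qed (use that in \<open>auto simp: cl hom M.smult_r_distr\<close>)
  have ext: "(\<lambda>x\<in>carrier M. f x) = f" if "f \<in> ?H" for f
    using that by (auto simp: mod_Hom_def PiE_def extensional_restrict)
  have "abelian_group ?D"
  proof (rule abelian_groupI)
    fix f assume f: "f \<in> carrier ?D"
    have "(\<lambda>x\<in>carrier M. \<ominus>\<^bsub>E\<^esub> f x) \<in> ?H"
    proof -
      have "(\<lambda>x\<in>carrier M. f ((\<ominus>\<^bsub>A\<^esub> \<one>\<^bsub>A\<^esub>) \<odot>\<^bsub>M\<^esub> x)) \<in> ?H" using f smult by simp
      moreover have "f ((\<ominus>\<^bsub>A\<^esub> \<one>\<^bsub>A\<^esub>) \<odot>\<^bsub>M\<^esub> x) = \<ominus>\<^bsub>E\<^esub> f x" if "x \<in> carrier M" for x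
      proof -
        interpret f: rmodule_hom R "restrict_scalars \<phi> M" E f
          using f by (intro rmodule_homI RM.rmodule_axioms E) auto
        have "f (\<ominus>\<^bsub>M\<^esub> x) \<oplus>\<^bsub>E\<^esub> f x = f (\<ominus>\<^bsub>M\<^esub> x \<oplus>\<^bsub>M\<^esub> x)"
          using that f hom[of f "\<ominus>\<^bsub>M\<^esub> x" x] by simp
        also have "\<dots> = \<zero>\<^bsub>E\<^esub>" using that f.zero by (simp add: M.M.l_neg)
        finally show ?thesis
          using that f cl by (simp add: M.smult_minus_one E.M.minus_equality)
      qed
      ultimately show ?thesis by (simp cong: restrict_cong)
    qed
    moreover have "(\<lambda>x\<in>carrier M. \<ominus>\<^bsub>E\<^esub> f x) \<oplus>\<^bsub>?D\<^esub> f = \<zero>\<^bsub>?D\<^esub>"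
      using f by (auto simp: cl E.M.l_neg intro!: restrict_ext)
    ultimately show "\<exists>f'\<in>carrier ?D. f' \<oplus>\<^bsub>?D\<^esub> f = \<zero>\<^bsub>?D\<^esub>"
      unfolding D_module_simps(1) by blast
  next
    fix f assume f: "f \<in> carrier ?D"
    have "\<zero>\<^bsub>?D\<^esub> \<oplus>\<^bsub>?D\<^esub> f = (\<lambda>x\<in>carrier M. f x)"
      using f by (auto simp: cl intro!: restrict_ext)
    then show "\<zero>\<^bsub>?D\<^esub> \<oplus>\<^bsub>?D\<^esub> f = f" using f ext by simp
  qed (auto simp: cl zero add E.M.add.m_ac intro!: restrict_ext)
  moreover have "rmodule_axioms (op_ring A) ?D"
  proof
    fix f assume f: "f \<in> carrier ?D"
    have "\<one>\<^bsub>op_ring A\<^esub> \<odot>\<^bsub>?D\<^esub> f = (\<lambda>x\<in>carrier M. f x)"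
      using f by (auto intro!: restrict_ext)
    then show "\<one>\<^bsub>op_ring A\<^esub> \<odot>\<^bsub>?D\<^esub> f = f" using f ext by simp
  qed (auto simp: cl smult hom M.smult_l_distr M.smult_assoc intro!: restrict_ext)
  ultimately show ?thesis by (simp add: rmodule_def ring_op_ring A.ring_axioms)
qed

end

section \<open>Dual bases of finitely generated projective modules\<close>

text \<open>The finite data equivalent to being finitely generated and projective. Facts derived
  from it concern modules on arbitrary types, whereas \<open>projective\<close> can only be applied
  to test modules on \<open>'a fgu\<close>.\<close>

locale dual_basis = rmodule A P
  for A :: "'a ring" and P :: "('a, 'p) module" +
  fixes n :: nat and x :: "nat \<Rightarrow> 'p" and f :: "nat \<Rightarrow> 'p \<Rightarrow> 'a"
  assumes x_closed [simp]: "i < n \<Longrightarrow> x i \<in> carrier P"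
    and f_hom: "i < n \<Longrightarrow> f i \<in> mod_Hom A P (regular_module A)"
    and expand: "p \<in> carrier P \<Longrightarrow> (\<Oplus>\<^bsub>P\<^esub>i\<in>{..<n}. f i p \<odot>\<^bsub>P\<^esub> x i) = p"

text \<open>The two regular modules share their addition, so a sum of values may be read over either
  ring.\<close>

lemma finsum_regular_op: "finsum (regular_module (op_ring A)) = finsum (regular_module A)"
  by (simp add: finsum_def regular_module_def op_ring_def)

lemma mod_Hom_regular:
  assumes "\<psi> \<in> mod_Hom A M (regular_module A)"
  shows "p \<in> carrier M \<Longrightarrow> \<psi> p \<in> carrier A"
    and "p \<in> carrier M \<Longrightarrow> q \<in> carrier M \<Longrightarrow> \<psi> (p \<oplus>\<^bsub>M\<^esub> q) = \<psi> p \<oplus>\<^bsub>A\<^esub> \<psi> q"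
    and "a \<in> carrier A \<Longrightarrow> p \<in> carrier M \<Longrightarrow> \<psi> (a \<odot>\<^bsub>M\<^esub> p) = \<psi> p \<otimes>\<^bsub>A\<^esub> a"
  using mod_Hom_closed[OF assms] mod_Hom_add[OF assms] mod_Hom_smult[OF assms] by auto

text \<open>Linearity of each functional turns a scalar on the argument into a scalar on its
  coefficient. With the functionals of a dual basis, \<open>b i\<close> is the image intended for
  \<open>x i\<close>; with other functionals this builds retractions onto \<open>P\<close>.\<close>

lemma comb_hom:
  fixes n :: nat
  assumes P: "rmodule A P" and B: "rmodule A B"
    and f: "\<And>i. i < n \<Longrightarrow> f i \<in> mod_Hom A P (regular_module A)"
    and b: "\<And>i. i < n \<Longrightarrow> b i \<in> carrier B"
  shows "(\<lambda>p\<in>carrier P. \<Oplus>\<^bsub>B\<^esub>i\<in>{..<n}. f i p \<odot>\<^bsub>B\<^esub> b i) \<in> mod_Hom A P B"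
proof -
  interpret B: rmodule A B by fact
  show ?thesis
  proof (rule mod_HomI[OF P])
    fix p q assume pq: "p \<in> carrier P" "q \<in> carrier P"
    have "(\<Oplus>\<^bsub>B\<^esub>i\<in>{..<n}. f i (p \<oplus>\<^bsub>P\<^esub> q) \<odot>\<^bsub>B\<^esub> b i)
        = (\<Oplus>\<^bsub>B\<^esub>i\<in>{..<n}. f i p \<odot>\<^bsub>B\<^esub> b i \<oplus>\<^bsub>B\<^esub> f i q \<odot>\<^bsub>B\<^esub> b i)"
      by (rule B.M.finsum_cong') (use b pq in \<open>auto simp: mod_Hom_regular[OF f] B.smult_l_distr\<close>)
    also have "\<dots> = (\<Oplus>\<^bsub>B\<^esub>i\<in>{..<n}. f i p \<odot>\<^bsub>B\<^esub> b i) \<oplus>\<^bsub>B\<^esub> (\<Oplus>\<^bsub>B\<^esub>i\<in>{..<n}. f i q \<odot>\<^bsub>B\<^esub> b i)"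
      by (rule B.M.finsum_addf) (use b pq mod_Hom_regular(1)[OF f] in auto)
    finally show "(\<Oplus>\<^bsub>B\<^esub>i\<in>{..<n}. f i (p \<oplus>\<^bsub>P\<^esub> q) \<odot>\<^bsub>B\<^esub> b i)
      = (\<Oplus>\<^bsub>B\<^esub>i\<in>{..<n}. f i p \<odot>\<^bsub>B\<^esub> b i) \<oplus>\<^bsub>B\<^esub> (\<Oplus>\<^bsub>B\<^esub>i\<in>{..<n}. f i q \<odot>\<^bsub>B\<^esub> b i)" .
  next
    fix a p assume ap: "a \<in> carrier A" "p \<in> carrier P"
    have "(\<Oplus>\<^bsub>B\<^esub>i\<in>{..<n}. f i (a \<odot>\<^bsub>P\<^esub> p) \<odot>\<^bsub>B\<^esub> b i)
        = (\<Oplus>\<^bsub>B\<^esub>i\<in>{..<n}. a \<odot>\<^bsub>B\<^esub> (f i p \<odot>\<^bsub>B\<^esub> b i))"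
      by (rule B.M.finsum_cong') (use b ap in \<open>auto simp: mod_Hom_regular[OF f] B.smult_assoc\<close>)
    also have "\<dots> = a \<odot>\<^bsub>B\<^esub> (\<Oplus>\<^bsub>B\<^esub>i\<in>{..<n}. f i p \<odot>\<^bsub>B\<^esub> b i)"
      by (rule B.smult_finsum[symmetric]) (use b ap mod_Hom_regular(1)[OF f] in auto)
    finally show "(\<Oplus>\<^bsub>B\<^esub>i\<in>{..<n}. f i (a \<odot>\<^bsub>P\<^esub> p) \<odot>\<^bsub>B\<^esub> b i)
      = a \<odot>\<^bsub>B\<^esub> (\<Oplus>\<^bsub>B\<^esub>i\<in>{..<n}. f i p \<odot>\<^bsub>B\<^esub> b i)" .
  qed (use b mod_Hom_regular(1)[OF f] in \<open>auto intro!: B.M.finsum_closed\<close>)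
qed

lemma eval_hom:
  assumes "rmodule A M" "p \<in> carrier M"
  shows "(\<lambda>\<psi>\<in>carrier (dual_module A M). \<psi> p)
    \<in> mod_Hom (op_ring A) (dual_module A M) (regular_module (op_ring A))"
  by (rule mod_HomI[OF rmodule_dual_module[OF assms(1)]])
    (use assms(2) in \<open>auto simp: mod_Hom_regular\<close>)

context dual_basis
begin

lemma f_closed [simp]: "i < n \<Longrightarrow> p \<in> carrier P \<Longrightarrow> f i p \<in> carrier A"
  using mod_Hom_closed[OF f_hom] by simp

lemma f_add: "i < n \<Longrightarrow> p \<in> carrier P \<Longrightarrow> q \<in> carrier P \<Longrightarrow> f i (p \<oplus>\<^bsub>P\<^esub> q) = f i p \<oplus>\<^bsub>A\<^esub> f i q"
  using mod_Hom_add[OF f_hom] by simp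

lemma f_smult: "i < n \<Longrightarrow> a \<in> carrier A \<Longrightarrow> p \<in> carrier P \<Longrightarrow> f i (a \<odot>\<^bsub>P\<^esub> p) = f i p \<otimes>\<^bsub>A\<^esub> a"
  using mod_Hom_smult[OF f_hom] by simp

lemma hom_expand:
  assumes "rmodule A B" "h \<in> mod_Hom A P B" "p \<in> carrier P"
  shows "h p = (\<Oplus>\<^bsub>B\<^esub>i\<in>{..<n}. f i p \<odot>\<^bsub>B\<^esub> h (x i))"
proof -
  interpret rmodule_hom A P B h using assms rmodule_axioms by (intro rmodule_homI)
  have "h p = h (\<Oplus>\<^bsub>P\<^esub>i\<in>{..<n}. f i p \<odot>\<^bsub>P\<^esub> x i)" using assms(3) by (simp add: expand)
  also have "\<dots> = (\<Oplus>\<^bsub>B\<^esub>i\<in>{..<n}. h (f i p \<odot>\<^bsub>P\<^esub> x i))"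
    by (rule finsum) (use assms(3) in auto)
  also have "\<dots> = (\<Oplus>\<^bsub>B\<^esub>i\<in>{..<n}. f i p \<odot>\<^bsub>B\<^esub> h (x i))"
    by (rule N.M.finsum_cong') (use assms(3) in \<open>auto simp: smult\<close>)
  finally show ?thesis .
qed

text \<open>Choose a preimage \<open>b i\<close> of each \<open>h (x i)\<close> and extend by the
  coordinates. Requiring only that \<open>h\<close> has its values in the image of \<open>p\<close>
  allows lifting along maps onto a kernel, such as \<open>g\<close> of the presentation.\<close>

lemma lift:
  assumes B: "rmodule A B" and C: "rmodule A C" and p: "p \<in> mod_Hom A B C"
    and h: "h \<in> mod_Hom A P C" and im: "\<And>y. y \<in> carrier P \<Longrightarrow> h y \<in> p ` carrier B"
  shows "\<exists>k\<in>mod_Hom A P B. \<forall>y\<in>carrier P. p (k y) = h y"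
proof -
  interpret p: rmodule_hom A B C p using B C p by (rule rmodule_homI)
  define b where "b = (\<lambda>i. inv_into (carrier B) p (h (x i)))"
  have b: "b i \<in> carrier B" "p (b i) = h (x i)" if "i < n" for i
    unfolding b_def using im[OF x_closed[OF that]] by (rule inv_into_into f_inv_into_f)+
  let ?k = "\<lambda>y\<in>carrier P. \<Oplus>\<^bsub>B\<^esub>i\<in>{..<n}. f i y \<odot>\<^bsub>B\<^esub> b i"
  have "p (?k y) = h y" if y: "y \<in> carrier P" for y
  proof -
    have "p (?k y) = (\<Oplus>\<^bsub>C\<^esub>i\<in>{..<n}. p (f i y \<odot>\<^bsub>B\<^esub> b i))"
      using y b by (simp add: p.finsum)
    also have "\<dots> = (\<Oplus>\<^bsub>C\<^esub>i\<in>{..<n}. f i y \<odot>\<^bsub>C\<^esub> h (x i))"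
      by (rule p.N.M.finsum_cong') (use y b mod_Hom_closed[OF h] in \<open>auto simp: p.smult\<close>)
    finally show ?thesis using hom_expand[OF C h y] by simp
  qed
  then show ?thesis by (intro bexI[OF _ comb_hom[OF rmodule_axioms B f_hom b(1)]] ballI)
qed

lemma submodule_eq_carrier:
  assumes "submodule U A P" "\<And>i. i < n \<Longrightarrow> x i \<in> U"
  shows "U = carrier P"
proof
  show "U \<subseteq> carrier P" using assms(1) by (simp add: submodule_iff)
  show "carrier P \<subseteq> U"
  proof
    fix p assume p: "p \<in> carrier P"
    have "(\<Oplus>\<^bsub>P\<^esub>i\<in>{..<n}. f i p \<odot>\<^bsub>P\<^esub> x i) \<in> U"
      by (rule submodule_finsum) (use assms p in \<open>auto simp: submodule_iff\<close>)
    then show "p \<in> U" using p by (simp add: expand)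
  qed
qed

lemma fg_module: "fg_module A P"
  unfolding fg_module_def
  by (intro conjI rmodule_axioms exI[of _ "x ` {..<n}"]) (auto intro!: submodule_eq_carrier)

lemma projective: "projective A P"
  unfolding projective_def
proof (intro conjI allI impI rmodule_axioms)
  fix B C :: "('a, 'a fgu) module" and p h
  assume *: "rmodule A B \<and> rmodule A C \<and> p \<in> mod_Hom A B C \<and> p ` carrier B = carrier C \<and>
    h \<in> mod_Hom A P C"
  then have B: "rmodule A B" and C: "rmodule A C" and p: "p \<in> mod_Hom A B C"
    and surj: "p ` carrier B = carrier C" and h: "h \<in> mod_Hom A P C" by auto
  have "h y \<in> p ` carrier B" if "y \<in> carrier P" for y
    unfolding surj using h that by (rule mod_Hom_closed)
  from lift[OF B C p h this] obtain k where
    k: "k \<in> mod_Hom A P B" "\<forall>y\<in>carrier P. p (k y) = h y" by auto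
  have "compose (carrier P) p k = h"
  proof (rule mod_Hom_eqI)
    show "compose (carrier P) p k \<in> mod_Hom A P C"
      using * k(1) rmodule_axioms by (intro mod_Hom_compose) auto
    show "h \<in> mod_Hom A P C" using * by simp
  qed (use k(2) in \<open>simp add: compose_eq\<close>)
  then show "\<exists>k\<in>mod_Hom A P B. compose (carrier P) p k = h" using k by blast
qed

text \<open>An element is recovered from its coordinates \<open>f i p\<close>, so functionals
  distinguish points. Identities constructed on the dual side are brought back in this way.\<close>

lemma separate:
  assumes "p \<in> carrier P" "q \<in> carrier P"
    and "\<And>\<psi>. \<psi> \<in> mod_Hom A P (regular_module A) \<Longrightarrow> \<psi> p = \<psi> q"
  shows "p = q"
proof -
  have "(\<Oplus>\<^bsub>P\<^esub>i\<in>{..<n}. f i p \<odot>\<^bsub>P\<^esub> x i) = (\<Oplus>\<^bsub>P\<^esub>i\<in>{..<n}. f i q \<odot>\<^bsub>P\<^esub> x i)"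
    by (rule M.finsum_cong') (use assms(1,2) assms(3)[OF f_hom] in auto)
  then show ?thesis using assms expand by simp
qed

text \<open>The roles of elements and functionals interchange: applying \<psi> to the expansion of
  \<open>p\<close> expresses \<psi> as the combination of the \<open>f i\<close> with coefficients
  \<open>\<psi> (x i)\<close>.\<close>

lemma dual_basis_dual:
  "dual_basis (op_ring A) (dual_module A P) n f (\<lambda>i. \<lambda>\<psi>\<in>carrier (dual_module A P). \<psi> (x i))"
proof -
  interpret D: rmodule "op_ring A" "dual_module A P" by (rule rmodule_dual_module[OF rmodule_axioms])
  show ?thesis
  proof
    fix i assume i: "i < n"
    show "f i \<in> carrier (dual_module A P)" using i f_hom by simp
    show "(\<lambda>\<psi>\<in>carrier (dual_module A P). \<psi> (x i))
        \<in> mod_Hom (op_ring A) (dual_module A P) (regular_module (op_ring A))"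
      by (rule eval_hom[OF rmodule_axioms]) (use i in simp)
  next
    fix \<psi> assume "\<psi> \<in> carrier (dual_module A P)"
    then have \<psi>: "\<psi> \<in> mod_Hom A P (regular_module A)" by simp
    let ?s = "\<Oplus>\<^bsub>dual_module A P\<^esub>i\<in>{..<n}.
      (\<lambda>\<psi>\<in>carrier (dual_module A P). \<psi> (x i)) \<psi> \<odot>\<^bsub>dual_module A P\<^esub> f i"
    have t: "(\<lambda>\<psi>\<in>carrier (dual_module A P). \<psi> (x i)) \<psi> \<odot>\<^bsub>dual_module A P\<^esub> f i
        \<in> carrier (dual_module A P)" if "i < n" for i
      using that \<psi> by (intro D.smult_closed) (auto simp: mod_Hom_regular f_hom)
    then have s: "?s \<in> carrier (dual_module A P)"
      by (intro D.M.finsum_closed) blast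
    show "?s = \<psi>"
    proof (rule mod_Hom_eqI)
      show "?s \<in> mod_Hom A P (regular_module A)" using s by simp
      show "\<psi> \<in> mod_Hom A P (regular_module A)" by (rule \<psi>)
      fix p assume p: "p \<in> carrier P"
      \<comment> \<open>Evaluation at \<open>p\<close> is linear over the opposite ring and can
        therefore be moved inside the sum in the dual module.\<close>
      let ?ev = "\<lambda>\<psi>\<in>carrier (dual_module A P). \<psi> p"
      interpret ev: rmodule_hom "op_ring A" "dual_module A P" "regular_module (op_ring A)" ?ev
        by (intro rmodule_homI D.rmodule_axioms rmodule_regular_module D.R.ring_axioms
            eval_hom[OF rmodule_axioms p])
      have "?s p = ?ev ?s" using s by simp
      also have "\<dots> = (\<Oplus>\<^bsub>regular_module (op_ring A)\<^esub>i\<in>{..<n}.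
          ?ev ((\<lambda>\<psi>\<in>carrier (dual_module A P). \<psi> (x i)) \<psi> \<odot>\<^bsub>dual_module A P\<^esub> f i))"
        by (rule ev.finsum) (use t in blast)+
      also have "\<dots> = (\<Oplus>\<^bsub>regular_module (op_ring A)\<^esub>i\<in>{..<n}. f i p \<odot>\<^bsub>regular_module A\<^esub> \<psi> (x i))"
      proof (rule ev.N.M.finsum_cong')
        fix i assume "i \<in> {..<n}"
        then show "?ev ((\<lambda>\<psi>\<in>carrier (dual_module A P). \<psi> (x i)) \<psi> \<odot>\<^bsub>dual_module A P\<^esub> f i)
            = f i p \<odot>\<^bsub>regular_module A\<^esub> \<psi> (x i)"
          using t[of i] \<psi> p by simp
      qed (use p \<psi> in \<open>auto simp: mod_Hom_regular\<close>)
      also have "\<dots> = \<psi> p"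
        using hom_expand[OF rmodule_regular_module[OF R.ring_axioms] \<psi> p]
        by (simp add: finsum_regular_op)
      finally show "?s p = \<psi> p" .
    qed
  qed
qed

text \<open>This is the dual of \<open>d\<close> followed by the inverse of the canonical map from
  \<open>P\<close> to its bidual. Since \<psi> is the combination of the \<open>f i\<close> with
  coefficients \<open>\<psi> (x i)\<close>, the required value of \<psi> forces
  \<open>u \<xi>\<close> to have the coordinates \<open>\<xi> (d (f i))\<close>.\<close>

lemma transpose:
  assumes L: "rmodule (op_ring A) L" and d: "d \<in> mod_Hom (op_ring A) (dual_module A P) L"
  shows "\<exists>u\<in>mod_Hom A (dual_module (op_ring A) L) P.
    \<forall>\<xi>\<in>carrier (dual_module (op_ring A) L). \<forall>\<psi>\<in>carrier (dual_module A P). \<psi> (u \<xi>) = \<xi> (d \<psi>)"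
proof -
  interpret L: rmodule "op_ring A" L by fact
  interpret LD: rmodule A "dual_module (op_ring A) L"
    using rmodule_dual_module[OF L] by simp
  interpret DB: dual_basis "op_ring A" "dual_module A P" n f
    "\<lambda>i. \<lambda>\<psi>\<in>carrier (dual_module A P). \<psi> (x i)" by (rule dual_basis_dual)
  interpret Reg: rmodule A "regular_module A" by (rule rmodule_regular_module[OF R.ring_axioms])
  interpret Rop: rmodule "op_ring A" "regular_module (op_ring A)"
    by (rule rmodule_regular_module[OF L.R.ring_axioms])
  have df: "d (f i) \<in> carrier L" if "i < n" for i
    using mod_Hom_closed[OF d] that f_hom by simp
  have xi: "\<xi> (d (f i)) \<in> carrier A" if "\<xi> \<in> carrier (dual_module (op_ring A) L)" "i < n" for \<xi> i
    using that df mod_Hom_closed[of \<xi> "op_ring A" L "regular_module (op_ring A)"] by simp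
  define u where "u = (\<lambda>\<xi>\<in>carrier (dual_module (op_ring A) L).
    \<Oplus>\<^bsub>P\<^esub>i\<in>{..<n}. \<xi> (d (f i)) \<odot>\<^bsub>P\<^esub> x i)"
  have "u \<in> mod_Hom A (dual_module (op_ring A) L) P"
    unfolding u_def
  proof (rule mod_HomI[OF LD.rmodule_axioms])
    fix \<xi> \<eta> assume *: "\<xi> \<in> carrier (dual_module (op_ring A) L)" "\<eta> \<in> carrier (dual_module (op_ring A) L)"
    have "(\<Oplus>\<^bsub>P\<^esub>i\<in>{..<n}. (\<xi> \<oplus>\<^bsub>dual_module (op_ring A) L\<^esub> \<eta>) (d (f i)) \<odot>\<^bsub>P\<^esub> x i)
        = (\<Oplus>\<^bsub>P\<^esub>i\<in>{..<n}. \<xi> (d (f i)) \<odot>\<^bsub>P\<^esub> x i \<oplus>\<^bsub>P\<^esub> \<eta> (d (f i)) \<odot>\<^bsub>P\<^esub> x i)"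
      by (rule M.finsum_cong') (use * in \<open>auto simp: df xi smult_l_distr\<close>)
    also have "\<dots> = (\<Oplus>\<^bsub>P\<^esub>i\<in>{..<n}. \<xi> (d (f i)) \<odot>\<^bsub>P\<^esub> x i) \<oplus>\<^bsub>P\<^esub>
        (\<Oplus>\<^bsub>P\<^esub>i\<in>{..<n}. \<eta> (d (f i)) \<odot>\<^bsub>P\<^esub> x i)"
      by (rule M.finsum_addf) (use * xi in auto)
    finally show "(\<Oplus>\<^bsub>P\<^esub>i\<in>{..<n}. (\<xi> \<oplus>\<^bsub>dual_module (op_ring A) L\<^esub> \<eta>) (d (f i)) \<odot>\<^bsub>P\<^esub> x i)
        = (\<Oplus>\<^bsub>P\<^esub>i\<in>{..<n}. \<xi> (d (f i)) \<odot>\<^bsub>P\<^esub> x i) \<oplus>\<^bsub>P\<^esub>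
        (\<Oplus>\<^bsub>P\<^esub>i\<in>{..<n}. \<eta> (d (f i)) \<odot>\<^bsub>P\<^esub> x i)" .
  next
    fix a \<xi> assume *: "a \<in> carrier A" "\<xi> \<in> carrier (dual_module (op_ring A) L)"
    have "(\<Oplus>\<^bsub>P\<^esub>i\<in>{..<n}. (a \<odot>\<^bsub>dual_module (op_ring A) L\<^esub> \<xi>) (d (f i)) \<odot>\<^bsub>P\<^esub> x i)
        = (\<Oplus>\<^bsub>P\<^esub>i\<in>{..<n}. a \<odot>\<^bsub>P\<^esub> (\<xi> (d (f i)) \<odot>\<^bsub>P\<^esub> x i))"
      by (rule M.finsum_cong') (use * in \<open>auto simp: df xi smult_assoc\<close>)
    also have "\<dots> = a \<odot>\<^bsub>P\<^esub> (\<Oplus>\<^bsub>P\<^esub>i\<in>{..<n}. \<xi> (d (f i)) \<odot>\<^bsub>P\<^esub> x i)"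
      by (rule smult_finsum[symmetric]) (use * xi in auto)
    finally show "(\<Oplus>\<^bsub>P\<^esub>i\<in>{..<n}. (a \<odot>\<^bsub>dual_module (op_ring A) L\<^esub> \<xi>) (d (f i)) \<odot>\<^bsub>P\<^esub> x i)
        = a \<odot>\<^bsub>P\<^esub> (\<Oplus>\<^bsub>P\<^esub>i\<in>{..<n}. \<xi> (d (f i)) \<odot>\<^bsub>P\<^esub> x i)" .
  qed (use xi in \<open>auto intro!: M.finsum_closed\<close>)
  moreover have "\<psi> (u \<xi>) = \<xi> (d \<psi>)"
    if "\<xi> \<in> carrier (dual_module (op_ring A) L)" "\<psi> \<in> carrier (dual_module A P)" for \<xi> \<psi>
  proof -
    interpret \<psi>: rmodule_hom A P "regular_module A" \<psi>
      using that(2) by (intro rmodule_homI rmodule_axioms Reg.rmodule_axioms) simp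
    have \<xi>: "\<xi> \<in> mod_Hom (op_ring A) L (regular_module (op_ring A))" using that(1) by simp
    have \<xi>d: "compose (carrier (dual_module A P)) \<xi> d
        \<in> mod_Hom (op_ring A) (dual_module A P) (regular_module (op_ring A))"
      using d \<xi> DB.rmodule_axioms by (rule mod_Hom_compose)
    have "\<psi> (u \<xi>) = (\<Oplus>\<^bsub>regular_module A\<^esub>i\<in>{..<n}. \<psi> (\<xi> (d (f i)) \<odot>\<^bsub>P\<^esub> x i))"
      using that xi by (simp add: u_def \<psi>.finsum)
    also have "\<dots> = (\<Oplus>\<^bsub>regular_module A\<^esub>i\<in>{..<n}. \<psi> (x i) \<otimes>\<^bsub>A\<^esub> \<xi> (d (f i)))"
      by (rule Reg.M.finsum_cong') (use that xi in \<open>auto simp: \<psi>.smult mod_Hom_regular\<close>)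
    also have "\<dots> = (\<Oplus>\<^bsub>regular_module (op_ring A)\<^esub>i\<in>{..<n}.
        (\<lambda>\<psi>\<in>carrier (dual_module A P). \<psi> (x i)) \<psi> \<odot>\<^bsub>regular_module (op_ring A)\<^esub>
          compose (carrier (dual_module A P)) \<xi> d (f i))"
      unfolding finsum_regular_op
      by (rule Reg.M.finsum_cong') (use that xi f_hom in \<open>auto simp: mod_Hom_regular compose_eq\<close>)
    also have "\<dots> = \<xi> (d \<psi>)"
      using DB.hom_expand[OF Rop.rmodule_axioms \<xi>d that(2)] that(2) by (simp add: compose_eq)
    finally show ?thesis .
  qed
  ultimately show ?thesis by blast
qed

text \<open>Injectivity is the separation of points by functionals; the transpose of the identity of
  P* supplies the preimages.\<close>

lemma bij_bidual_map:
  "bij_betw (bidual_map A P) (carrier P) (carrier (dual_module (op_ring A) (dual_module A P)))"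
  unfolding bij_betw_def
proof
  have mem: "bidual_map A P p \<in> carrier (dual_module (op_ring A) (dual_module A P))"
    if "p \<in> carrier P" for p
    using eval_hom[OF rmodule_axioms that] that by (simp add: bidual_map_def)
  show "inj_on (bidual_map A P) (carrier P)"
  proof (rule inj_onI)
    fix p q assume pq: "p \<in> carrier P" "q \<in> carrier P" "bidual_map A P p = bidual_map A P q"
    show "p = q"
    proof (rule separate[OF pq(1,2)])
      fix \<psi> assume "\<psi> \<in> mod_Hom A P (regular_module A)"
      then show "\<psi> p = \<psi> q"
        using fun_cong[OF pq(3), of \<psi>] pq(1,2) by (simp add: bidual_map_def)
    qed
  qed
  interpret D: rmodule "op_ring A" "dual_module A P" by (rule rmodule_dual_module[OF rmodule_axioms])
  obtain u where u: "u \<in> mod_Hom A (dual_module (op_ring A) (dual_module A P)) P"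
    "\<And>\<xi> \<psi>. \<xi> \<in> carrier (dual_module (op_ring A) (dual_module A P)) \<Longrightarrow>
      \<psi> \<in> carrier (dual_module A P) \<Longrightarrow> \<psi> (u \<xi>) = \<xi> \<psi>"
    using transpose[OF D.rmodule_axioms mod_Hom_id[OF D.rmodule_axioms]] by auto
  show "bidual_map A P ` carrier P = carrier (dual_module (op_ring A) (dual_module A P))"
  proof
    show "carrier (dual_module (op_ring A) (dual_module A P)) \<subseteq> bidual_map A P ` carrier P"
    proof
      fix \<xi> assume \<xi>: "\<xi> \<in> carrier (dual_module (op_ring A) (dual_module A P))"
      have up: "u \<xi> \<in> carrier P" by (rule mod_Hom_closed[OF u(1) \<xi>])
      have "\<xi> = bidual_map A P (u \<xi>)"
      proof (rule mod_Hom_eqI)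
        show "\<xi> \<in> mod_Hom (op_ring A) (dual_module A P) (regular_module (op_ring A))"
          using \<xi> by simp
        show "bidual_map A P (u \<xi>) \<in> mod_Hom (op_ring A) (dual_module A P) (regular_module (op_ring A))"
          using mem[OF up] by simp
        show "\<xi> \<psi> = bidual_map A P (u \<xi>) \<psi>" if "\<psi> \<in> carrier (dual_module A P)" for \<psi>
          using u(2)[OF \<xi> that] up that by (simp add: bidual_map_def)
      qed
      then show "\<xi> \<in> bidual_map A P ` carrier P" using up by blast
    qed
  qed (use mem in blast)
qed

end

section \<open>Free modules and the existence of dual bases\<close>

definition free_module :: "'a ring \<Rightarrow> nat \<Rightarrow> ('a, nat \<Rightarrow> 'a) module" where
  "free_module A n = \<lparr>carrier = {..<n} \<rightarrow>\<^sub>E carrier A, mult = undefined, one = undefined,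
     zero = (\<lambda>i\<in>{..<n}. \<zero>\<^bsub>A\<^esub>), add = \<lambda>c d. \<lambda>i\<in>{..<n}. c i \<oplus>\<^bsub>A\<^esub> d i,
     smult = \<lambda>a c. \<lambda>i\<in>{..<n}. c i \<otimes>\<^bsub>A\<^esub> a\<rparr>"

lemma free_module_simps [simp]:
  "carrier (free_module A n) = {..<n} \<rightarrow>\<^sub>E carrier A"
  "\<zero>\<^bsub>free_module A n\<^esub> = (\<lambda>i\<in>{..<n}. \<zero>\<^bsub>A\<^esub>)"
  "c \<oplus>\<^bsub>free_module A n\<^esub> d = (\<lambda>i\<in>{..<n}. c i \<oplus>\<^bsub>A\<^esub> d i)"
  "a \<odot>\<^bsub>free_module A n\<^esub> c = (\<lambda>i\<in>{..<n}. c i \<otimes>\<^bsub>A\<^esub> a)"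
  by (simp_all add: free_module_def)

lemma rmodule_free_module:
  assumes "ring A"
  shows "rmodule A (free_module A n)"
proof -
  interpret ring A by (rule assms)
  have mem: "c i \<in> carrier A" if "c \<in> {..<n} \<rightarrow>\<^sub>E carrier A" "i < n" for c i
    using that by auto
  have ext: "restrict c {..<n} = c" if "c \<in> {..<n} \<rightarrow>\<^sub>E carrier A" for c
    using that by (simp add: PiE_def extensional_restrict)
  have "abelian_group (free_module A n)"
  proof (rule abelian_groupI)
    fix c assume c: "c \<in> carrier (free_module A n)"
    show "\<exists>d\<in>carrier (free_module A n). d \<oplus>\<^bsub>free_module A n\<^esub> c = \<zero>\<^bsub>free_module A n\<^esub>"
      by (rule bexI[of _ "\<lambda>i\<in>{..<n}. \<ominus>\<^bsub>A\<^esub> c i"])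
        (use c in \<open>simp_all add: mem l_neg restrict_PiE_iff cong: restrict_cong\<close>)
    have "(\<lambda>i\<in>{..<n}. \<zero>\<^bsub>A\<^esub> \<oplus>\<^bsub>A\<^esub> c i) = (\<lambda>i\<in>{..<n}. c i)"
      using c by (intro restrict_ext) (simp add: mem)
    then show "\<zero>\<^bsub>free_module A n\<^esub> \<oplus>\<^bsub>free_module A n\<^esub> c = c"
      using c ext by (simp cong: restrict_cong)
  qed (simp_all add: mem add.m_ac restrict_PiE_iff cong: restrict_cong)
  moreover have "rmodule_axioms A (free_module A n)"
  proof
    fix c assume c: "c \<in> carrier (free_module A n)"
    have "(\<lambda>i\<in>{..<n}. c i \<otimes>\<^bsub>A\<^esub> \<one>\<^bsub>A\<^esub>) = (\<lambda>i\<in>{..<n}. c i)"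
      using c by (intro restrict_ext) (simp add: mem)
    then show "\<one>\<^bsub>A\<^esub> \<odot>\<^bsub>free_module A n\<^esub> c = c" using c ext by simp
  qed (simp_all add: mem l_distr r_distr m_assoc restrict_PiE_iff cong: restrict_cong)
  ultimately show ?thesis by (simp add: rmodule_def assms)
qed

text \<open>A surjection \<open>q\<close> from a free module splits, and the coordinates of a
  section are the functionals dual to the generators. To apply \<open>projective\<close>, both the
  free module and \<open>P\<close> are replaced by copies on \<open>'a fgu\<close>.\<close>

lemma exists_dual_basis:
  fixes A :: "'a ring" and P :: "('a, 'p) module"
  assumes fg: "fg_module A P" and proj: "projective A P"
  shows "\<exists>n x f. dual_basis A P n x f"
proof -
  interpret P: rmodule A P using fg by (simp add: fg_module_def)
  obtain S where S: "S \<subseteq> carrier P" "finite S"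
      "\<And>U. submodule U A P \<Longrightarrow> S \<subseteq> U \<Longrightarrow> U = carrier P"
    using fg by (auto simp: fg_module_def)
  obtain n and s :: "nat \<Rightarrow> 'p" where s: "S = s ` {..<n}"
    using finite_imp_nat_seg_image_inj_on[OF S(2)] by (auto simp: lessThan_def)
  have sP [simp]: "i < n \<Longrightarrow> s i \<in> carrier P" for i using S(1) s by auto
  define F where "F = free_module A n"
  interpret F: rmodule A F unfolding F_def by (rule rmodule_free_module[OF P.R.ring_axioms])
  have Fc: "c i \<in> carrier A" if "c \<in> carrier F" "i < n" for c i
    using that by (auto simp: F_def)
  define q where "q = (\<lambda>c\<in>carrier F. \<Oplus>\<^bsub>P\<^esub>i\<in>{..<n}. c i \<odot>\<^bsub>P\<^esub> s i)"
  have q: "q \<in> mod_Hom A F P"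
    unfolding q_def
  proof (rule mod_HomI[OF F.rmodule_axioms])
    fix c d assume cd: "c \<in> carrier F" "d \<in> carrier F"
    have "(\<Oplus>\<^bsub>P\<^esub>i\<in>{..<n}. (c \<oplus>\<^bsub>F\<^esub> d) i \<odot>\<^bsub>P\<^esub> s i)
        = (\<Oplus>\<^bsub>P\<^esub>i\<in>{..<n}. c i \<odot>\<^bsub>P\<^esub> s i \<oplus>\<^bsub>P\<^esub> d i \<odot>\<^bsub>P\<^esub> s i)"
      by (rule P.M.finsum_cong') (use cd in \<open>auto simp: Fc F_def P.smult_l_distr\<close>)
    also have "\<dots> = (\<Oplus>\<^bsub>P\<^esub>i\<in>{..<n}. c i \<odot>\<^bsub>P\<^esub> s i) \<oplus>\<^bsub>P\<^esub> (\<Oplus>\<^bsub>P\<^esub>i\<in>{..<n}. d i \<odot>\<^bsub>P\<^esub> s i)"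
      by (rule P.M.finsum_addf) (use cd Fc in auto)
    finally show "(\<Oplus>\<^bsub>P\<^esub>i\<in>{..<n}. (c \<oplus>\<^bsub>F\<^esub> d) i \<odot>\<^bsub>P\<^esub> s i)
        = (\<Oplus>\<^bsub>P\<^esub>i\<in>{..<n}. c i \<odot>\<^bsub>P\<^esub> s i) \<oplus>\<^bsub>P\<^esub> (\<Oplus>\<^bsub>P\<^esub>i\<in>{..<n}. d i \<odot>\<^bsub>P\<^esub> s i)" .
  next
    fix a c assume ac: "a \<in> carrier A" "c \<in> carrier F"
    have "(\<Oplus>\<^bsub>P\<^esub>i\<in>{..<n}. (a \<odot>\<^bsub>F\<^esub> c) i \<odot>\<^bsub>P\<^esub> s i)
        = (\<Oplus>\<^bsub>P\<^esub>i\<in>{..<n}. a \<odot>\<^bsub>P\<^esub> (c i \<odot>\<^bsub>P\<^esub> s i))"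
      by (rule P.M.finsum_cong') (use ac in \<open>auto simp: Fc F_def P.smult_assoc\<close>)
    also have "\<dots> = a \<odot>\<^bsub>P\<^esub> (\<Oplus>\<^bsub>P\<^esub>i\<in>{..<n}. c i \<odot>\<^bsub>P\<^esub> s i)"
      by (rule P.smult_finsum[symmetric]) (use ac Fc in auto)
    finally show "(\<Oplus>\<^bsub>P\<^esub>i\<in>{..<n}. (a \<odot>\<^bsub>F\<^esub> c) i \<odot>\<^bsub>P\<^esub> s i)
        = a \<odot>\<^bsub>P\<^esub> (\<Oplus>\<^bsub>P\<^esub>i\<in>{..<n}. c i \<odot>\<^bsub>P\<^esub> s i)" .
  qed (use Fc in \<open>auto intro!: P.M.finsum_closed\<close>)
  interpret q: rmodule_hom A F P q
    by (intro rmodule_homI F.rmodule_axioms P.rmodule_axioms q)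
  have "s k \<in> q ` carrier F" if k: "k < n" for k
  proof
    let ?c = "\<lambda>i\<in>{..<n}. if k = i then \<one>\<^bsub>A\<^esub> else \<zero>\<^bsub>A\<^esub>"
    show c: "?c \<in> carrier F" by (auto simp: F_def)
    have "q ?c = (\<Oplus>\<^bsub>P\<^esub>i\<in>{..<n}. if k = i then s i else \<zero>\<^bsub>P\<^esub>)"
      unfolding q_def restrict_apply'[OF c] by (rule P.M.finsum_cong') auto
    also have "\<dots> = s k"
      using k by (intro P.M.finsum_singleton) auto
    finally show "s k = q ?c" by simp
  qed
  then have surj: "q ` carrier F = carrier P"
    using s by (intro S(3) q.submodule_image F.submodule_carrier) auto
  \<comment> \<open>Sending a coefficient family to its singleton embeds the free module into
    \<open>'a fgu\<close>, which makes its copy an admissible test module.\<close>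
  have "inj_on (\<lambda>c. {c}) (carrier F)" by (simp add: inj_on_def)
  from rmodule_transport[OF F.rmodule_axioms this] obtain F' :: "('a, 'a fgu) module" and j
    where F': "rmodule A F'" and j: "j \<in> mod_iso A F F'" by auto
  from fg_module_has_copy[OF fg] obtain P' :: "('a, 'a fgu) module" and l
    where P': "rmodule A P'" and l: "l \<in> mod_iso A P P'" by (auto simp: fg_module_def)
  have lH: "l \<in> mod_Hom A P P'" and lb: "bij_betw l (carrier P) (carrier P')"
    using l by (auto simp: mod_iso_def)
  define j' where "j' = (\<lambda>y\<in>carrier F'. inv_into (carrier F) j y)"
  have "j' \<in> mod_iso A F' F"
    unfolding j'_def by (rule mod_iso_inverse[OF j F.rmodule_axioms F'])
  then have jH: "j' \<in> mod_Hom A F' F" and jb: "bij_betw j' (carrier F') (carrier F)"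
    by (auto simp: mod_iso_def)
  define p where "p = compose (carrier F') l (compose (carrier F') q j')"
  have pH: "p \<in> mod_Hom A F' P'"
    unfolding p_def by (rule mod_Hom_compose[OF mod_Hom_compose[OF jH q F'] lH F'])
  have "p ` carrier F' = l ` q ` j' ` carrier F'"
    by (auto simp: p_def compose_eq image_comp)
  also have "\<dots> = carrier P'"
    using jb lb by (simp add: bij_betw_def surj)
  finally have "p ` carrier F' = carrier P'" .
  with proj F' P' pH lH obtain k where k: "k \<in> mod_Hom A P F'" "compose (carrier P) p k = l"
    unfolding projective_def by meson
  have kc: "k y \<in> carrier F'" if "y \<in> carrier P" for y
    using k(1) that by (rule mod_Hom_closed)
  have qk: "q (j' (k y)) = y" if y: "y \<in> carrier P" for y
  proof -
    have "l (q (j' (k y))) = l y"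
      using fun_cong[OF k(2), of y] y kc by (simp add: compose_eq p_def)
    then show ?thesis
      using lb y q.closed[OF mod_Hom_closed[OF jH kc[OF y]]] by (auto simp: bij_betw_def inj_on_def)
  qed
  \<comment> \<open>The section \<open>k\<close>, carried back to the free module by
    \<open>j'\<close>, has these coordinates.\<close>
  define f where "f = (\<lambda>i. \<lambda>y\<in>carrier P. j' (k y) i)"
  have jk: "j' (k y) \<in> carrier F" if "y \<in> carrier P" for y
    using mod_Hom_closed[OF jH kc[OF that]] .
  have "dual_basis A P n s f"
  proof
    fix i assume i: "i < n"
    show "f i \<in> mod_Hom A P (regular_module A)"
      unfolding f_def
    proof (rule mod_HomI[OF P.rmodule_axioms])
      fix y z assume yz: "y \<in> carrier P" "z \<in> carrier P"
      then have "j' (k (y \<oplus>\<^bsub>P\<^esub> z)) = j' (k y) \<oplus>\<^bsub>F\<^esub> j' (k z)"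
        by (simp add: mod_Hom_add[OF k(1)] mod_Hom_add[OF jH] kc)
      then show "j' (k (y \<oplus>\<^bsub>P\<^esub> z)) i = j' (k y) i \<oplus>\<^bsub>regular_module A\<^esub> j' (k z) i"
        using i by (simp add: F_def)
    next
      fix a y assume ay: "a \<in> carrier A" "y \<in> carrier P"
      then have "j' (k (a \<odot>\<^bsub>P\<^esub> y)) = a \<odot>\<^bsub>F\<^esub> j' (k y)"
        by (simp add: mod_Hom_smult[OF k(1)] mod_Hom_smult[OF jH] kc)
      then show "j' (k (a \<odot>\<^bsub>P\<^esub> y)) i = a \<odot>\<^bsub>regular_module A\<^esub> j' (k y) i"
        using i by (simp add: F_def)
    qed (use i jk Fc in auto)
  next
    fix p assume p: "p \<in> carrier P"
    have "(\<Oplus>\<^bsub>P\<^esub>i\<in>{..<n}. f i p \<odot>\<^bsub>P\<^esub> s i) = q (j' (k p))"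
      using p jk by (simp add: q_def f_def)
    then show "(\<Oplus>\<^bsub>P\<^esub>i\<in>{..<n}. f i p \<odot>\<^bsub>P\<^esub> s i) = p" using qk[OF p] by simp
  qed simp
  then show ?thesis by blast
qed

section \<open>Closure properties of finitely generated projective modules\<close>

lemma dual_module_fg_projective:
  assumes "fg_module A P" "projective A P"
  shows "fg_module (op_ring A) (dual_module A P)" "projective (op_ring A) (dual_module A P)"
proof -
  obtain n x f where "dual_basis A P n x f" using exists_dual_basis[OF assms] by blast
  then interpret dual_basis A P n x f .
  interpret D: dual_basis "op_ring A" "dual_module A P" n f
    "\<lambda>i. \<lambda>\<psi>\<in>carrier (dual_module A P). \<psi> (x i)" by (rule dual_basis_dual)
  show "fg_module (op_ring A) (dual_module A P)" by (rule D.fg_module)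
  show "projective (op_ring A) (dual_module A P)" by (rule D.projective)
qed

lemma dsum_module_fg:
  assumes "fg_module A M" "fg_module A N"
  shows "fg_module A (dsum_module M N)"
proof -
  interpret M: rmodule A M using assms(1) by (simp add: fg_module_def)
  interpret N: rmodule A N using assms(2) by (simp add: fg_module_def)
  interpret MN: rmodule A "dsum_module M N"
    by (rule rmodule_dsum_module[OF M.rmodule_axioms N.rmodule_axioms])
  obtain S where S: "S \<subseteq> carrier M" "finite S"
      "\<And>U. submodule U A M \<Longrightarrow> S \<subseteq> U \<Longrightarrow> U = carrier M"
    using assms(1) by (auto simp: fg_module_def)
  obtain T where T: "T \<subseteq> carrier N" "finite T"
      "\<And>U. submodule U A N \<Longrightarrow> T \<subseteq> U \<Longrightarrow> U = carrier N"
    using assms(2) by (auto simp: fg_module_def)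
  let ?S = "(\<lambda>x. (x, \<zero>\<^bsub>N\<^esub>)) ` S \<union> (\<lambda>y. (\<zero>\<^bsub>M\<^esub>, y)) ` T"
  have "U = carrier (dsum_module M N)" if U: "submodule U A (dsum_module M N)" "?S \<subseteq> U" for U
  proof
    have UD: "U \<subseteq> carrier M \<times> carrier N" "(\<zero>\<^bsub>M\<^esub>, \<zero>\<^bsub>N\<^esub>) \<in> U"
      "\<And>p q. p \<in> U \<Longrightarrow> q \<in> U \<Longrightarrow> p \<oplus>\<^bsub>dsum_module M N\<^esub> q \<in> U"
      "\<And>a p. a \<in> carrier A \<Longrightarrow> p \<in> U \<Longrightarrow> a \<odot>\<^bsub>dsum_module M N\<^esub> p \<in> U"
      using U(1) unfolding MN.submodule_iff by auto
    show "U \<subseteq> carrier (dsum_module M N)" using UD(1) by simp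
    have "{x \<in> carrier M. (x, \<zero>\<^bsub>N\<^esub>) \<in> U} = carrier M"
    proof (rule S(3))
      show "submodule {x \<in> carrier M. (x, \<zero>\<^bsub>N\<^esub>) \<in> U} A M"
        unfolding M.submodule_iff
        using UD(2) UD(3)[of "(_, \<zero>\<^bsub>N\<^esub>)" "(_, \<zero>\<^bsub>N\<^esub>)"] UD(4)[of _ "(_, \<zero>\<^bsub>N\<^esub>)"] by auto
    qed (use U(2) S(1) in auto)
    moreover have "{y \<in> carrier N. (\<zero>\<^bsub>M\<^esub>, y) \<in> U} = carrier N"
    proof (rule T(3))
      show "submodule {y \<in> carrier N. (\<zero>\<^bsub>M\<^esub>, y) \<in> U} A N"
        unfolding N.submodule_iff
        using UD(2) UD(3)[of "(\<zero>\<^bsub>M\<^esub>, _)" "(\<zero>\<^bsub>M\<^esub>, _)"] UD(4)[of _ "(\<zero>\<^bsub>M\<^esub>, _)"] by auto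
    qed (use U(2) T(1) in auto)
    ultimately have "(x, \<zero>\<^bsub>N\<^esub>) \<oplus>\<^bsub>dsum_module M N\<^esub> (\<zero>\<^bsub>M\<^esub>, y) \<in> U"
      if "x \<in> carrier M" "y \<in> carrier N" for x y
      using that by (intro UD(3)) auto
    then show "carrier (dsum_module M N) \<subseteq> U" by auto
  qed
  then show ?thesis
    unfolding fg_module_def using S(1,2) T(1,2)
    by (intro conjI MN.rmodule_axioms exI[of _ ?S]) auto
qed

lemma dsum_module_projective:
  assumes "projective A M" "projective A N"
  shows "projective A (dsum_module M N)"
proof -
  interpret M: rmodule A M using assms(1) by (simp add: projective_def)
  interpret N: rmodule A N using assms(2) by (simp add: projective_def)
  interpret MN: rmodule A "dsum_module M N"
    by (rule rmodule_dsum_module[OF M.rmodule_axioms N.rmodule_axioms])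
  show ?thesis
    unfolding projective_def
  proof (intro conjI allI impI MN.rmodule_axioms)
    fix B C :: "('a, 'a fgu) module" and p h
    assume "rmodule A B \<and> rmodule A C \<and> p \<in> mod_Hom A B C \<and> p ` carrier B = carrier C \<and>
      h \<in> mod_Hom A (dsum_module M N) C"
    then have B: "rmodule A B" and C: "rmodule A C" and p: "p \<in> mod_Hom A B C"
      and surj: "p ` carrier B = carrier C" and h: "h \<in> mod_Hom A (dsum_module M N) C" by auto
    interpret p: rmodule_hom A B C p using B C p by (rule rmodule_homI)
    interpret h: rmodule_hom A "dsum_module M N" C h
      using MN.rmodule_axioms C h by (rule rmodule_homI)
    define h1 where "h1 = (\<lambda>x\<in>carrier M. h (x, \<zero>\<^bsub>N\<^esub>))"
    define h2 where "h2 = (\<lambda>y\<in>carrier N. h (\<zero>\<^bsub>M\<^esub>, y))"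
    have "h1 \<in> mod_Hom A M C"
      unfolding h1_def
      by (rule mod_HomI[OF M.rmodule_axioms]) (simp_all flip: h.add h.smult)
    with assms(1) B C p surj obtain k1 where
      k1: "k1 \<in> mod_Hom A M B" "compose (carrier M) p k1 = h1"
      unfolding projective_def by meson
    have "h2 \<in> mod_Hom A N C"
      unfolding h2_def
      by (rule mod_HomI[OF N.rmodule_axioms]) (simp_all flip: h.add h.smult)
    with assms(2) B C p surj obtain k2 where
      k2: "k2 \<in> mod_Hom A N B" "compose (carrier N) p k2 = h2"
      unfolding projective_def by meson
    interpret k1: rmodule_hom A M B k1 using M.rmodule_axioms B k1(1) by (rule rmodule_homI)
    interpret k2: rmodule_hom A N B k2 using N.rmodule_axioms B k2(1) by (rule rmodule_homI)
    define k where "k = (\<lambda>z\<in>carrier (dsum_module M N). k1 (fst z) \<oplus>\<^bsub>B\<^esub> k2 (snd z))"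
    have k: "k \<in> mod_Hom A (dsum_module M N) B"
      unfolding k_def
      by (rule mod_HomI[OF MN.rmodule_axioms])
        (auto simp: k1.add k2.add k1.smult k2.smult p.M.smult_r_distr p.M.M.add.m_ac)
    have "compose (carrier (dsum_module M N)) p k = h"
    proof (rule mod_Hom_eqI)
      show "compose (carrier (dsum_module M N)) p k \<in> mod_Hom A (dsum_module M N) C"
        using k p MN.rmodule_axioms by (rule mod_Hom_compose)
      show "h \<in> mod_Hom A (dsum_module M N) C" by (rule h)
      fix z assume "z \<in> carrier (dsum_module M N)"
      then obtain x y where xy: "z = (x, y)" "x \<in> carrier M" "y \<in> carrier N" by auto
      have "p (k1 x) = h (x, \<zero>\<^bsub>N\<^esub>)" "p (k2 y) = h (\<zero>\<^bsub>M\<^esub>, y)"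
        using fun_cong[OF k1(2), of x] fun_cong[OF k2(2), of y] xy
        by (simp_all add: h1_def h2_def compose_eq)
      then show "compose (carrier (dsum_module M N)) p k z = h z"
        using xy h.add[of "(x, \<zero>\<^bsub>N\<^esub>)" "(\<zero>\<^bsub>M\<^esub>, y)"] by (simp add: compose_eq k_def p.add)
    qed
    then show "\<exists>k\<in>mod_Hom A (dsum_module M N) B. compose (carrier (dsum_module M N)) p k = h"
      using k by blast
  qed
qed

lemma projective_iso:
  assumes "projective A M" "rmodule A N" "j \<in> mod_iso A M N"
  shows "projective A N"
proof -
  interpret M: rmodule A M using assms(1) by (simp add: projective_def)
  interpret N: rmodule A N by fact
  have j: "j \<in> mod_Hom A M N" "bij_betw j (carrier M) (carrier N)"
    using assms(3) by (auto simp: mod_iso_def)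
  define j' where "j' = (\<lambda>y\<in>carrier N. inv_into (carrier M) j y)"
  have "j' \<in> mod_iso A N M"
    unfolding j'_def by (rule mod_iso_inverse[OF assms(3) M.rmodule_axioms N.rmodule_axioms])
  then have jH: "j' \<in> mod_Hom A N M" by (simp add: mod_iso_def)
  have jj: "j (j' y) = y" if "y \<in> carrier N" for y
    using that j(2) by (auto simp: j'_def bij_betw_def f_inv_into_f)
  show ?thesis
    unfolding projective_def
  proof (intro conjI allI impI N.rmodule_axioms)
    fix B C :: "('a, 'a fgu) module" and p h
    assume "rmodule A B \<and> rmodule A C \<and> p \<in> mod_Hom A B C \<and> p ` carrier B = carrier C \<and>
      h \<in> mod_Hom A N C"
    then have B: "rmodule A B" and C: "rmodule A C" and p: "p \<in> mod_Hom A B C"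
      and surj: "p ` carrier B = carrier C" and h: "h \<in> mod_Hom A N C" by auto
    have "compose (carrier M) h j \<in> mod_Hom A M C"
      using j(1) h M.rmodule_axioms by (rule mod_Hom_compose)
    with assms(1) B C p surj obtain k where
      k: "k \<in> mod_Hom A M B" "compose (carrier M) p k = compose (carrier M) h j"
      unfolding projective_def by meson
    have "compose (carrier N) p (compose (carrier N) k j') = h"
    proof (rule mod_Hom_eqI)
      show "compose (carrier N) p (compose (carrier N) k j') \<in> mod_Hom A N C"
        by (rule mod_Hom_compose[OF mod_Hom_compose[OF jH k(1) N.rmodule_axioms] p N.rmodule_axioms])
      show "h \<in> mod_Hom A N C" by (rule h)
      fix y assume y: "y \<in> carrier N"
      then have "j' y \<in> carrier M" using jH by (rule mod_Hom_closed[rotated])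
      then show "compose (carrier N) p (compose (carrier N) k j') y = h y"
        using fun_cong[OF k(2), of "j' y"] y jj by (simp add: compose_eq)
    qed
    moreover have "compose (carrier N) k j' \<in> mod_Hom A N B"
      using jH k(1) N.rmodule_axioms by (rule mod_Hom_compose)
    ultimately show "\<exists>k\<in>mod_Hom A N B. compose (carrier N) p k = h" by blast
  qed
qed

lemma zero_module_fg_projective:
  assumes "ring A"
  shows "fg_module A zero_module" "projective A zero_module"
proof -
  interpret Z: rmodule A zero_module by (rule rmodule_zero_module[OF assms])
  interpret dual_basis A zero_module 0 "\<lambda>_. ()" "\<lambda>_ _. \<zero>\<^bsub>A\<^esub>"
    by unfold_locales auto
  show "fg_module A zero_module" "projective A zero_module" by (rule fg_module projective)+
qed

section \<open>The morphism category\<close>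

lemma H_mor_iff:
  "s \<in> H_mor A F G \<longleftrightarrow> fst s \<in> mod_Hom A (src F) (src G) \<and> snd s \<in> mod_Hom A (tgt F) (tgt G) \<and>
     (\<forall>x\<in>carrier (src F). snd s (arr F x) = arr G (fst s x))"
proof -
  have "compose (carrier (src F)) (snd s) (arr F) = compose (carrier (src F)) (arr G) (fst s) \<longleftrightarrow>
      (\<forall>x\<in>carrier (src F). snd s (arr F x) = arr G (fst s x))"
    by (auto simp: compose_def fun_eq_iff)
  then show ?thesis by (auto simp: H_mor_def split_beta)
qed

lemma H_objD:
  assumes "H_obj A F"
  shows "rmodule A (src F)" "rmodule A (tgt F)" "arr F \<in> mod_Hom A (src F) (tgt F)"
  using assms by (auto simp: H_obj_def fg_module_def)

lemma P_objD:
  assumes "P_obj A F"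
  shows "rmodule A (src F)" "rmodule A (tgt F)" "arr F \<in> mod_Hom A (src F) (tgt F)"
    "fg_module A (src F)" "fg_module A (tgt F)" "projective A (src F)" "projective A (tgt F)"
  using assms by (auto simp: P_obj_def H_obj_def fg_module_def)

lemma H_mor_eqI:
  assumes "s \<in> H_mor A F G" "s' \<in> H_mor A F G'"
    and "\<And>x. x \<in> carrier (src F) \<Longrightarrow> fst s x = fst s' x"
    and "\<And>y. y \<in> carrier (tgt F) \<Longrightarrow> snd s y = snd s' y"
  shows "s = s'"
proof (rule prod_eqI)
  show "fst s = fst s'"
    by (rule mod_Hom_eqI[of _ A "src F" "src G" _ "src G'"]) (use assms in \<open>simp_all add: H_mor_iff\<close>)
  show "snd s = snd s'"
    by (rule mod_Hom_eqI[of _ A "tgt F" "tgt G" _ "tgt G'"]) (use assms in \<open>simp_all add: H_mor_iff\<close>)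
qed

lemma H_comp_apply [simp]:
  "x \<in> carrier (src F) \<Longrightarrow> fst (H_comp F t s) x = fst t (fst s x)"
  "y \<in> carrier (tgt F) \<Longrightarrow> snd (H_comp F t s) y = snd t (snd s y)"
  by (simp_all add: H_comp_def compose_eq)

lemma H_id_apply [simp]:
  "x \<in> carrier (src F) \<Longrightarrow> fst (H_id F) x = x"
  "y \<in> carrier (tgt F) \<Longrightarrow> snd (H_id F) y = y"
  by (simp_all add: H_id_def)

lemma H_mor_closed:
  assumes "s \<in> H_mor A F G"
  shows "x \<in> carrier (src F) \<Longrightarrow> fst s x \<in> carrier (src G)"
    and "y \<in> carrier (tgt F) \<Longrightarrow> snd s y \<in> carrier (tgt G)"
  using assms by (auto simp: H_mor_iff mod_Hom_closed)

lemma H_comp_mor: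
  assumes "s \<in> H_mor A F G" "t \<in> H_mor A G K" "H_obj A F"
  shows "H_comp F t s \<in> H_mor A F K"
proof -
  note F = H_objD[OF assms(3)]
  have "fst (H_comp F t s) \<in> mod_Hom A (src F) (src K)"
    "snd (H_comp F t s) \<in> mod_Hom A (tgt F) (tgt K)"
    using assms(1,2) F unfolding H_comp_def H_mor_iff fst_conv snd_conv
    by (blast intro: mod_Hom_compose)+
  moreover have "snd (H_comp F t s) (arr F x) = arr K (fst (H_comp F t s) x)"
    if x: "x \<in> carrier (src F)" for x
    using assms(1,2) x mod_Hom_closed[OF F(3) x] H_mor_closed(1)[OF assms(1) x]
    by (simp add: H_mor_iff)
  ultimately show ?thesis by (simp add: H_mor_iff)
qed

lemma H_id_mor: "H_obj A F \<Longrightarrow> H_id F \<in> H_mor A F F"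
  using H_objD[of A F] mod_Hom_closed[of "arr F" A "src F" "tgt F"]
  by (simp add: H_mor_iff) (simp add: H_id_def mod_Hom_id)

lemma H_comp_assoc:
  assumes "s \<in> H_mor A F G"
  shows "H_comp F (H_comp G u t) s = H_comp F u (H_comp F t s)"
  using H_mor_closed[OF assms] unfolding H_comp_def compose_def
  by (auto intro!: restrict_ext)

lemma H_comp_id_left:
  assumes "s \<in> H_mor A F G" "H_obj A F" "H_obj A G"
  shows "H_comp F (H_id G) s = s"
  by (rule H_mor_eqI[OF H_comp_mor[OF assms(1) H_id_mor[OF assms(3)] assms(2)] assms(1)])
    (simp_all add: H_mor_closed[OF assms(1)])

lemma H_comp_id_right:
  assumes "s \<in> H_mor A F G" "H_obj A F"
  shows "H_comp F s (H_id F) = s"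
  by (rule H_mor_eqI[OF H_comp_mor[OF H_id_mor[OF assms(2)] assms(1) assms(2)] assms(1)]) simp_all

text \<open>The almost split conditions test only against objects on \<open>'a fgu\<close>. A copy
  there, together with maps to it and back that compose to the identity, transfers them to objects
  on arbitrary types.\<close>

lemma P_obj_has_copy:
  fixes A :: "'a ring" and K :: "('a, 'x, 'y) mobj"
  assumes K: "P_obj A K"
  shows "\<exists>(K' :: ('a, 'a fgu, 'a fgu) mobj) j j'. P_obj A K' \<and> j \<in> H_mor A K K' \<and>
    j' \<in> H_mor A K' K \<and> H_comp K j' j = H_id K"
proof -
  note KD = P_objD[OF K]
  obtain S :: "('a, 'a fgu) module" and j1 where S: "fg_module A S" "j1 \<in> mod_iso A (src K) S"
    using fg_module_has_copy[OF KD(4)] by blast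
  obtain T :: "('a, 'a fgu) module" and j2 where T: "fg_module A T" "j2 \<in> mod_iso A (tgt K) T"
    using fg_module_has_copy[OF KD(5)] by blast
  have rS: "rmodule A S" and rT: "rmodule A T" using S T by (auto simp: fg_module_def)
  define i1 where "i1 = (\<lambda>y\<in>carrier S. inv_into (carrier (src K)) j1 y)"
  define i2 where "i2 = (\<lambda>y\<in>carrier T. inv_into (carrier (tgt K)) j2 y)"
  have i1: "i1 \<in> mod_iso A S (src K)"
    unfolding i1_def by (rule mod_iso_inverse[OF S(2) KD(1) rS])
  have i2: "i2 \<in> mod_iso A T (tgt K)"
    unfolding i2_def by (rule mod_iso_inverse[OF T(2) KD(2) rT])
  have h: "j1 \<in> mod_Hom A (src K) S" "j2 \<in> mod_Hom A (tgt K) T"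
    "i1 \<in> mod_Hom A S (src K)" "i2 \<in> mod_Hom A T (tgt K)"
    using S(2) T(2) i1 i2 by (auto simp: mod_iso_def)
  have i1j1: "i1 (j1 x) = x" if "x \<in> carrier (src K)" for x
    using that S(2) mod_Hom_closed[OF h(1) that] by (auto simp: i1_def mod_iso_def bij_betw_def)
  have i2j2: "i2 (j2 x) = x" if "x \<in> carrier (tgt K)" for x
    using that T(2) mod_Hom_closed[OF h(2) that] by (auto simp: i2_def mod_iso_def bij_betw_def)
  have j2i2: "j2 (i2 x) = x" if "x \<in> carrier T" for x
    using that T(2) by (auto simp: i2_def mod_iso_def bij_betw_def f_inv_into_f)
  define K' where "K' = \<lparr>src = S, tgt = T,
    arr = compose (carrier S) j2 (compose (carrier S) (arr K) i1)\<rparr>"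
  have "arr K' \<in> mod_Hom A (src K') (tgt K')"
    unfolding K'_def mobj.simps
    by (rule mod_Hom_compose[OF mod_Hom_compose[OF h(3) KD(3) rS] h(2) rS])
  then have K': "P_obj A K'"
    using S T projective_iso[OF KD(6) rS S(2)] projective_iso[OF KD(7) rT T(2)]
    by (simp add: P_obj_def H_obj_def K'_def)
  moreover have "(j1, j2) \<in> H_mor A K K'"
    using h mod_Hom_closed[OF h(1)] by (simp add: H_mor_iff K'_def compose_eq i1j1)
  moreover have "(i1, i2) \<in> H_mor A K' K"
    using h mod_Hom_closed[OF h(3)] mod_Hom_closed[OF KD(3)]
    by (simp add: H_mor_iff K'_def compose_eq i2j2)
  moreover have "H_comp K (i1, i2) (j1, j2) = H_id K"
    unfolding H_comp_def H_id_def compose_def by (auto simp: i1j1 i2j2 intro!: restrict_ext)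
  ultimately show ?thesis by blast
qed

text \<open>Replace \<open>h\<close> by \<open>j h\<close>. A retraction of \<open>j h\<close>
  composed with \<open>j\<close> would be one of \<open>h\<close>, and a factorization of
  \<open>j h\<close> is carried back by \<open>j'\<close>.\<close>

lemma left_almost_split_factor:
  fixes A :: "'a ring" and K :: "('a, 'x, 'y) mobj"
  assumes s: "left_almost_split A F G s" and F: "P_obj A F" and G: "P_obj A G" and K: "P_obj A K"
    and h: "h \<in> H_mor A F K" and ns: "\<not> split_mono A F K h"
  shows "\<exists>k\<in>H_mor A G K. H_comp F k s = h"
proof -
  have HF: "H_obj A F" and HG: "H_obj A G" and HK: "H_obj A K" using F G K by (auto simp: P_obj_def)
  have sH: "s \<in> H_mor A F G" using s by (simp add: left_almost_split_def)
  obtain K' :: "('a, 'a fgu, 'a fgu) mobj" and j j' where K': "P_obj A K'"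
    and j: "j \<in> H_mor A K K'" and j': "j' \<in> H_mor A K' K" and jj: "H_comp K j' j = H_id K"
    using P_obj_has_copy[OF K] by blast
  have hj: "H_comp F j h \<in> H_mor A F K'" using h j HF by (rule H_comp_mor)
  have "\<not> split_mono A F K' (H_comp F j h)"
  proof
    assume "split_mono A F K' (H_comp F j h)"
    then obtain t where t: "t \<in> H_mor A K' F" "H_comp F t (H_comp F j h) = H_id F"
      by (auto simp: split_mono_def)
    have "H_comp K t j \<in> H_mor A K F" using j t(1) HK by (rule H_comp_mor)
    moreover have "H_comp F (H_comp K t j) h = H_id F"
      using t(2) by (simp add: H_comp_assoc[OF h])
    ultimately show False using ns by (auto simp: split_mono_def)
  qed
  then obtain k where k: "k \<in> H_mor A G K'" "H_comp F k s = H_comp F j h"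
    using s K' hj unfolding left_almost_split_def by blast
  have "H_comp F (H_comp G j' k) s = H_comp F (H_comp K j' j) h"
    by (simp add: H_comp_assoc[OF sH] H_comp_assoc[OF h] k(2))
  also have "\<dots> = h" using H_comp_id_left[OF h HF HK] jj by simp
  finally show ?thesis using H_comp_mor[OF k(1) j' HG] by blast
qed

text \<open>Replace \<open>h\<close> by \<open>h j'\<close>. A section of \<open>h j'\<close>
  followed by \<open>j'\<close> would be one of \<open>h\<close>, and a factorization of
  \<open>h j'\<close> is precomposed with \<open>j\<close>.\<close>

lemma right_almost_split_factor:
  fixes A :: "'a ring" and K :: "('a, 'x, 'y) mobj"
  assumes t: "right_almost_split A F G t" and F: "P_obj A F" and G: "P_obj A G" and K: "P_obj A K"
    and h: "h \<in> H_mor A K G" and ns: "\<not> split_epi A K G h"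
  shows "\<exists>k\<in>H_mor A K F. H_comp K t k = h"
proof -
  have HF: "H_obj A F" and HG: "H_obj A G" and HK: "H_obj A K" using F G K by (auto simp: P_obj_def)
  obtain K' :: "('a, 'a fgu, 'a fgu) mobj" and j j' where K': "P_obj A K'"
    and j: "j \<in> H_mor A K K'" and j': "j' \<in> H_mor A K' K" and jj: "H_comp K j' j = H_id K"
    using P_obj_has_copy[OF K] by blast
  have HK': "H_obj A K'" using K' by (simp add: P_obj_def)
  have hj: "H_comp K' h j' \<in> H_mor A K' G" using j' h HK' by (rule H_comp_mor)
  have "\<not> split_epi A K' G (H_comp K' h j')"
  proof
    assume "split_epi A K' G (H_comp K' h j')"
    then obtain r where r: "r \<in> H_mor A G K'" "H_comp G (H_comp K' h j') r = H_id G"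
      by (auto simp: split_epi_def)
    have "H_comp G j' r \<in> H_mor A G K" using r(1) j' HG by (rule H_comp_mor)
    moreover have "H_comp G h (H_comp G j' r) = H_id G"
      using r(2) by (simp add: H_comp_assoc[OF r(1)])
    ultimately show False using ns by (auto simp: split_epi_def)
  qed
  then obtain k where k: "k \<in> H_mor A K' F" "H_comp K' t k = H_comp K' h j'"
    using t K' hj unfolding right_almost_split_def by blast
  have "H_comp K t (H_comp K k j) = H_comp K h (H_comp K j' j)"
    by (simp flip: H_comp_assoc[OF j] add: k(2))
  also have "\<dots> = h" using H_comp_id_right[OF h HK] jj by simp
  finally show ?thesis using H_comp_mor[OF j k(1) HK] by blast
qed

text \<open>The inverses of the two components again form a commuting square, as is seen by
  cancelling the bijections in the square of \<open>s\<close>.\<close>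

lemma H_isoI:
  assumes F: "H_obj A F" and G: "H_obj A G" and s: "s \<in> H_mor A F G"
    and b1: "bij_betw (fst s) (carrier (src F)) (carrier (src G))"
    and b2: "bij_betw (snd s) (carrier (tgt F)) (carrier (tgt G))"
  shows "s \<in> H_iso A F G"
proof -
  note FD = H_objD[OF F] and GD = H_objD[OF G]
  have sH: "fst s \<in> mod_Hom A (src F) (src G)" "snd s \<in> mod_Hom A (tgt F) (tgt G)"
    "\<And>x. x \<in> carrier (src F) \<Longrightarrow> snd s (arr F x) = arr G (fst s x)"
    using s by (auto simp: H_mor_iff)
  define t1 where "t1 = (\<lambda>y\<in>carrier (src G). inv_into (carrier (src F)) (fst s) y)"
  define t2 where "t2 = (\<lambda>y\<in>carrier (tgt G). inv_into (carrier (tgt F)) (snd s) y)"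
  have t: "t1 \<in> mod_Hom A (src G) (src F)" "t2 \<in> mod_Hom A (tgt G) (tgt F)"
    unfolding t1_def t2_def
    using mod_iso_inverse[of "fst s" A "src F" "src G"] mod_iso_inverse[of "snd s" A "tgt F" "tgt G"]
      sH b1 b2 FD GD by (auto simp: mod_iso_def)
  have ts: "t1 (fst s x) = x" if "x \<in> carrier (src F)" for x
    using that b1 mod_Hom_closed[OF sH(1) that] by (simp add: t1_def bij_betw_def)
  have ts2: "t2 (snd s x) = x" if "x \<in> carrier (tgt F)" for x
    using that b2 mod_Hom_closed[OF sH(2) that] by (simp add: t2_def bij_betw_def)
  have st: "fst s (t1 x) = x" if "x \<in> carrier (src G)" for x
    using that b1 by (auto simp: t1_def bij_betw_def f_inv_into_f)
  have st2: "snd s (t2 x) = x" if "x \<in> carrier (tgt G)" for x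
    using that b2 by (auto simp: t2_def bij_betw_def f_inv_into_f)
  have "t2 (arr G x) = arr F (t1 x)" if x: "x \<in> carrier (src G)" for x
    using sH(3)[OF mod_Hom_closed[OF t(1) x]] st[OF x]
      ts2[OF mod_Hom_closed[OF FD(3) mod_Hom_closed[OF t(1) x]]] by simp
  then have "(t1, t2) \<in> H_mor A G F" using t by (simp add: H_mor_iff)
  moreover have "H_comp F (t1, t2) s = H_id F" "H_comp G s (t1, t2) = H_id G"
    unfolding H_comp_def H_id_def compose_def by (auto simp: ts ts2 st st2 intro!: restrict_ext)
  ultimately show ?thesis using s by (auto simp: H_iso_def)
qed

section \<open>Chain conditions over Artin algebras\<close>

text \<open>Recursion over a list of generators lets the chain condition be proved by splitting off
  one generator at a time.\<close>

fun lin_span :: "'a ring \<Rightarrow> ('a, 'm) module \<Rightarrow> 'm list \<Rightarrow> 'm set" where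
  "lin_span A M [] = {\<zero>\<^bsub>M\<^esub>}"
| "lin_span A M (s # ss) = {a \<odot>\<^bsub>M\<^esub> s \<oplus>\<^bsub>M\<^esub> m | a m. a \<in> carrier A \<and> m \<in> lin_span A M ss}"

context rmodule
begin

lemma submodule_lin_span:
  "set ss \<subseteq> carrier M \<Longrightarrow> submodule (lin_span A M ss) A M"
proof (induction ss)
  case Nil
  then show ?case using submodule_zero by simp
next
  case (Cons s ss)
  then have s: "s \<in> carrier M" by simp
  have L: "lin_span A M ss \<subseteq> carrier M" "\<zero>\<^bsub>M\<^esub> \<in> lin_span A M ss"
    "\<And>x y. x \<in> lin_span A M ss \<Longrightarrow> y \<in> lin_span A M ss \<Longrightarrow> x \<oplus>\<^bsub>M\<^esub> y \<in> lin_span A M ss"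
    "\<And>a x. a \<in> carrier A \<Longrightarrow> x \<in> lin_span A M ss \<Longrightarrow> a \<odot>\<^bsub>M\<^esub> x \<in> lin_span A M ss"
    using Cons unfolding submodule_iff by auto
  have mem: "x \<in> lin_span A M (s # ss)"
    if "x = a \<odot>\<^bsub>M\<^esub> s \<oplus>\<^bsub>M\<^esub> m" "a \<in> carrier A" "m \<in> lin_span A M ss" for x a m
    using that by auto
  show ?case
    unfolding submodule_iff
  proof (intro conjI subsetI ballI)
    fix x assume "x \<in> lin_span A M (s # ss)"
    then show "x \<in> carrier M" using s subsetD[OF L(1)] by auto
  next
    show "\<zero>\<^bsub>M\<^esub> \<in> lin_span A M (s # ss)"
      using s L(2) by (intro mem[of _ "\<zero>\<^bsub>A\<^esub>" "\<zero>\<^bsub>M\<^esub>"]) auto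
  next
    fix x y assume "x \<in> lin_span A M (s # ss)" "y \<in> lin_span A M (s # ss)"
    then obtain a m b m' where *: "a \<in> carrier A" "b \<in> carrier A" "m \<in> lin_span A M ss"
      "m' \<in> lin_span A M ss" "x = a \<odot>\<^bsub>M\<^esub> s \<oplus>\<^bsub>M\<^esub> m" "y = b \<odot>\<^bsub>M\<^esub> s \<oplus>\<^bsub>M\<^esub> m'" by auto
    then have "x \<oplus>\<^bsub>M\<^esub> y = (a \<oplus>\<^bsub>A\<^esub> b) \<odot>\<^bsub>M\<^esub> s \<oplus>\<^bsub>M\<^esub> (m \<oplus>\<^bsub>M\<^esub> m')"
      using s subsetD[OF L(1)] by (simp add: smult_l_distr M.add.m_ac)
    then show "x \<oplus>\<^bsub>M\<^esub> y \<in> lin_span A M (s # ss)"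
      by (rule mem) (use * L(3) in auto)
  next
    fix c x assume c: "c \<in> carrier A" and "x \<in> lin_span A M (s # ss)"
    then obtain a m where *: "a \<in> carrier A" "m \<in> lin_span A M ss" "x = a \<odot>\<^bsub>M\<^esub> s \<oplus>\<^bsub>M\<^esub> m" by auto
    then have "c \<odot>\<^bsub>M\<^esub> x = (a \<otimes>\<^bsub>A\<^esub> c) \<odot>\<^bsub>M\<^esub> s \<oplus>\<^bsub>M\<^esub> c \<odot>\<^bsub>M\<^esub> m"
      using c s subsetD[OF L(1)] by (simp add: smult_r_distr smult_assoc)
    then show "c \<odot>\<^bsub>M\<^esub> x \<in> lin_span A M (s # ss)"
      by (rule mem) (use * c L(4) in auto)
  qed
qed

lemma set_subset_lin_span:
  "set ss \<subseteq> carrier M \<Longrightarrow> set ss \<subseteq> lin_span A M ss"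
proof (induction ss)
  case (Cons s ss)
  then have "\<zero>\<^bsub>M\<^esub> \<in> lin_span A M ss"
    using submodule_lin_span[of ss] unfolding submodule_iff by auto
  moreover have "\<one>\<^bsub>A\<^esub> \<odot>\<^bsub>M\<^esub> s \<oplus>\<^bsub>M\<^esub> \<zero>\<^bsub>M\<^esub> = s" using Cons.prems by simp
  ultimately have "s \<in> lin_span A M (s # ss)"
    unfolding lin_span.simps mem_Collect_eq by (metis R.one_closed)
  moreover have "x \<in> lin_span A M (s # ss)" if x: "x \<in> set ss" for x
  proof -
    have "s \<in> carrier M" "x \<in> carrier M" using Cons.prems x by auto
    then have "\<zero>\<^bsub>A\<^esub> \<odot>\<^bsub>M\<^esub> s \<oplus>\<^bsub>M\<^esub> x = x" by simp
    moreover have "x \<in> lin_span A M ss" using Cons.IH Cons.prems x by fastforce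
    ultimately show ?thesis unfolding lin_span.simps mem_Collect_eq by (metis R.zero_closed)
  qed
  ultimately show ?case by auto
qed simp

text \<open>Finite generation is defined through submodules; this converts it into linear
  combinations on which one can induct.\<close>

lemma fg_lin_span:
  assumes "fg_module A M"
  shows "\<exists>ss. set ss \<subseteq> carrier M \<and> lin_span A M ss = carrier M"
proof -
  obtain S where S: "S \<subseteq> carrier M" "finite S"
      "\<And>U. submodule U A M \<Longrightarrow> S \<subseteq> U \<Longrightarrow> U = carrier M"
    using assms by (auto simp: fg_module_def)
  obtain ss where ss: "set ss = S" using finite_list[OF S(2)] by blast
  then have ssM: "set ss \<subseteq> carrier M" using S(1) by simp
  have "lin_span A M ss = carrier M"
    using S(3)[OF submodule_lin_span[OF ssM]] set_subset_lin_span[OF ssM] ss by simp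
  with ssM show ?thesis by auto
qed

end

text \<open>Commutativity makes closure on one side enough, so the chain condition on ideals applies
  to sets of coefficients.\<close>

lemma submodule_regular_ideal:
  assumes "cring R" "submodule J R (regular_module R)"
  shows "ideal J R"
proof -
  interpret cring R by fact
  interpret Reg: rmodule R "regular_module R" by (rule rmodule_regular_module[OF ring_axioms])
  have J: "J \<subseteq> carrier R" "\<zero>\<^bsub>R\<^esub> \<in> J" "\<And>x y. x \<in> J \<Longrightarrow> y \<in> J \<Longrightarrow> x \<oplus>\<^bsub>R\<^esub> y \<in> J"
    "\<And>a x. a \<in> carrier R \<Longrightarrow> x \<in> J \<Longrightarrow> x \<otimes>\<^bsub>R\<^esub> a \<in> J"
    using assms(2) unfolding Reg.submodule_iff by auto
  have neg: "\<ominus>\<^bsub>R\<^esub> x \<in> J" if "x \<in> J" for x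
    using J(4)[of "\<ominus>\<^bsub>R\<^esub> \<one>\<^bsub>R\<^esub>" x] that subsetD[OF J(1) that] by (simp add: r_minus)
  have com: "a \<otimes>\<^bsub>R\<^esub> x \<in> J" if "a \<in> carrier R" "x \<in> J" for a x
    using J(4)[OF that] m_comm[of a x] that J(1) by auto
  show ?thesis
  proof (rule idealI[OF ring_axioms])
    show "subgroup J (add_monoid R)"
      by (rule add.subgroupI) (use J neg in auto)
  qed (use J com in auto)
qed

text \<open>Induction on the generators. A descending chain in the span of \<open>s # ss\<close> is
  constant as soon as both the ideals of coefficients at \<open>s\<close> and the intersections with
  the span of \<open>ss\<close> are constant; the former stabilize because \<open>R\<close> is
  Artinian, the latter by induction.\<close>

lemma artinian_cring_dcc:
  assumes R: "artinian_cring R" and M: "rmodule R M"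
  shows "set ss \<subseteq> carrier M \<Longrightarrow> (\<And>n. submodule (I n) R M) \<Longrightarrow> (\<And>n. I (Suc n) \<subseteq> I n) \<Longrightarrow>
    (\<And>n. I n \<subseteq> lin_span R M ss) \<Longrightarrow> \<exists>N. \<forall>n\<ge>N. I n = I N"
proof (induction ss arbitrary: I)
  case Nil
  interpret M: rmodule R M by fact
  have "I n = {\<zero>\<^bsub>M\<^esub>}" for n
    using Nil(4)[of n] Nil(2)[of n] by (auto simp: M.submodule_iff)
  then show ?case by simp
next
  case (Cons s ss)
  interpret M: rmodule R M by fact
  interpret R: cring R using R by (simp add: artinian_cring_def)
  interpret Reg: rmodule R "regular_module R" by (rule rmodule_regular_module[OF M.R.ring_axioms])
  have s: "s \<in> carrier M" and ss: "set ss \<subseteq> carrier M" using Cons.prems(1) by auto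
  let ?L = "lin_span R M ss"
  have Ls: "submodule ?L R M" by (rule M.submodule_lin_span[OF ss])
  then have L: "?L \<subseteq> carrier M" "\<zero>\<^bsub>M\<^esub> \<in> ?L" "\<And>x y. x \<in> ?L \<Longrightarrow> y \<in> ?L \<Longrightarrow> x \<oplus>\<^bsub>M\<^esub> y \<in> ?L"
    "\<And>a x. a \<in> carrier R \<Longrightarrow> x \<in> ?L \<Longrightarrow> a \<odot>\<^bsub>M\<^esub> x \<in> ?L"
    unfolding M.submodule_iff by auto
  have I: "I n \<subseteq> carrier M" "\<zero>\<^bsub>M\<^esub> \<in> I n" "\<And>x y. x \<in> I n \<Longrightarrow> y \<in> I n \<Longrightarrow> x \<oplus>\<^bsub>M\<^esub> y \<in> I n"
    "\<And>a x. a \<in> carrier R \<Longrightarrow> x \<in> I n \<Longrightarrow> a \<odot>\<^bsub>M\<^esub> x \<in> I n" for n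
    using Cons.prems(2)[of n] unfolding M.submodule_iff by auto
  \<comment> \<open>The coefficients at \<open>s\<close> of elements of \<open>I n\<close>, up to
    the span of the remaining generators.\<close>
  define J where "J n = {r \<in> carrier R. \<exists>m\<in>?L. r \<odot>\<^bsub>M\<^esub> s \<oplus>\<^bsub>M\<^esub> m \<in> I n}" for n
  have "submodule (J n) R (regular_module R)" for n
    unfolding Reg.submodule_iff
  proof (intro conjI ballI)
    show "J n \<subseteq> carrier (regular_module R)" by (auto simp: J_def)
    show "\<zero>\<^bsub>regular_module R\<^esub> \<in> J n"
      using L(2) I(2) s by (auto simp: J_def intro!: bexI[of _ "\<zero>\<^bsub>M\<^esub>"])
  next
    fix a b assume "a \<in> J n" "b \<in> J n"
    then obtain m m' where m: "a \<in> carrier R" "m \<in> ?L" "a \<odot>\<^bsub>M\<^esub> s \<oplus>\<^bsub>M\<^esub> m \<in> I n"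
      and m': "b \<in> carrier R" "m' \<in> ?L" "b \<odot>\<^bsub>M\<^esub> s \<oplus>\<^bsub>M\<^esub> m' \<in> I n"
      by (auto simp: J_def)
    have "(a \<oplus>\<^bsub>R\<^esub> b) \<odot>\<^bsub>M\<^esub> s \<oplus>\<^bsub>M\<^esub> (m \<oplus>\<^bsub>M\<^esub> m') = (a \<odot>\<^bsub>M\<^esub> s \<oplus>\<^bsub>M\<^esub> m) \<oplus>\<^bsub>M\<^esub> (b \<odot>\<^bsub>M\<^esub> s \<oplus>\<^bsub>M\<^esub> m')"
      using m(1,2) m'(1,2) s subsetD[OF L(1)] by (simp add: M.smult_l_distr M.M.add.m_ac)
    then have "(a \<oplus>\<^bsub>R\<^esub> b) \<odot>\<^bsub>M\<^esub> s \<oplus>\<^bsub>M\<^esub> (m \<oplus>\<^bsub>M\<^esub> m') \<in> I n"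
      using I(3)[OF m(3) m'(3)] by simp
    then show "a \<oplus>\<^bsub>regular_module R\<^esub> b \<in> J n"
      using m m' L(3) by (auto simp: J_def)
  next
    fix c a assume c: "c \<in> carrier R" and "a \<in> J n"
    then obtain m where m: "a \<in> carrier R" "m \<in> ?L" "a \<odot>\<^bsub>M\<^esub> s \<oplus>\<^bsub>M\<^esub> m \<in> I n"
      by (auto simp: J_def)
    have "(a \<otimes>\<^bsub>R\<^esub> c) \<odot>\<^bsub>M\<^esub> s \<oplus>\<^bsub>M\<^esub> c \<odot>\<^bsub>M\<^esub> m = c \<odot>\<^bsub>M\<^esub> (a \<odot>\<^bsub>M\<^esub> s \<oplus>\<^bsub>M\<^esub> m)"
      using m(1,2) c s subsetD[OF L(1)] by (simp add: M.smult_r_distr M.smult_assoc)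
    then have "(a \<otimes>\<^bsub>R\<^esub> c) \<odot>\<^bsub>M\<^esub> s \<oplus>\<^bsub>M\<^esub> c \<odot>\<^bsub>M\<^esub> m \<in> I n"
      using I(4)[OF c m(3)] by simp
    then show "c \<odot>\<^bsub>regular_module R\<^esub> a \<in> J n"
      using m c L(4) by (auto simp: J_def)
  qed
  then have "ideal (J n) R" for n
    by (rule submodule_regular_ideal[OF R.cring_axioms])
  moreover have "J (Suc n) \<subseteq> J n" for n
    using Cons.prems(3)[of n] by (auto simp: J_def)
  ultimately obtain N1 where N1: "\<And>n. n \<ge> N1 \<Longrightarrow> J n = J N1"
    using R unfolding artinian_cring_def by meson
  have "\<exists>N. \<forall>n\<ge>N. I n \<inter> ?L = I N \<inter> ?L"
    by (rule Cons.IH[OF ss]) (use Cons.prems(2,3) Ls M.submodule_Int in auto)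
  then obtain N2 where N2: "\<And>n. n \<ge> N2 \<Longrightarrow> I n \<inter> ?L = I N2 \<inter> ?L" by blast
  have dec: "I n \<subseteq> I m" if "m \<le> n" for m n
    using that Cons.prems(3) by (rule lift_Suc_antimono_le[rotated])
  have "I n = I (max N1 N2)" if n: "n \<ge> max N1 N2" for n
  proof
    show "I n \<subseteq> I (max N1 N2)" using n by (rule dec)
    show "I (max N1 N2) \<subseteq> I n"
    proof
      fix x assume x: "x \<in> I (max N1 N2)"
      then obtain r m where r: "r \<in> carrier R" "m \<in> ?L" "x = r \<odot>\<^bsub>M\<^esub> s \<oplus>\<^bsub>M\<^esub> m"
        using Cons.prems(4)[of "max N1 N2"] by auto
      then have "r \<in> J (max N1 N2)" using x by (auto simp: J_def)
      then have "r \<in> J n" using N1[of n] N1[of "max N1 N2"] n by simp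
      then obtain m' where m': "m' \<in> ?L" "r \<odot>\<^bsub>M\<^esub> s \<oplus>\<^bsub>M\<^esub> m' \<in> I n" by (auto simp: J_def)
      \<comment> \<open>An element of the smaller term with the same coefficient at \<open>s\<close>
        as \<open>x\<close>. The difference lies in the span of \<open>ss\<close>, where the two
        terms of the chain already agree.\<close>
      let ?y = "r \<odot>\<^bsub>M\<^esub> s \<oplus>\<^bsub>M\<^esub> m'"
      have mc: "m \<in> carrier M" "m' \<in> carrier M" using r m' L(1) by auto
      then have "x \<ominus>\<^bsub>M\<^esub> ?y = m \<ominus>\<^bsub>M\<^esub> m'"
        using r(1) s unfolding r(3) a_minus_def
        by (simp add: M.M.minus_add M.M.add.m_ac) (metis M.M.a_inv_closed M.M.add.m_assoc M.M.r_neg M.M.l_zero M.M.r_zero M.smult_closed)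
      moreover have "x \<ominus>\<^bsub>M\<^esub> ?y \<in> I (max N1 N2)"
        using dec[OF n] m'(2) x Cons.prems(2) by (intro M.submodule_diff) auto
      moreover have "m \<ominus>\<^bsub>M\<^esub> m' \<in> ?L"
        using r(2) m'(1) Ls by (intro M.submodule_diff)
      ultimately have "x \<ominus>\<^bsub>M\<^esub> ?y \<in> I (max N1 N2) \<inter> ?L" by simp
      then have "x \<ominus>\<^bsub>M\<^esub> ?y \<in> I n" using N2[of n] N2[of "max N1 N2"] n by auto
      moreover have "x \<in> carrier M" using x I(1) by auto
      ultimately show "x \<in> I n"
        using M.submodule_diff_cancel[OF Cons.prems(2) _ m'(2)] by blast
    qed
  qed
  then show ?case by blast
qed

locale artin_alg =
  fixes R :: "'r ring" and \<phi> :: "'r \<Rightarrow> 'a" and A :: "'a ring"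
  assumes artin: "artin_algebra R \<phi> A"
begin

sublocale central_ring_map R \<phi> A
  using artin
  by (simp add: artin_algebra_def artinian_cring_def central_ring_map_def central_ring_map_axioms_def)

text \<open>Products of \<open>R\<close>-generators of \<open>A\<close> with
  \<open>A\<close>-generators of \<open>M\<close> generate \<open>M\<close> over \<open>R\<close>.
  That a submodule \<open>U\<close> containing them is everything is tested on generators twice:
  first in the scalar with the vector fixed, then in the vector.\<close>

lemma fg_restrict_scalars:
  assumes "fg_module A M"
  shows "fg_module R (restrict_scalars \<phi> M)"
proof -
  interpret M: rmodule A M using assms by (simp add: fg_module_def)
  interpret RM: rmodule R "restrict_scalars \<phi> M" by (rule rmodule_restrict_scalars[OF M.rmodule_axioms])
  interpret Reg: rmodule R "restrict_scalars \<phi> (regular_module A)"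
    by (rule rmodule_restrict_scalars[OF rmodule_regular_module[OF A.ring_axioms]])
  obtain S where S: "S \<subseteq> carrier M" "finite S"
      "\<And>U. submodule U A M \<Longrightarrow> S \<subseteq> U \<Longrightarrow> U = carrier M"
    using assms by (auto simp: fg_module_def)
  have "fg_module R (restrict_scalars \<phi> (regular_module A))"
    using artin by (simp add: artin_algebra_def)
  then obtain T where T: "T \<subseteq> carrier A" "finite T"
      "\<And>U. submodule U R (restrict_scalars \<phi> (regular_module A)) \<Longrightarrow> T \<subseteq> U \<Longrightarrow> U = carrier A"
    by (auto simp: fg_module_def)
  let ?ST = "(\<lambda>(a, x). a \<odot>\<^bsub>M\<^esub> x) ` (T \<times> S)"
  have "U = carrier M" if U: "submodule U R (restrict_scalars \<phi> M)" "?ST \<subseteq> U" for U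
  proof -
    have UD: "U \<subseteq> carrier M" "\<zero>\<^bsub>M\<^esub> \<in> U" "\<And>x y. x \<in> U \<Longrightarrow> y \<in> U \<Longrightarrow> x \<oplus>\<^bsub>M\<^esub> y \<in> U"
      "\<And>r x. r \<in> carrier R \<Longrightarrow> x \<in> U \<Longrightarrow> \<phi> r \<odot>\<^bsub>M\<^esub> x \<in> U"
      using U(1) unfolding RM.submodule_iff by auto
    have "{a \<in> carrier A. a \<odot>\<^bsub>M\<^esub> x \<in> U} = carrier A" if x: "x \<in> S" for x
    proof (rule T(3))
      have xM: "x \<in> carrier M" using x S by auto
      show "submodule {a \<in> carrier A. a \<odot>\<^bsub>M\<^esub> x \<in> U} R (restrict_scalars \<phi> (regular_module A))"
        unfolding Reg.submodule_iff using xM UD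
        by (auto simp: M.smult_l_distr M.smult_assoc)
      show "T \<subseteq> {a \<in> carrier A. a \<odot>\<^bsub>M\<^esub> x \<in> U}" using x T(1) U(2) by auto
    qed
    then have AS: "a \<odot>\<^bsub>M\<^esub> x \<in> U" if "x \<in> S" "a \<in> carrier A" for a x
      using that by blast
    have "{x \<in> carrier M. \<forall>a\<in>carrier A. a \<odot>\<^bsub>M\<^esub> x \<in> U} = carrier M"
    proof (rule S(3))
      show "submodule {x \<in> carrier M. \<forall>a\<in>carrier A. a \<odot>\<^bsub>M\<^esub> x \<in> U} A M"
        unfolding M.submodule_iff using UD
        by (auto simp: M.smult_r_distr simp flip: M.smult_assoc)
      show "S \<subseteq> {x \<in> carrier M. \<forall>a\<in>carrier A. a \<odot>\<^bsub>M\<^esub> x \<in> U}" using S(1) AS by auto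
    qed
    then have "\<one>\<^bsub>A\<^esub> \<odot>\<^bsub>M\<^esub> x \<in> U" if "x \<in> carrier M" for x
      using that A.one_closed by blast
    then show ?thesis using UD(1) by auto
  qed
  then show ?thesis
    unfolding fg_module_def using S(1,2) T(1,2)
    by (intro conjI RM.rmodule_axioms exI[of _ ?ST]) auto
qed

text \<open>An \<open>A\<close>-submodule is an \<open>R\<close>-submodule of a finitely generated
  \<open>R\<close>-module, so there is no infinite strictly descending chain. All later uses of the
  chain condition pass through this form.\<close>

lemma minimal_submodule:
  assumes M: "fg_module A M" and \<U>: "\<And>U. U \<in> \<U> \<Longrightarrow> submodule U A M" and ne: "\<U> \<noteq> {}"
  shows "\<exists>U\<in>\<U>. \<forall>V\<in>\<U>. V \<subseteq> U \<longrightarrow> V = U"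
proof -
  interpret M: rmodule A M using M by (simp add: fg_module_def)
  interpret RM: rmodule R "restrict_scalars \<phi> M" by (rule rmodule_restrict_scalars[OF M.rmodule_axioms])
  obtain ss where ss: "set ss \<subseteq> carrier M" "lin_span R (restrict_scalars \<phi> M) ss = carrier M"
    using RM.fg_lin_span[OF fg_restrict_scalars[OF M]] by auto
  have aR: "artinian_cring R" using artin by (simp add: artin_algebra_def)
  have "wf {(V, U). submodule V A M \<and> submodule U A M \<and> V \<subset> U}"
    unfolding wf_iff_no_infinite_down_chain
  proof
    assume "\<exists>I. \<forall>n. (I (Suc n), I n) \<in> {(V, U). submodule V A M \<and> submodule U A M \<and> V \<subset> U}"
    then obtain I where "\<forall>n. submodule (I (Suc n)) A M \<and> submodule (I n) A M \<and> I (Suc n) \<subset> I n"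
      by auto
    then have I: "submodule (I n) A M" "I (Suc n) \<subset> I n" for n by blast+
    have "\<exists>N. \<forall>n\<ge>N. I n = I N"
    proof (rule artinian_cring_dcc[OF aR RM.rmodule_axioms])
      show "set ss \<subseteq> carrier (restrict_scalars \<phi> M)" using ss by simp
      show "submodule (I n) R (restrict_scalars \<phi> M)" for n
        by (rule submodule_restrict_scalars[OF M.rmodule_axioms I(1)])
      show "I (Suc n) \<subseteq> I n" for n using I(2)[of n] by blast
      show "I n \<subseteq> lin_span R (restrict_scalars \<phi> M) ss" for n
        using I(1)[of n] ss(2) by (simp add: M.submodule_iff)
    qed
    then obtain N where "I (Suc N) = I N" by (metis le_SucI order_refl)
    then show False using I(2)[of N] by simp
  qed
  then show ?thesis
  proof (rule wfE_min'[OF _ ne])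
    fix U assume U: "U \<in> \<U>"
      "\<And>V. (V, U) \<in> {(V, U). submodule V A M \<and> submodule U A M \<and> V \<subset> U} \<Longrightarrow> V \<notin> \<U>"
    have "V = U" if "V \<in> \<U>" "V \<subseteq> U" for V
      using U(2)[of V] U(1) that \<U> by auto
    then show ?thesis using U(1) by blast
  qed
qed

lemma injective_endo_surj:
  assumes M: "fg_module A M" and f: "f \<in> mod_Hom A M M" and inj: "inj_on f (carrier M)"
  shows "f ` carrier M = carrier M"
proof -
  interpret M: rmodule A M using M by (simp add: fg_module_def)
  interpret f: rmodule_hom A M M f by (intro rmodule_homI M.rmodule_axioms f)
  have sub: "submodule ((f ^^ n) ` carrier M) A M" for n
  proof (induction n)
    case 0
    then show ?case using M.submodule_carrier by simp
  next
    case (Suc n)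
    then have "submodule (f ` (f ^^ n) ` carrier M) A M" by (rule f.submodule_image)
    then show ?case by (simp add: image_comp)
  qed
  then have cl: "(f ^^ n) x \<in> carrier M" if "x \<in> carrier M" for n x
    using that unfolding M.submodule_iff by blast
  have injn: "inj_on (f ^^ n) (carrier M)" for n
  proof (induction n)
    case (Suc n)
    have "inj_on f ((f ^^ n) ` carrier M)"
      using inj cl by (rule_tac inj_on_subset) auto
    with Suc have "inj_on (f \<circ> f ^^ n) (carrier M)" by (rule comp_inj_on)
    then show ?case by (simp add: o_def)
  qed simp
  have "\<exists>U\<in>range (\<lambda>n. (f ^^ n) ` carrier M). \<forall>V\<in>range (\<lambda>n. (f ^^ n) ` carrier M). V \<subseteq> U \<longrightarrow> V = U"
    by (rule minimal_submodule[OF M]) (use sub in auto)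
  then obtain n where n: "\<And>m. (f ^^ m) ` carrier M \<subseteq> (f ^^ n) ` carrier M \<Longrightarrow>
      (f ^^ m) ` carrier M = (f ^^ n) ` carrier M" by auto
  have "(f ^^ Suc n) ` carrier M = (f ^^ n) ` f ` carrier M"
    unfolding funpow_Suc_right image_comp ..
  moreover have "(f ^^ n) ` f ` carrier M \<subseteq> (f ^^ n) ` carrier M"
    by (intro image_mono) auto
  ultimately have "(f ^^ n) ` f ` carrier M = (f ^^ n) ` carrier M"
    using n[of "Suc n"] by simp
  then show ?thesis
    using inj_on_image_eq_iff[OF injn[of n], of "f ` carrier M" "carrier M"] by auto
qed

text \<open>Restricted to \<open>R\<close>, the regular modules of \<open>A\<close> and of its
  opposite coincide along the identity, because \<open>\<phi> r\<close> acts equally from both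
  sides.\<close>

lemma artin_alg_op: "artin_alg R \<phi> (op_ring A)"
proof
  interpret Op: central_ring_map R \<phi> "op_ring A" by (rule central_ring_map_op)
  let ?M = "restrict_scalars \<phi> (regular_module A)"
  let ?N = "restrict_scalars \<phi> (regular_module (op_ring A))"
  have fg: "fg_module R ?M" using artin by (simp add: artin_algebra_def)
  interpret N: rmodule R ?N
    by (rule Op.rmodule_restrict_scalars[OF rmodule_regular_module[OF Op.A.ring_axioms]])
  have "(\<lambda>x\<in>carrier ?M. x) \<in> mod_Hom R ?M ?N"
    by (rule mod_HomI) (use fg central in \<open>auto simp: fg_module_def\<close>)
  then have "(\<lambda>x\<in>carrier ?M. x) \<in> mod_iso R ?M ?N"
    by (auto simp: mod_iso_def bij_betw_def inj_on_def)
  then have "fg_module R ?N" by (rule fg_module_iso[OF fg N.rmodule_axioms])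
  then show "artin_algebra R \<phi> (op_ring A)"
    using artin Op.A.ring_axioms Op.hom Op.central by (simp add: artin_algebra_def)
qed

end

section \<open>Maximal submodules and local projective modules\<close>

text \<open>Zorn's lemma for proper submodules: if the union of a chain were everything, a single
  member would already contain the finitely many generators.\<close>

lemma fg_module_maximal_submodule:
  assumes fg: "fg_module A M" and ne: "carrier M \<noteq> {\<zero>\<^bsub>M\<^esub>}"
  shows "\<exists>U. maximal_submodule A M U"
proof -
  interpret M: rmodule A M using fg by (simp add: fg_module_def)
  obtain S where S: "S \<subseteq> carrier M" "finite S"
      "\<And>U. submodule U A M \<Longrightarrow> S \<subseteq> U \<Longrightarrow> U = carrier M"
    using fg by (auto simp: fg_module_def)
  let ?\<A> = "{U. submodule U A M \<and> U \<noteq> carrier M}"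
  have "\<exists>W\<in>?\<A>. \<forall>X\<in>?\<A>. W \<subseteq> X \<longrightarrow> X = W"
  proof (rule subset_Zorn_nonempty)
    show "?\<A> \<noteq> {}" using M.submodule_zero ne by auto
    fix \<C> assume \<C>: "\<C> \<noteq> {}" "subset.chain ?\<A> \<C>"
    then have sub: "submodule U A M" "U \<noteq> carrier M" if "U \<in> \<C>" for U
      using that by (auto simp: subset.chain_def)
    have tot: "U \<subseteq> V \<or> V \<subseteq> U" if "U \<in> \<C>" "V \<in> \<C>" for U V
      using that \<C>(2) by (auto simp: subset_chain_def)
    have subc: "U \<subseteq> carrier M" "\<zero>\<^bsub>M\<^esub> \<in> U" if "U \<in> \<C>" for U
      using sub(1)[OF that] by (auto simp: M.submodule_iff)
    have "submodule (\<Union>\<C>) A M"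
      unfolding M.submodule_iff
    proof (intro conjI ballI)
      show "\<Union>\<C> \<subseteq> carrier M" using subc(1) by blast
      show "\<zero>\<^bsub>M\<^esub> \<in> \<Union>\<C>" using \<C>(1) subc(2) by blast
    next
      fix x y assume "x \<in> \<Union>\<C>" "y \<in> \<Union>\<C>"
      then obtain U V where UV: "U \<in> \<C>" "V \<in> \<C>" "x \<in> U" "y \<in> V" by blast
      obtain W where W: "W \<in> \<C>" "x \<in> W" "y \<in> W" using tot[OF UV(1,2)] UV by blast
      then have "x \<oplus>\<^bsub>M\<^esub> y \<in> W" using sub(1)[OF W(1)] by (simp add: M.submodule_iff)
      then show "x \<oplus>\<^bsub>M\<^esub> y \<in> \<Union>\<C>" using W(1) by blast
    next
      fix a x assume a: "a \<in> carrier A" and "x \<in> \<Union>\<C>"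
      then obtain U where U: "U \<in> \<C>" "x \<in> U" by blast
      then have "a \<odot>\<^bsub>M\<^esub> x \<in> U" using a sub(1)[OF U(1)] by (simp add: M.submodule_iff)
      then show "a \<odot>\<^bsub>M\<^esub> x \<in> \<Union>\<C>" using U(1) by blast
    qed
    moreover have "\<Union>\<C> \<noteq> carrier M"
    proof
      assume "\<Union>\<C> = carrier M"
      then obtain U where "U \<in> \<C>" "S \<subseteq> U"
        using finite_subset_Union_chain[OF S(2) _ \<C>] S(1) by metis
      then show False using S(3) sub by blast
    qed
    ultimately show "\<Union>\<C> \<in> ?\<A>" by simp
  qed
  then obtain W where W: "submodule W A M" "W \<noteq> carrier M"
    "\<And>X. submodule X A M \<Longrightarrow> X \<noteq> carrier M \<Longrightarrow> W \<subseteq> X \<Longrightarrow> X = W" by auto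
  then have "maximal_submodule A M W" unfolding maximal_submodule_def by blast
  then show ?thesis by blast
qed

context artin_alg
begin

text \<open>Choose a maximal submodule \<open>W\<close> not containing \<open>U\<close> and \<open>U0 \<subseteq> U\<close> minimal with
  \<open>U0 + W = Q\<close>. Among the endomorphisms with image in \<open>U0\<close> that are the identity modulo \<open>W\<close>,
  one with minimal kernel, say \<open>h\<close>, factors as \<open>h \<circ> \<eta>\<close> with \<open>\<eta>\<close> of the same kind, and \<open>\<eta>\<close> is
  idempotent because it has the same kernel as \<open>h\<close>.\<close>

lemma submodule_not_in_radical:
  assumes db: "dual_basis A Q n x f"
    and indec: "\<And>\<eta>. \<eta> \<in> mod_Hom A Q Q \<Longrightarrow> (\<forall>q\<in>carrier Q. \<eta> (\<eta> q) = \<eta> q) \<Longrightarrow>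
      (\<forall>q\<in>carrier Q. \<eta> q = \<zero>\<^bsub>Q\<^esub>) \<or> (\<forall>q\<in>carrier Q. \<eta> q = q)"
    and U: "submodule U A Q" "\<not> U \<subseteq> radical A Q"
  shows "U = carrier Q"
proof -
  interpret dual_basis A Q n x f by fact
  have Usub: "U \<subseteq> carrier Q" using U(1) by (simp add: submodule_iff)
  obtain W where W: "maximal_submodule A Q W" "\<not> U \<subseteq> W"
    using U(2) Usub unfolding radical_def by blast
  then have Wsub: "submodule W A Q" and Wne: "W \<noteq> carrier Q"
    and Wmax: "\<And>V. submodule V A Q \<Longrightarrow> W \<subseteq> V \<Longrightarrow> V = W \<or> V = carrier Q"
    unfolding maximal_submodule_def by blast+
  have Wc: "W \<subseteq> carrier Q" "\<zero>\<^bsub>Q\<^esub> \<in> W" "\<And>u v. u \<in> W \<Longrightarrow> v \<in> W \<Longrightarrow> u \<oplus>\<^bsub>Q\<^esub> v \<in> W"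
    using Wsub by (auto simp: submodule_iff)
  define \<U> where "\<U> = {V. submodule V A Q \<and> V \<subseteq> U \<and> (\<forall>q\<in>carrier Q. \<exists>u\<in>V. \<exists>w\<in>W. q = u \<oplus>\<^bsub>Q\<^esub> w)}"
  have sum: "submodule (U <+>\<^bsub>Q\<^esub> W) A Q" by (rule submodule_set_add[OF U(1) Wsub])
  have "w \<in> U <+>\<^bsub>Q\<^esub> W" if "w \<in> W" for w
    unfolding mem_set_add using that U(1) Wc(1)
    by (intro bexI[of _ "\<zero>\<^bsub>Q\<^esub>"] bexI[of _ w]) (auto simp: submodule_iff)
  then have 1: "W \<subseteq> U <+>\<^bsub>Q\<^esub> W" by blast
  have "u \<in> U <+>\<^bsub>Q\<^esub> W" if "u \<in> U" for u
    unfolding mem_set_add using that Usub Wc(2)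
    by (intro bexI[of _ u] bexI[of _ "\<zero>\<^bsub>Q\<^esub>"]) auto
  then have 2: "U <+>\<^bsub>Q\<^esub> W \<noteq> W" using W(2) by blast
  have "U <+>\<^bsub>Q\<^esub> W = carrier Q" using Wmax[OF sum 1] 2 by simp
  then have "U \<in> \<U>" using U(1) by (simp add: \<U>_def flip: mem_set_add)
  moreover have "submodule V A Q" if "V \<in> \<U>" for V using that by (simp add: \<U>_def)
  ultimately obtain U0 where U0: "U0 \<in> \<U>" and U0min: "\<And>V. V \<in> \<U> \<Longrightarrow> V \<subseteq> U0 \<Longrightarrow> V = U0"
    using minimal_submodule[OF fg_module, of \<U>] by (metis emptyE)
  have U0s: "submodule U0 A Q" "U0 \<subseteq> U"
    and U0W: "\<And>q. q \<in> carrier Q \<Longrightarrow> \<exists>u\<in>U0. \<exists>w\<in>W. q = u \<oplus>\<^bsub>Q\<^esub> w"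
    using U0 by (auto simp: \<U>_def)
  have U0c: "U0 \<subseteq> carrier Q" using U0s Usub by blast
  define \<Phi> where "\<Phi> = {h \<in> mod_Hom A Q Q. (\<forall>q\<in>carrier Q. h q \<in> U0) \<and> (\<forall>q\<in>carrier Q. q \<ominus>\<^bsub>Q\<^esub> h q \<in> W)}"
  have id: "(\<lambda>q\<in>carrier Q. q) \<in> mod_Hom A Q Q" by (rule mod_Hom_id[OF rmodule_axioms])
  interpret B1: rmodule A "Q\<lparr>carrier := U0\<rparr>" by (rule rmodule_submodule[OF U0s(1)])
  interpret B2: rmodule A "Q\<lparr>carrier := W\<rparr>" by (rule rmodule_submodule[OF Wsub])
  \<comment> \<open>The external sum of \<open>U0\<close> and \<open>W\<close> maps onto
    \<open>Q\<close>. A lift of the identity splits each element linearly into two parts, and its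
    \<open>U0\<close>-part shows that the set of candidates for \<open>h\<close> is not
    empty.\<close>
  let ?B = "dsum_module (Q\<lparr>carrier := U0\<rparr>) (Q\<lparr>carrier := W\<rparr>)"
  interpret B: rmodule A ?B by (rule rmodule_dsum_module[OF B1.rmodule_axioms B2.rmodule_axioms])
  let ?p = "\<lambda>b\<in>carrier ?B. fst b \<oplus>\<^bsub>Q\<^esub> snd b"
  have p: "?p \<in> mod_Hom A ?B Q"
    by (rule mod_HomI[OF B.rmodule_axioms])
      (use subsetD[OF U0c] subsetD[OF Wc(1)] in \<open>auto simp: M.add.m_ac smult_r_distr\<close>)
  have "(\<lambda>q\<in>carrier Q. q) q \<in> ?p ` carrier ?B" if "q \<in> carrier Q" for q
    using U0W[OF that] that by (force simp: image_iff)
  from lift[OF B.rmodule_axioms rmodule_axioms p id this] obtain k where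
    k: "k \<in> mod_Hom A Q ?B" "\<And>q. q \<in> carrier Q \<Longrightarrow> ?p (k q) = q" by auto
  have kc: "fst (k q) \<in> U0" "snd (k q) \<in> W" "q = fst (k q) \<oplus>\<^bsub>Q\<^esub> snd (k q)" if "q \<in> carrier Q" for q
    using mod_Hom_closed[OF k(1) that] k(2)[OF that] by (auto simp: mem_Times_iff)
  have "(\<lambda>q\<in>carrier Q. fst (k q)) \<in> \<Phi>"
  proof -
    have "(\<lambda>q\<in>carrier Q. fst (k q)) \<in> mod_Hom A Q Q"
    proof (rule mod_HomI[OF rmodule_axioms])
      show "fst (k q) \<in> carrier Q" if "q \<in> carrier Q" for q using kc(1)[OF that] U0c by blast
      show "fst (k (q \<oplus>\<^bsub>Q\<^esub> r)) = fst (k q) \<oplus>\<^bsub>Q\<^esub> fst (k r)" if "q \<in> carrier Q" "r \<in> carrier Q" for q r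
        unfolding mod_Hom_add[OF k(1) that] by (cases "k q"; cases "k r") simp
      show "fst (k (a \<odot>\<^bsub>Q\<^esub> q)) = a \<odot>\<^bsub>Q\<^esub> fst (k q)" if "a \<in> carrier A" "q \<in> carrier Q" for a q
        unfolding mod_Hom_smult[OF k(1) that] by (cases "k q") simp
    qed
    moreover have "q \<ominus>\<^bsub>Q\<^esub> fst (k q) \<in> W" if q: "q \<in> carrier Q" for q
    proof -
      have c: "fst (k q) \<in> carrier Q" "snd (k q) \<in> carrier Q" using kc[OF q] U0c Wc(1) by auto
      have "q \<ominus>\<^bsub>Q\<^esub> fst (k q) = snd (k q)"
        by (subst (1) kc(3)[OF q]) (rule add_diff_cancel[OF c])
      then show ?thesis using kc(2)[OF q] by simp
    qed
    ultimately show ?thesis using kc(1) by (simp add: \<Phi>_def)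
  qed
  then have ne: "a_kernel Q Q ` \<Phi> \<noteq> {}" by blast
  have "submodule V A Q" if V: "V \<in> a_kernel Q Q ` \<Phi>" for V
  proof -
    obtain h where h: "h \<in> \<Phi>" "V = a_kernel Q Q h" using V by blast
    interpret h: rmodule_hom A Q Q h
      by (intro rmodule_homI rmodule_axioms) (use h in \<open>simp add: \<Phi>_def\<close>)
    show ?thesis using h.submodule_kernel h(2) by simp
  qed
  from minimal_submodule[OF fg_module this ne] obtain h where h: "h \<in> \<Phi>"
    and hmin: "\<And>h'. h' \<in> \<Phi> \<Longrightarrow> a_kernel Q Q h' \<subseteq> a_kernel Q Q h \<Longrightarrow> a_kernel Q Q h' = a_kernel Q Q h"
    by auto
  have hH: "h \<in> mod_Hom A Q Q" and hU: "\<And>q. q \<in> carrier Q \<Longrightarrow> h q \<in> U0"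
    and hW: "\<And>q. q \<in> carrier Q \<Longrightarrow> q \<ominus>\<^bsub>Q\<^esub> h q \<in> W"
    using h by (auto simp: \<Phi>_def)
  interpret h: rmodule_hom A Q Q h by (intro rmodule_homI rmodule_axioms hH)
  \<comment> \<open>Since \<open>h\<close> is the identity modulo \<open>W\<close>, the image of
    \<open>U0\<close> still supplements \<open>W\<close>, and minimality of \<open>U0\<close>
    applies to it.\<close>
  have hU0: "h ` U0 = U0"
  proof (rule U0min)
    show "h ` U0 \<subseteq> U0" using hU U0c by auto
    then have "h ` U0 \<subseteq> U" using U0s(2) by blast
    moreover have "\<exists>u\<in>h ` U0. \<exists>w\<in>W. q = u \<oplus>\<^bsub>Q\<^esub> w" if "q \<in> carrier Q" for q
    proof -
      obtain u w where uw: "u \<in> U0" "w \<in> W" "q = u \<oplus>\<^bsub>Q\<^esub> w" using U0W \<open>q \<in> carrier Q\<close> by blast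
      have c: "u \<in> carrier Q" "w \<in> carrier Q" using uw U0c Wc(1) by auto
      have "h u \<oplus>\<^bsub>Q\<^esub> ((u \<ominus>\<^bsub>Q\<^esub> h u) \<oplus>\<^bsub>Q\<^esub> w) = u \<oplus>\<^bsub>Q\<^esub> w"
        using c add_diff[of "h u" u] by (simp flip: M.a_assoc)
      moreover have "(u \<ominus>\<^bsub>Q\<^esub> h u) \<oplus>\<^bsub>Q\<^esub> w \<in> W" using hW[OF c(1)] uw(2) by (rule Wc(3))
      ultimately show ?thesis using uw by (metis imageI)
    qed
    ultimately show "h ` U0 \<in> \<U>"
      unfolding \<U>_def using h.submodule_image[OF U0s(1)] by simp
  qed
  have "restrict h U0 \<in> mod_Hom A (Q\<lparr>carrier := U0\<rparr>) Q"
    by (rule mod_Hom_restrict[OF hH U0s(1) rmodule_axioms])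
  moreover have "h q \<in> restrict h U0 ` carrier (Q\<lparr>carrier := U0\<rparr>)" if "q \<in> carrier Q" for q
    using hU[OF that] hU0 by auto
  ultimately obtain \<eta> where \<eta>: "\<eta> \<in> mod_Hom A Q (Q\<lparr>carrier := U0\<rparr>)"
      "\<And>q. q \<in> carrier Q \<Longrightarrow> restrict h U0 (\<eta> q) = h q"
    using lift[OF B1.rmodule_axioms rmodule_axioms _ hH] by blast
  have \<eta>U: "\<eta> q \<in> U0" if "q \<in> carrier Q" for q using mod_Hom_closed[OF \<eta>(1) that] by simp
  have h\<eta>: "h (\<eta> q) = h q" if "q \<in> carrier Q" for q using \<eta>(2)[OF that] \<eta>U[OF that] by simp
  have \<eta>H: "\<eta> \<in> mod_Hom A Q Q" by (rule mod_Hom_mono[OF \<eta>(1) U0c])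
  interpret \<eta>: rmodule_hom A Q Q \<eta> by (intro rmodule_homI rmodule_axioms \<eta>H)
  have hd: "h (q \<ominus>\<^bsub>Q\<^esub> \<eta> q) = \<zero>\<^bsub>Q\<^esub>" if q: "q \<in> carrier Q" for q
    using q by (simp add: h.diff h\<eta> diff_eq_zero_iff)
  have \<eta>W: "q \<ominus>\<^bsub>Q\<^esub> \<eta> q \<in> W" if q: "q \<in> carrier Q" for q
    using hW[of "q \<ominus>\<^bsub>Q\<^esub> \<eta> q"] hd[OF q] q by (simp add: diff_zero)
  have \<eta>\<Phi>: "\<eta> \<in> \<Phi>" using \<eta>H \<eta>U \<eta>W by (simp add: \<Phi>_def)
  have "a_kernel Q Q \<eta> \<subseteq> a_kernel Q Q h"
  proof
    fix q assume "q \<in> a_kernel Q Q \<eta>"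
    then have q: "q \<in> carrier Q" "\<eta> q = \<zero>\<^bsub>Q\<^esub>" by (auto simp: mem_a_kernel)
    then show "q \<in> a_kernel Q Q h" using h\<eta>[OF q(1)] by (simp add: mem_a_kernel)
  qed
  then have ker: "a_kernel Q Q \<eta> = a_kernel Q Q h" by (rule hmin[OF \<eta>\<Phi>])
  have "\<eta> (\<eta> q) = \<eta> q" if q: "q \<in> carrier Q" for q
  proof -
    have "q \<ominus>\<^bsub>Q\<^esub> \<eta> q \<in> a_kernel Q Q \<eta>"
      unfolding ker mem_a_kernel using hd[OF q] q by simp
    then have "\<eta> q \<ominus>\<^bsub>Q\<^esub> \<eta> (\<eta> q) = \<zero>\<^bsub>Q\<^esub>" using q by (simp add: mem_a_kernel \<eta>.diff)
    then show ?thesis using q diff_eq_zero_iff[of "\<eta> q" "\<eta> (\<eta> q)"] by simp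
  qed
  \<comment> \<open>If \<eta> vanished, all of \<open>Q\<close> would lie in the proper submodule
    \<open>W\<close>. So \<eta> is the identity, and its values lie in \<open>U\<close>.\<close>
  then consider "\<forall>q\<in>carrier Q. \<eta> q = \<zero>\<^bsub>Q\<^esub>" | "\<forall>q\<in>carrier Q. \<eta> q = q"
    using indec[OF \<eta>H] by blast
  then show ?thesis
  proof cases
    case 1
    have "q \<in> W" if q: "q \<in> carrier Q" for q
      using \<eta>W[OF q] 1 q by (simp add: diff_zero)
    then show ?thesis using Wc(1) Wne by blast
  next
    case 2
    have "q \<in> U" if q: "q \<in> carrier Q" for q
      using \<eta>U[OF q] 2 q U0s(2) by auto
    then show ?thesis using Usub by blast
  qed
qed

text \<open>Projectivity gives a section of \<open>u\<close>. The section is an injective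
  endomorphism, hence onto, and \<open>u\<close> is its inverse.\<close>

lemma surjective_endo_bij:
  assumes fg: "fg_module A M" and proj: "projective A M"
    and u: "u \<in> mod_Hom A M M" and surj: "u ` carrier M = carrier M"
  shows "bij_betw u (carrier M) (carrier M)"
proof -
  obtain n x f where "dual_basis A M n x f" using exists_dual_basis[OF fg proj] by blast
  then interpret dual_basis A M n x f .
  have "(\<lambda>y\<in>carrier M. y) y \<in> u ` carrier M" if "y \<in> carrier M" for y using that surj by simp
  from lift[OF rmodule_axioms rmodule_axioms u mod_Hom_id[OF rmodule_axioms] this]
  obtain s where s: "s \<in> mod_Hom A M M" "\<And>y. y \<in> carrier M \<Longrightarrow> u (s y) = y" by auto
  have "inj_on s (carrier M)" by (rule inj_on_inverseI[of _ u]) (use s(2) in simp)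
  then have ss: "s ` carrier M = carrier M" by (rule injective_endo_surj[OF fg s(1)])
  have "inj_on u (carrier M)"
  proof (rule inj_on_inverseI)
    fix y assume "y \<in> carrier M"
    then obtain z where z: "z \<in> carrier M" "y = s z" using ss by auto
    then show "s (u y) = y" using s(2) by simp
  qed
  then show ?thesis using surj by (simp add: bij_betw_def)
qed

lemma projective_cover_endo_bij:
  assumes cov: "projective_cover A P M p" and M: "rmodule A M"
    and u: "u \<in> mod_Hom A P P" and surj: "\<And>y. y \<in> carrier P \<Longrightarrow> \<exists>z\<in>carrier P. p (u z) = p y"
  shows "bij_betw u (carrier P) (carrier P)"
proof -
  have fg: "fg_module A P" and proj: "projective A P" and p: "p \<in> mod_Hom A P M"
    and sf: "superfluous A P (a_kernel P M p)"
    using cov by (auto simp: projective_cover_def)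
  interpret P: rmodule A P using fg by (simp add: fg_module_def)
  interpret p: rmodule_hom A P M p by (intro rmodule_homI P.rmodule_axioms M p)
  interpret u: rmodule_hom A P P u by (intro rmodule_homI P.rmodule_axioms u)
  have sub: "submodule (u ` carrier P) A P"
    by (rule u.submodule_image[OF P.submodule_carrier])
  have "carrier P \<subseteq> u ` carrier P <+>\<^bsub>P\<^esub> a_kernel P M p"
  proof
    fix y assume y: "y \<in> carrier P"
    then obtain z where z: "z \<in> carrier P" "p (u z) = p y" using surj by blast
    have "y \<ominus>\<^bsub>P\<^esub> u z \<in> a_kernel P M p"
      using y z by (simp add: mem_a_kernel p.diff p.N.diff_eq_zero_iff)
    moreover have "y = u z \<oplus>\<^bsub>P\<^esub> (y \<ominus>\<^bsub>P\<^esub> u z)"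
      using P.add_diff[OF u.closed[OF z(1)] y] by simp
    ultimately show "y \<in> u ` carrier P <+>\<^bsub>P\<^esub> a_kernel P M p"
      unfolding mem_set_add using z(1) by blast
  qed
  moreover have "submodule (u ` carrier P <+>\<^bsub>P\<^esub> a_kernel P M p) A P"
    by (rule P.submodule_set_add[OF sub p.submodule_kernel])
  ultimately have "u ` carrier P <+>\<^bsub>P\<^esub> a_kernel P M p = carrier P"
    by (auto simp: P.submodule_iff)
  then have "u ` carrier P = carrier P" using sf sub by (simp add: superfluous_def)
  then show ?thesis by (rule surjective_endo_bij[OF fg proj u])
qed

end

text \<open>Indecomposability of \<open>P\<close> speaks of complementary submodules, while the
  locality argument for P* needs idempotents. An idempotent of P* transposes to one of
  \<open>P\<close>, whose image and kernel are complementary.\<close>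

lemma (in dual_basis) dual_idempotent_trivial:
  assumes indec: "indecomposable A P"
    and \<eta>: "\<eta> \<in> mod_Hom (op_ring A) (dual_module A P) (dual_module A P)"
    and idem: "\<forall>q\<in>carrier (dual_module A P). \<eta> (\<eta> q) = \<eta> q"
  shows "(\<forall>q\<in>carrier (dual_module A P). \<eta> q = \<zero>\<^bsub>dual_module A P\<^esub>) \<or>
    (\<forall>q\<in>carrier (dual_module A P). \<eta> q = q)"
proof -
  interpret Q: rmodule "op_ring A" "dual_module A P" by (rule rmodule_dual_module[OF rmodule_axioms])
  obtain u where u: "u \<in> mod_Hom A (dual_module (op_ring A) (dual_module A P)) P"
    "\<And>\<xi> \<psi>. \<xi> \<in> carrier (dual_module (op_ring A) (dual_module A P)) \<Longrightarrow>
      \<psi> \<in> carrier (dual_module A P) \<Longrightarrow> \<psi> (u \<xi>) = \<xi> (\<eta> \<psi>)"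
    using transpose[OF Q.rmodule_axioms \<eta>] by auto
  have \<eta>c: "\<eta> \<psi> \<in> carrier (dual_module A P)" if "\<psi> \<in> carrier (dual_module A P)" for \<psi>
    using \<eta> that by (rule mod_Hom_closed)
  define ev where "ev p = (\<lambda>\<psi>\<in>carrier (dual_module A P). \<psi> p)" for p
  have ev: "ev p \<in> carrier (dual_module (op_ring A) (dual_module A P))" if "p \<in> carrier P" for p
    using eval_hom[OF rmodule_axioms that] by (simp add: ev_def)
  \<comment> \<open>The transpose of \<eta>, with \<open>P\<close> identified with its bidual by
    evaluation; applying \<psi> after it is the same as applying
    \<open>\<eta> \<psi>\<close>.\<close>
  define \<epsilon> where "\<epsilon> = (\<lambda>p\<in>carrier P. u (ev p))"
  have \<epsilon>c: "\<epsilon> p \<in> carrier P" if "p \<in> carrier P" for p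
    using mod_Hom_closed[OF u(1) ev[OF that]] that by (simp add: \<epsilon>_def)
  have \<psi>\<epsilon>: "\<psi> (\<epsilon> p) = \<eta> \<psi> p" if "p \<in> carrier P" "\<psi> \<in> carrier (dual_module A P)" for p \<psi>
    using u(2)[OF ev[OF that(1)] that(2)] \<eta>c[OF that(2)] that(1) by (simp add: \<epsilon>_def ev_def)
  note reg = mod_Hom_regular[of _ A P]
  have "(\<lambda>p\<in>carrier P. \<epsilon> p) \<in> mod_Hom A P P"
  proof (rule mod_HomI[OF rmodule_axioms \<epsilon>c])
    fix p q assume pq: "p \<in> carrier P" "q \<in> carrier P"
    show "\<epsilon> (p \<oplus>\<^bsub>P\<^esub> q) = \<epsilon> p \<oplus>\<^bsub>P\<^esub> \<epsilon> q"
    proof (rule separate)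
      fix \<psi> assume "\<psi> \<in> mod_Hom A P (regular_module A)"
      then show "\<psi> (\<epsilon> (p \<oplus>\<^bsub>P\<^esub> q)) = \<psi> (\<epsilon> p \<oplus>\<^bsub>P\<^esub> \<epsilon> q)"
        using pq \<eta>c[of \<psi>] by (simp add: reg \<epsilon>c \<psi>\<epsilon>)
    qed (use pq \<epsilon>c in auto)
  next
    fix a p assume ap: "a \<in> carrier A" "p \<in> carrier P"
    show "\<epsilon> (a \<odot>\<^bsub>P\<^esub> p) = a \<odot>\<^bsub>P\<^esub> \<epsilon> p"
    proof (rule separate)
      fix \<psi> assume "\<psi> \<in> mod_Hom A P (regular_module A)"
      then show "\<psi> (\<epsilon> (a \<odot>\<^bsub>P\<^esub> p)) = \<psi> (a \<odot>\<^bsub>P\<^esub> \<epsilon> p)"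
        using ap \<eta>c[of \<psi>] by (simp add: reg \<epsilon>c \<psi>\<epsilon>)
    qed (use ap \<epsilon>c in auto)
  qed
  then have \<epsilon>H: "\<epsilon> \<in> mod_Hom A P P" by (simp add: \<epsilon>_def cong: restrict_cong)
  interpret \<epsilon>: rmodule_hom A P P \<epsilon> by (intro rmodule_homI rmodule_axioms \<epsilon>H)
  have \<epsilon>\<epsilon>: "\<epsilon> (\<epsilon> p) = \<epsilon> p" if p: "p \<in> carrier P" for p
  proof (rule separate)
    fix \<psi> assume "\<psi> \<in> mod_Hom A P (regular_module A)"
    then show "\<psi> (\<epsilon> (\<epsilon> p)) = \<psi> (\<epsilon> p)"
      using p \<eta>c[of \<psi>] idem by (simp add: \<psi>\<epsilon> \<epsilon>c)
  qed (use p \<epsilon>c in auto)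
  have dker: "p \<ominus>\<^bsub>P\<^esub> \<epsilon> p \<in> a_kernel P P \<epsilon>" if p: "p \<in> carrier P" for p
    using p by (simp add: mem_a_kernel \<epsilon>.diff \<epsilon>\<epsilon> diff_eq_zero_iff)
  let ?U = "\<epsilon> ` carrier P" and ?V = "a_kernel P P \<epsilon>"
  have U: "submodule ?U A P" by (rule \<epsilon>.submodule_image[OF submodule_carrier])
  have V: "submodule ?V A P" by (rule \<epsilon>.submodule_kernel)
  have "p \<in> ?U <+>\<^bsub>P\<^esub> ?V" if p: "p \<in> carrier P" for p
  proof -
    have "p = \<epsilon> p \<oplus>\<^bsub>P\<^esub> (p \<ominus>\<^bsub>P\<^esub> \<epsilon> p)"
      using add_diff[OF \<epsilon>c[OF p] p] by simp
    then show ?thesis unfolding mem_set_add using dker[OF p] p by blast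
  qed
  then have "?U <+>\<^bsub>P\<^esub> ?V = carrier P"
    using submodule_set_add[OF U V] by (auto simp: submodule_iff)
  moreover have "?U \<inter> ?V = {\<zero>\<^bsub>P\<^esub>}"
    using U V \<epsilon>\<epsilon> by (auto simp: submodule_iff mem_a_kernel)
  ultimately consider "?U = {\<zero>\<^bsub>P\<^esub>}" | "?V = {\<zero>\<^bsub>P\<^esub>}"
    using indec U V unfolding indecomposable_def by blast
  then show ?thesis
  proof cases
    case 1
    have "\<eta> \<psi> = \<zero>\<^bsub>dual_module A P\<^esub>" if \<psi>: "\<psi> \<in> carrier (dual_module A P)" for \<psi>
    proof (rule mod_Hom_eqI)
      show "\<eta> \<psi> \<in> mod_Hom A P (regular_module A)" using \<eta>c[OF \<psi>] by simp
      show "\<zero>\<^bsub>dual_module A P\<^esub> \<in> mod_Hom A P (regular_module A)"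
        using Q.M.zero_closed by simp
      interpret \<psi>: rmodule_hom A P "regular_module A" \<psi>
        by (intro rmodule_homI rmodule_axioms rmodule_regular_module R.ring_axioms)
          (use \<psi> in simp)
      fix p assume p: "p \<in> carrier P"
      then have "\<epsilon> p = \<zero>\<^bsub>P\<^esub>" using 1 by auto
      then show "\<eta> \<psi> p = \<zero>\<^bsub>dual_module A P\<^esub> p" using \<psi>\<epsilon>[OF p \<psi>] \<psi>.zero p by simp
    qed
    then show ?thesis by blast
  next
    case 2
    have "\<eta> \<psi> = \<psi>" if \<psi>: "\<psi> \<in> carrier (dual_module A P)" for \<psi>
    proof (rule mod_Hom_eqI)
      show "\<eta> \<psi> \<in> mod_Hom A P (regular_module A)" using \<eta>c[OF \<psi>] by simp
      show "\<psi> \<in> mod_Hom A P (regular_module A)" using \<psi> by simp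
      fix p assume p: "p \<in> carrier P"
      then have "p \<ominus>\<^bsub>P\<^esub> \<epsilon> p = \<zero>\<^bsub>P\<^esub>" using 2 dker by blast
      then have "\<epsilon> p = p" using p by (simp add: diff_eq_zero_iff)
      then show "\<eta> \<psi> p = \<psi> p" using \<psi>\<epsilon>[OF p \<psi>] by simp
    qed
    then show ?thesis by blast
  qed
qed

section \<open>Extending homomorphisms into the Nakayama module\<close>

text \<open>By the condition on kernels \<open>b\<close> descends to the image of \<open>B\<close>
  in \<open>L\<close>. To meet the type restriction in \<open>injective\<close>, \<open>L\<close> is
  replaced by a copy \<open>C\<close>, and the monomorphism tested is the inclusion into
  \<open>C\<close> of the image \<open>N\<close> of \<open>B\<close>.\<close>

lemma injective_extend:
  fixes R :: "'r ring"
  assumes E: "injective R E" and L: "fg_module R L" and B: "rmodule R B"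
    and i: "i \<in> mod_Hom R B L" and b: "b \<in> mod_Hom R B E"
    and ker: "\<And>y. y \<in> carrier B \<Longrightarrow> i y = \<zero>\<^bsub>L\<^esub> \<Longrightarrow> b y = \<zero>\<^bsub>E\<^esub>"
  shows "\<exists>c\<in>mod_Hom R L E. \<forall>y\<in>carrier B. c (i y) = b y"
proof -
  obtain C :: "('r, 'r fgu) module" and j where "fg_module R C" and j: "j \<in> mod_iso R L C"
    using fg_module_has_copy[OF L] by blast
  then have jH: "j \<in> mod_Hom R L C" and jinj: "inj_on j (carrier L)" and C: "rmodule R C"
    by (auto simp: mod_iso_def bij_betw_def fg_module_def)
  have rL: "rmodule R L" using L by (simp add: fg_module_def)
  have rE: "rmodule R E" using E by (simp add: injective_def)
  interpret B: rmodule R B by fact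
  interpret C: rmodule R C by fact
  interpret i: rmodule_hom R B L i using B rL i by (rule rmodule_homI)
  interpret b: rmodule_hom R B E b using B rE b by (rule rmodule_homI)
  interpret j: rmodule_hom R L C j using rL C jH by (rule rmodule_homI)
  define k where "k = compose (carrier B) j i"
  have kH: "k \<in> mod_Hom R B C" unfolding k_def using i jH B by (rule mod_Hom_compose)
  interpret k: rmodule_hom R B C k using B C kH by (rule rmodule_homI)
  have k_eq: "k y = j (i y)" if "y \<in> carrier B" for y using that by (simp add: k_def compose_eq)
  have wd: "b y = b z" if yz: "y \<in> carrier B" "z \<in> carrier B" "k y = k z" for y z
  proof -
    have "i y = i z"
      using yz jinj by (simp add: k_eq inj_on_def)
    then have "i (y \<ominus>\<^bsub>B\<^esub> z) = \<zero>\<^bsub>L\<^esub>"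
      using yz by (simp add: i.diff i.N.diff_eq_zero_iff)
    then have "b (y \<ominus>\<^bsub>B\<^esub> z) = \<zero>\<^bsub>E\<^esub>" using yz by (intro ker) simp_all
    then show ?thesis using yz by (simp add: b.diff b.N.diff_eq_zero_iff)
  qed
  define N where "N = k ` carrier B"
  have N: "submodule N R C" unfolding N_def by (rule k.submodule_image[OF B.submodule_carrier])
  interpret N: rmodule R "C\<lparr>carrier := N\<rparr>" by (rule C.rmodule_submodule[OF N])
  have Nc: "y \<in> carrier C" if "y \<in> N" for y using N that by (auto simp: C.submodule_iff)
  define q where "q = inv_into (carrier B) k"
  have q: "q y \<in> carrier B" "k (q y) = y" if "y \<in> N" for y
    unfolding q_def using that[unfolded N_def] by (rule inv_into_into f_inv_into_f)+
  have bq: "b (q (k y)) = b y" if "y \<in> carrier B" for y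
    using that q[of "k y"] by (intro wd) (auto simp: N_def)
  have "(\<lambda>y\<in>carrier (C\<lparr>carrier := N\<rparr>). b (q y)) \<in> mod_Hom R (C\<lparr>carrier := N\<rparr>) E"
  proof (rule mod_HomI[OF N.rmodule_axioms])
    fix y z assume "y \<in> carrier (C\<lparr>carrier := N\<rparr>)" "z \<in> carrier (C\<lparr>carrier := N\<rparr>)"
    then have yz: "y \<in> N" "z \<in> N" by auto
    then show "b (q (y \<oplus>\<^bsub>C\<lparr>carrier := N\<rparr>\<^esub> z)) = b (q y) \<oplus>\<^bsub>E\<^esub> b (q z)"
      using bq[of "q y \<oplus>\<^bsub>B\<^esub> q z"] by (simp add: q k.add b.add)
  next
    fix a y assume "a \<in> carrier R" "y \<in> carrier (C\<lparr>carrier := N\<rparr>)"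
    then show "b (q (a \<odot>\<^bsub>C\<lparr>carrier := N\<rparr>\<^esub> y)) = a \<odot>\<^bsub>E\<^esub> b (q y)"
      using bq[of "a \<odot>\<^bsub>B\<^esub> q y"] by (simp add: q k.smult b.smult)
  qed (use q in auto)
  moreover have "(\<lambda>y\<in>carrier (C\<lparr>carrier := N\<rparr>). y) \<in> mod_Hom R (C\<lparr>carrier := N\<rparr>) C"
    by (rule mod_HomI[OF N.rmodule_axioms]) (use Nc in auto)
  moreover have "inj_on (\<lambda>y\<in>carrier (C\<lparr>carrier := N\<rparr>). y) (carrier (C\<lparr>carrier := N\<rparr>))"
    by (auto simp: inj_on_def)
  ultimately obtain c where c: "c \<in> mod_Hom R C E"
    "compose (carrier (C\<lparr>carrier := N\<rparr>)) c (\<lambda>y\<in>carrier (C\<lparr>carrier := N\<rparr>). y)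
      = (\<lambda>y\<in>carrier (C\<lparr>carrier := N\<rparr>). b (q y))"
    using E C N.rmodule_axioms unfolding injective_def by meson
  have cN: "c y = b (q y)" if "y \<in> N" for y
    using fun_cong[OF c(2), of y] that by (simp add: compose_eq)
  have "compose (carrier L) c j \<in> mod_Hom R L E" using jH c(1) rL by (rule mod_Hom_compose)
  moreover have "compose (carrier L) c j (i y) = b y" if y: "y \<in> carrier B" for y
  proof -
    have "k y \<in> N" using y by (simp add: N_def)
    then show ?thesis using y cN[of "k y"] bq[OF y] k_eq[OF y] by (simp add: compose_eq)
  qed
  ultimately show ?thesis by blast
qed

lemma fg_module_image:
  assumes fg: "fg_module A M" and N: "rmodule A N" and f: "f \<in> mod_Hom A M N"
    and surj: "f ` carrier M = carrier N"
  shows "fg_module A N"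
proof -
  have M: "rmodule A M" using fg by (simp add: fg_module_def)
  interpret f: rmodule_hom A M N f using M N f by (rule rmodule_homI)
  obtain S where S: "S \<subseteq> carrier M" "finite S"
      "\<And>U. submodule U A M \<Longrightarrow> S \<subseteq> U \<Longrightarrow> U = carrier M"
    using fg by (auto simp: fg_module_def)
  have "V = carrier N" if V: "submodule V A N" "f ` S \<subseteq> V" for V
  proof -
    have "{x \<in> carrier M. f x \<in> V} = carrier M"
      by (rule S(3)[OF f.submodule_preimage[OF V(1)]]) (use S(1) V(2) in auto)
    then have "f ` carrier M \<subseteq> V" by blast
    then show ?thesis using V(1) surj by (auto simp: f.N.submodule_iff)
  qed
  then show ?thesis
    unfolding fg_module_def using S by (intro conjI N exI[of _ "f ` S"]) auto
qed

lemma dual_map_hom: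
  assumes M: "rmodule A M" and N: "rmodule A N" and h: "h \<in> mod_Hom A M N"
  shows "dual_map A M N h \<in> mod_Hom (op_ring A) (dual_module A N) (dual_module A M)"
  unfolding dual_map_def
proof (rule mod_HomI[OF rmodule_dual_module[OF N]])
  fix \<psi> assume "\<psi> \<in> carrier (dual_module A N)"
  then show "compose (carrier M) \<psi> h \<in> carrier (dual_module A M)"
    using h M by (auto intro: mod_Hom_compose)
qed (auto simp: compose_def mod_Hom_closed[OF h] intro!: restrict_ext)

context artin_alg
begin

text \<open>Since \<open>M\<close> is projective, an \<open>A\<close>-linear map into \<open>D M\<close> is determined by its \<open>R\<close>-linear
  components \<open>y \<mapsto> b y (x i)\<close>, which can be extended separately.\<close>

lemma D_module_extend:
  assumes E: "injective R E" and db: "dual_basis A M n x f"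
    and L: "fg_module (op_ring A) L" and B: "rmodule (op_ring A) B"
    and i: "i \<in> mod_Hom (op_ring A) B L" and b: "b \<in> mod_Hom (op_ring A) B (D_module R \<phi> E M)"
    and ker: "\<And>y. y \<in> carrier B \<Longrightarrow> i y = \<zero>\<^bsub>L\<^esub> \<Longrightarrow> b y = \<zero>\<^bsub>D_module R \<phi> E M\<^esub>"
  shows "\<exists>c\<in>mod_Hom (op_ring A) L (D_module R \<phi> E M). \<forall>y\<in>carrier B. c (i y) = b y"
proof -
  interpret M: dual_basis A M n x f by fact
  interpret Op: artin_alg R \<phi> "op_ring A" by (rule artin_alg_op)
  have rL: "rmodule (op_ring A) L" using L by (simp add: fg_module_def)
  have rE: "rmodule R E" using E by (simp add: injective_def)
  interpret L: rmodule "op_ring A" L by fact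
  interpret B: rmodule "op_ring A" B by fact
  interpret E: rmodule R E by fact
  interpret RM: rmodule R "restrict_scalars \<phi> M" by (rule rmodule_restrict_scalars[OF M.rmodule_axioms])
  interpret RB: rmodule R "restrict_scalars \<phi> B" by (rule Op.rmodule_restrict_scalars[OF B])
  interpret D: rmodule "op_ring A" "D_module R \<phi> E M"
    by (rule rmodule_D_module[OF M.rmodule_axioms rE])
  interpret i: rmodule_hom "op_ring A" B L i using B rL i by (rule rmodule_homI)
  interpret b: rmodule_hom "op_ring A" B "D_module R \<phi> E M" b
    using B D.rmodule_axioms b by (rule rmodule_homI)
  have bH: "b y \<in> mod_Hom R (restrict_scalars \<phi> M) E" if "y \<in> carrier B" for y
    using b.closed[OF that] by simp
  have bc: "b y m \<in> carrier E" if "y \<in> carrier B" "m \<in> carrier M" for y m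
    using mod_Hom_closed[OF bH[OF that(1)], of m] that(2) by simp
  have "\<exists>c\<in>mod_Hom R (restrict_scalars \<phi> L) E. \<forall>y\<in>carrier B. c (i y) = b y (x k)" if k: "k < n" for k
  proof -
    have "(\<lambda>y\<in>carrier (restrict_scalars \<phi> B). b y (x k)) \<in> mod_Hom R (restrict_scalars \<phi> B) E"
    proof (rule mod_HomI[OF RB.rmodule_axioms])
      fix r y assume r: "r \<in> carrier R" and "y \<in> carrier (restrict_scalars \<phi> B)"
      then have y: "y \<in> carrier B" by simp
      \<comment> \<open>Linearity over the opposite ring moves the scalar from \<open>y\<close> into
        the argument of \<open>b y\<close>, where \<open>R\<close>-linearity takes it out.\<close>
      have "b (\<phi> r \<odot>\<^bsub>B\<^esub> y) (x k) = b y (\<phi> r \<odot>\<^bsub>M\<^esub> x k)"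
        using r y k by (simp add: b.smult)
      also have "\<dots> = r \<odot>\<^bsub>E\<^esub> b y (x k)"
        using mod_Hom_smult[OF bH[OF y] r, of "x k"] k by simp
      finally show "b (r \<odot>\<^bsub>restrict_scalars \<phi> B\<^esub> y) (x k) = r \<odot>\<^bsub>E\<^esub> b y (x k)" by simp
    qed (use k bc in \<open>auto simp: b.add\<close>)
    moreover have "(\<lambda>y\<in>carrier (restrict_scalars \<phi> B). b y (x k)) y = \<zero>\<^bsub>E\<^esub>"
      if "y \<in> carrier (restrict_scalars \<phi> B)" "i y = \<zero>\<^bsub>restrict_scalars \<phi> L\<^esub>" for y
      using that ker[of y] k by simp
    ultimately obtain c where "c \<in> mod_Hom R (restrict_scalars \<phi> L) E"
      "\<forall>y\<in>carrier (restrict_scalars \<phi> B). c (i y) = (\<lambda>y\<in>carrier (restrict_scalars \<phi> B). b y (x k)) y"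
      using injective_extend[OF E Op.fg_restrict_scalars[OF L] RB.rmodule_axioms
          Op.mod_Hom_restrict_scalars[OF i]] by blast
    then show ?thesis by auto
  qed
  then have "\<forall>k. \<exists>c. k < n \<longrightarrow> c \<in> mod_Hom R (restrict_scalars \<phi> L) E \<and>
      (\<forall>y\<in>carrier B. c (i y) = b y (x k))" by blast
  then obtain \<gamma> where "\<forall>k. k < n \<longrightarrow> \<gamma> k \<in> mod_Hom R (restrict_scalars \<phi> L) E \<and>
      (\<forall>y\<in>carrier B. \<gamma> k (i y) = b y (x k))" unfolding choice_iff by blast
  then have \<gamma>: "\<gamma> k \<in> mod_Hom R (restrict_scalars \<phi> L) E"
    "y \<in> carrier B \<Longrightarrow> \<gamma> k (i y) = b y (x k)" if "k < n" for k y using that by blast+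
  have \<gamma>c: "\<gamma> k l \<in> carrier E" if "k < n" "l \<in> carrier L" for k l
    using mod_Hom_closed[OF \<gamma>(1)[OF that(1)], of l] that(2) by simp
  have \<gamma>add: "\<gamma> k (l \<oplus>\<^bsub>L\<^esub> l') = \<gamma> k l \<oplus>\<^bsub>E\<^esub> \<gamma> k l'"
    if "k < n" "l \<in> carrier L" "l' \<in> carrier L" for k l l'
    using mod_Hom_add[OF \<gamma>(1)[OF that(1)], of l l'] that(2,3) by simp
  have \<gamma>smult: "\<gamma> k (\<phi> r \<odot>\<^bsub>L\<^esub> l) = r \<odot>\<^bsub>E\<^esub> \<gamma> k l"
    if "k < n" "r \<in> carrier R" "l \<in> carrier L" for k r l
    using mod_Hom_smult[OF \<gamma>(1)[OF that(1)], of r l] that(2,3) by simp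
  have sm: "f k m \<odot>\<^bsub>L\<^esub> l \<in> carrier L" if "k < n" "m \<in> carrier M" "l \<in> carrier L" for k m l
    using that by (intro L.smult_closed) auto
  have La: "(a \<otimes>\<^bsub>A\<^esub> a') \<odot>\<^bsub>L\<^esub> l = a \<odot>\<^bsub>L\<^esub> (a' \<odot>\<^bsub>L\<^esub> l)"
    if "a \<in> carrier A" "a' \<in> carrier A" "l \<in> carrier L" for a a' l
    using L.smult_assoc[of a' a l] that by simp
  \<comment> \<open>Forced by the dual basis: a linear \<open>c\<close> into \<open>D M\<close> has
    as its value at \<open>l\<close> and \<open>m\<close> the sum over \<open>k\<close> of the
    values of \<open>c (f k m \<odot> l)\<close> at \<open>x k\<close>, and these components are the
    maps \<open>\<gamma> k\<close>.\<close>
  define s where "s l m = (\<Oplus>\<^bsub>E\<^esub>k\<in>{..<n}. \<gamma> k (f k m \<odot>\<^bsub>L\<^esub> l))" for l m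
  have sc: "s l m \<in> carrier E" if "l \<in> carrier L" "m \<in> carrier M" for l m
    unfolding s_def using that sm \<gamma>c by (intro E.M.finsum_closed) auto
  have sH: "(\<lambda>m\<in>carrier M. s l m) \<in> mod_Hom R (restrict_scalars \<phi> M) E" if l: "l \<in> carrier L" for l
  proof -
    have "(\<lambda>m\<in>carrier (restrict_scalars \<phi> M). s l m) \<in> mod_Hom R (restrict_scalars \<phi> M) E"
    proof (rule mod_HomI[OF RM.rmodule_axioms])
      fix m m' assume "m \<in> carrier (restrict_scalars \<phi> M)" "m' \<in> carrier (restrict_scalars \<phi> M)"
      then have m: "m \<in> carrier M" "m' \<in> carrier M" by auto
      have "s l (m \<oplus>\<^bsub>M\<^esub> m') = (\<Oplus>\<^bsub>E\<^esub>k\<in>{..<n}. \<gamma> k (f k m \<odot>\<^bsub>L\<^esub> l) \<oplus>\<^bsub>E\<^esub> \<gamma> k (f k m' \<odot>\<^bsub>L\<^esub> l))"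
        unfolding s_def
      proof (rule E.M.finsum_cong')
        fix k assume k: "k \<in> {..<n}"
        have "f k (m \<oplus>\<^bsub>M\<^esub> m') \<odot>\<^bsub>L\<^esub> l = f k m \<odot>\<^bsub>L\<^esub> l \<oplus>\<^bsub>L\<^esub> f k m' \<odot>\<^bsub>L\<^esub> l"
          using k m l L.smult_l_distr[of "f k m" "f k m'" l] by (simp add: M.f_add)
        then show "\<gamma> k (f k (m \<oplus>\<^bsub>M\<^esub> m') \<odot>\<^bsub>L\<^esub> l)
            = \<gamma> k (f k m \<odot>\<^bsub>L\<^esub> l) \<oplus>\<^bsub>E\<^esub> \<gamma> k (f k m' \<odot>\<^bsub>L\<^esub> l)"
          using k m l sm by (simp add: \<gamma>add)
      qed (use m l sm \<gamma>c in auto)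
      also have "\<dots> = s l m \<oplus>\<^bsub>E\<^esub> s l m'"
        unfolding s_def by (rule E.M.finsum_addf) (use m l sm \<gamma>c in auto)
      finally show "s l (m \<oplus>\<^bsub>restrict_scalars \<phi> M\<^esub> m') = s l m \<oplus>\<^bsub>E\<^esub> s l m'" by simp
    next
      fix r m assume r: "r \<in> carrier R" and "m \<in> carrier (restrict_scalars \<phi> M)"
      then have m: "m \<in> carrier M" by simp
      have "s l (\<phi> r \<odot>\<^bsub>M\<^esub> m) = (\<Oplus>\<^bsub>E\<^esub>k\<in>{..<n}. r \<odot>\<^bsub>E\<^esub> \<gamma> k (f k m \<odot>\<^bsub>L\<^esub> l))"
        unfolding s_def
      proof (rule E.M.finsum_cong')
        fix k assume k: "k \<in> {..<n}"
        have "f k (\<phi> r \<odot>\<^bsub>M\<^esub> m) \<odot>\<^bsub>L\<^esub> l = \<phi> r \<odot>\<^bsub>L\<^esub> (f k m \<odot>\<^bsub>L\<^esub> l)"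
          using k m l r La[of "\<phi> r" "f k m" l] central[OF r, of "f k m"] by (simp add: M.f_smult)
        then show "\<gamma> k (f k (\<phi> r \<odot>\<^bsub>M\<^esub> m) \<odot>\<^bsub>L\<^esub> l) = r \<odot>\<^bsub>E\<^esub> \<gamma> k (f k m \<odot>\<^bsub>L\<^esub> l)"
          using k m l r sm by (simp add: \<gamma>smult)
      qed (use m l r sm \<gamma>c in auto)
      also have "\<dots> = r \<odot>\<^bsub>E\<^esub> s l m"
        unfolding s_def by (rule E.smult_finsum[symmetric]) (use m l r sm \<gamma>c in auto)
      finally show "s l (r \<odot>\<^bsub>restrict_scalars \<phi> M\<^esub> m) = r \<odot>\<^bsub>E\<^esub> s l m" by simp
    qed (use sc l in auto)
    then show ?thesis by simp
  qed
  define c where "c = (\<lambda>l\<in>carrier L. \<lambda>m\<in>carrier M. s l m)"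
  have "c \<in> mod_Hom (op_ring A) L (D_module R \<phi> E M)"
    unfolding c_def
  proof (rule mod_HomI[OF rL])
    fix l l' assume l: "l \<in> carrier L" "l' \<in> carrier L"
    have "s (l \<oplus>\<^bsub>L\<^esub> l') m = s l m \<oplus>\<^bsub>E\<^esub> s l' m" if m: "m \<in> carrier M" for m
    proof -
      have "s (l \<oplus>\<^bsub>L\<^esub> l') m = (\<Oplus>\<^bsub>E\<^esub>k\<in>{..<n}. \<gamma> k (f k m \<odot>\<^bsub>L\<^esub> l) \<oplus>\<^bsub>E\<^esub> \<gamma> k (f k m \<odot>\<^bsub>L\<^esub> l'))"
        unfolding s_def
        by (rule E.M.finsum_cong') (use m l sm \<gamma>c in \<open>auto simp: L.smult_r_distr \<gamma>add\<close>)
      also have "\<dots> = s l m \<oplus>\<^bsub>E\<^esub> s l' m"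
        unfolding s_def by (rule E.M.finsum_addf) (use m l sm \<gamma>c in auto)
      finally show ?thesis .
    qed
    then show "(\<lambda>m\<in>carrier M. s (l \<oplus>\<^bsub>L\<^esub> l') m)
        = (\<lambda>m\<in>carrier M. s l m) \<oplus>\<^bsub>D_module R \<phi> E M\<^esub> (\<lambda>m\<in>carrier M. s l' m)"
      by (simp cong: restrict_cong)
  next
    fix a l assume "a \<in> carrier (op_ring A)" and l: "l \<in> carrier L"
    then have a: "a \<in> carrier A" by simp
    have "s (a \<odot>\<^bsub>L\<^esub> l) m = s l (a \<odot>\<^bsub>M\<^esub> m)" if m: "m \<in> carrier M" for m
      unfolding s_def
      by (rule E.M.finsum_cong') (use m a l sm \<gamma>c La in \<open>auto simp: M.f_smult\<close>)
    then show "(\<lambda>m\<in>carrier M. s (a \<odot>\<^bsub>L\<^esub> l) m) = a \<odot>\<^bsub>D_module R \<phi> E M\<^esub> (\<lambda>m\<in>carrier M. s l m)"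
      using a by (simp cong: restrict_cong)
  qed (use sH in simp)
  moreover have "c (i y) = b y" if y: "y \<in> carrier B" for y
  proof (rule mod_Hom_eqI)
    show "c (i y) \<in> mod_Hom R (restrict_scalars \<phi> M) E" using sH y by (simp add: c_def)
    show "b y \<in> mod_Hom R (restrict_scalars \<phi> M) E" by (rule bH[OF y])
    fix m assume "m \<in> carrier (restrict_scalars \<phi> M)"
    then have m: "m \<in> carrier M" by simp
    interpret bY: rmodule_hom R "restrict_scalars \<phi> M" E "b y"
      by (intro rmodule_homI RM.rmodule_axioms rE bH[OF y])
    \<comment> \<open>Restriction of scalars changes the record but not the addition.\<close>
    have fs: "finsum (restrict_scalars \<phi> M) = finsum M"
      by (simp add: fun_eq_iff finsum_def finprod_def restrict_scalars_def)
    have "c (i y) m = (\<Oplus>\<^bsub>E\<^esub>k\<in>{..<n}. \<gamma> k (f k m \<odot>\<^bsub>L\<^esub> i y))"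
      using m y by (simp add: c_def s_def)
    also have "\<dots> = (\<Oplus>\<^bsub>E\<^esub>k\<in>{..<n}. b y (f k m \<odot>\<^bsub>M\<^esub> x k))"
    proof (rule E.M.finsum_cong')
      fix k assume k: "k \<in> {..<n}"
      then have a: "f k m \<in> carrier (op_ring A)" using m by simp
      have "\<gamma> k (f k m \<odot>\<^bsub>L\<^esub> i y) = \<gamma> k (i (f k m \<odot>\<^bsub>B\<^esub> y))"
        using i.smult[OF a y] by simp
      also have "\<dots> = b (f k m \<odot>\<^bsub>B\<^esub> y) (x k)"
        using k a y by (intro \<gamma>(2)) auto
      also have "\<dots> = b y (f k m \<odot>\<^bsub>M\<^esub> x k)"
        using b.smult[OF a y] k by simp
      finally show "\<gamma> k (f k m \<odot>\<^bsub>L\<^esub> i y) = b y (f k m \<odot>\<^bsub>M\<^esub> x k)" .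
    qed (use m y bc in auto)
    also have "\<dots> = b y (\<Oplus>\<^bsub>M\<^esub>k\<in>{..<n}. f k m \<odot>\<^bsub>M\<^esub> x k)"
      using bY.finsum[of "{..<n}" "\<lambda>k. f k m \<odot>\<^bsub>M\<^esub> x k"] m by (simp add: fs)
    finally show "c (i y) m = b y m" using M.expand[OF m] by simp
  qed
  ultimately show ?thesis by blast
qed

end

section \<open>The sequence attached to a minimal presentation of the Nakayama module\<close>

text \<open>The data of the theorem with a dual basis of \<open>P\<close> fixed. Its functionals
  generate P*, and it is on them that factorizations through \<open>e\<close> are tested.\<close>

locale nakayama_presentation = Alg: artin_alg R \<phi> A + dual_basis A P n x f
  for R :: "'r ring" and \<phi> :: "'r \<Rightarrow> 'a" and A :: "'a ring" and P :: "('a, 'p) module" and n x f +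
  fixes E :: "('r, 'e) module" and P0 :: "('a, 'n) module" and P1 :: "('a, 'k) module"
    and g :: "'k \<Rightarrow> 'n" and \<sigma> :: "'n \<Rightarrow> (('p \<Rightarrow> 'a) \<Rightarrow> 'a) \<Rightarrow> 'e"
    and \<theta> :: "('p \<Rightarrow> 'a) set \<Rightarrow> (('p \<Rightarrow> 'a) \<Rightarrow> 'a) \<Rightarrow> 'e" and e :: "('p \<Rightarrow> 'a) \<Rightarrow> 'n"
  assumes injE: "injective R E" and indec: "indecomposable A P"
    and pres: "minimal_projective_presentation (op_ring A) P1 P0
      (nakayama R \<phi> E (op_ring A) (dual_module A P)) g \<sigma>"
    and theta: "\<theta> \<in> mod_iso (op_ring A) (top_module (op_ring A) (dual_module A P))
      (soc_module (op_ring A) (nakayama R \<phi> E (op_ring A) (dual_module A P)))"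
    and e_hom: "e \<in> mod_Hom (op_ring A) (dual_module A P) P0"
    and \<sigma>e: "compose (carrier (dual_module A P)) \<sigma> e = via_top_soc (op_ring A) (dual_module A P) \<theta>"
begin

abbreviation "Aop \<equiv> op_ring A"
abbreviation "Q \<equiv> dual_module A P"
abbreviation "N \<equiv> nakayama R \<phi> E Aop Q"

sublocale Op: artin_alg R \<phi> Aop by (rule Alg.artin_alg_op)

sublocale Q: dual_basis Aop Q n f "\<lambda>i. \<lambda>\<psi>\<in>carrier Q. \<psi> (x i)" by (rule dual_basis_dual)

text \<open>The Nakayama module of P* is \<open>D\<close> of the bidual of \<open>P\<close>; these
  are the coordinates along which maps into it are extended.\<close>

lemma dual_basis_bidual:
  "dual_basis A (dual_module Aop Q) n (\<lambda>i. \<lambda>\<psi>\<in>carrier Q. \<psi> (x i))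
    (\<lambda>i. \<lambda>\<xi>\<in>carrier (dual_module Aop Q). \<xi> (f i))"
  using Q.dual_basis_dual by simp

lemma N_eq: "N = D_module R \<phi> E (dual_module Aop Q)"
  by (simp add: nakayama_def)

lemma N_rmodule: "rmodule Aop N"
  unfolding N_eq using dual_basis_bidual injE
  by (intro Alg.rmodule_D_module) (simp_all add: dual_basis_def injective_def)

lemma covers: "projective_cover Aop P0 N \<sigma>"
  "projective_cover Aop P1 (P0\<lparr>carrier := a_kernel P0 N \<sigma>\<rparr>) g"
  using pres by (simp_all add: minimal_projective_presentation_def)

lemma P0: "fg_module Aop P0" "projective Aop P0" "rmodule Aop P0"
  and \<sigma>_hom: "\<sigma> \<in> mod_Hom Aop P0 N" and \<sigma>_surj: "\<sigma> ` carrier P0 = carrier N"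
  using covers(1) by (auto simp: projective_cover_def projective_def)

sublocale \<sigma>: rmodule_hom Aop P0 N \<sigma>
  by (rule rmodule_homI[OF P0(3) N_rmodule \<sigma>_hom])

sublocale e: rmodule_hom Aop Q P0 e
  by (rule rmodule_homI[OF Q.rmodule_axioms P0(3) e_hom])

lemma P1: "fg_module Aop P1" "projective Aop P1" "rmodule Aop P1"
  using covers(2) by (auto simp: projective_cover_def projective_def)

lemma g_hom: "g \<in> mod_Hom Aop P1 P0" and g_image: "g ` carrier P1 = a_kernel P0 N \<sigma>"
proof -
  have "g \<in> mod_Hom Aop P1 (P0\<lparr>carrier := a_kernel P0 N \<sigma>\<rparr>)"
    using covers(2) by (simp add: projective_cover_def)
  then show "g \<in> mod_Hom Aop P1 P0"
    by (rule mod_Hom_mono) (auto simp: mem_a_kernel)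
  show "g ` carrier P1 = a_kernel P0 N \<sigma>"
    using covers(2) by (simp add: projective_cover_def)
qed

sublocale g: rmodule_hom Aop P1 P0 g
  by (rule rmodule_homI[OF P1(3) P0(3) g_hom])

lemma \<sigma>g: "z \<in> carrier P1 \<Longrightarrow> \<sigma> (g z) = \<zero>\<^bsub>N\<^esub>"
  using g_image by (auto simp: mem_a_kernel)

lemma kernel_\<sigma>: "y \<in> carrier P0 \<Longrightarrow> \<sigma> y = \<zero>\<^bsub>N\<^esub> \<Longrightarrow> y \<in> g ` carrier P1"
  by (simp add: g_image mem_a_kernel)

section \<open>The radical of \<open>Q\<close>, the map \<alpha> and the socle of the Nakayama
  module\<close>

abbreviation "rad \<equiv> radical Aop Q"

lemma submodule_rad: "submodule rad Aop Q"
proof -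
  \<comment> \<open>With the whole module added, the family intersected is nonempty even if there
    were no maximal submodule.\<close>
  have eq: "radical Aop Q = \<Inter>(insert (carrier Q) {U. maximal_submodule Aop Q U})"
    unfolding radical_def by simp
  have sub: "submodule U Aop Q" if "U \<in> insert (carrier Q) {U. maximal_submodule Aop Q U}" for U
    using that Q.submodule_carrier by (elim insertE) (simp_all add: maximal_submodule_def)
  show ?thesis unfolding eq by (rule Q.submodule_Inter[OF sub]) simp_all
qed

lemma alpha_eq: "q \<in> carrier Q \<Longrightarrow> \<sigma> (e q) = \<theta> (rad +>\<^bsub>Q\<^esub> q)"
  using fun_cong[OF \<sigma>e, of q] by (simp add: via_top_soc_def compose_eq)

text \<open>The isomorphism \<theta> is injective on cosets, so the value at \<open>q\<close>
  vanishes exactly if the coset of \<open>q\<close> is that of zero.\<close>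

lemma alpha_zero_iff:
  assumes q: "q \<in> carrier Q"
  shows "\<sigma> (e q) = \<zero>\<^bsub>N\<^esub> \<longleftrightarrow> q \<in> rad"
proof -
  have rc: "rad \<subseteq> carrier Q" and r0: "\<zero>\<^bsub>Q\<^esub> \<in> rad"
    using submodule_rad unfolding Q.submodule_iff by auto
  have sg: "subgroup rad (add_monoid Q)" using submodule_rad by (rule submodule.axioms)
  have inj: "inj_on \<theta> (a_rcosets\<^bsub>Q\<^esub> rad)"
    using theta by (simp add: mod_iso_def bij_betw_def top_module_def quot_module_def)
  have z: "\<sigma> (e \<zero>\<^bsub>Q\<^esub>) = \<zero>\<^bsub>N\<^esub>" unfolding e.zero \<sigma>.zero ..
  have "\<sigma> (e q) = \<zero>\<^bsub>N\<^esub> \<longleftrightarrow> \<theta> (rad +>\<^bsub>Q\<^esub> q) = \<theta> (rad +>\<^bsub>Q\<^esub> \<zero>\<^bsub>Q\<^esub>)"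
    using alpha_eq[OF q] alpha_eq[OF Q.M.zero_closed] z by metis
  also have "\<dots> \<longleftrightarrow> rad +>\<^bsub>Q\<^esub> q = rad +>\<^bsub>Q\<^esub> \<zero>\<^bsub>Q\<^esub>"
    by (rule inj_on_eq_iff[OF inj Q.M.a_rcosetsI[OF rc q] Q.M.a_rcosetsI[OF rc Q.M.zero_closed]])
  also have "\<dots> \<longleftrightarrow> rad +>\<^bsub>Q\<^esub> q = rad"
    unfolding Q.M.a_coset_add_zero[OF rc] ..
  also have "\<dots> \<longleftrightarrow> q \<in> rad"
    using Q.M.a_coset_join1[OF _ q sg] Q.M.a_coset_join2[OF q sg] by metis
  finally show ?thesis .
qed

lemma alpha_image: "(\<lambda>q. \<sigma> (e q)) ` carrier Q = socle Aop N"
proof -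
  have "\<theta> ` (a_rcosets\<^bsub>Q\<^esub> rad) = socle Aop N"
    using theta by (simp add: mod_iso_def bij_betw_def top_module_def quot_module_def soc_module_def)
  moreover have "a_rcosets\<^bsub>Q\<^esub> rad = (\<lambda>q. rad +>\<^bsub>Q\<^esub> q) ` carrier Q"
    unfolding A_RCOSETS_def' by blast
  ultimately have "socle Aop N = (\<lambda>q. \<theta> (rad +>\<^bsub>Q\<^esub> q)) ` carrier Q"
    by (simp add: image_image)
  also have "\<dots> = (\<lambda>q. \<sigma> (e q)) ` carrier Q"
    by (rule image_cong[OF refl]) (simp only: alpha_eq)
  finally show ?thesis ..
qed

lemma alpha_hom: "compose (carrier Q) \<sigma> e \<in> mod_Hom Aop Q N"
  using e_hom \<sigma>_hom Q.rmodule_axioms by (rule mod_Hom_compose)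

text \<open>This is the locality of \<open>Q\<close>. Its idempotent endomorphisms are trivial
  because they transpose to idempotents of the indecomposable module \<open>P\<close>.\<close>

lemma submodule_not_in_rad:
  assumes "submodule U Aop Q" "\<not> U \<subseteq> rad"
  shows "U = carrier Q"
  using Q.dual_basis_axioms _ assms
proof (rule Op.submodule_not_in_radical)
  fix \<eta> assume "\<eta> \<in> mod_Hom Aop Q Q" "\<forall>q\<in>carrier Q. \<eta> (\<eta> q) = \<eta> q"
  then show "(\<forall>q\<in>carrier Q. \<eta> q = \<zero>\<^bsub>Q\<^esub>) \<or> (\<forall>q\<in>carrier Q. \<eta> q = q)"
    by (rule dual_idempotent_trivial[OF indec])
qed

text \<open>Functionals separate the points of the nonzero module \<open>P\<close>, so
  \<open>Q\<close> is nonzero; being finitely generated it has a maximal submodule, and its radical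
  is proper.\<close>

lemma alpha_nonzero: "\<exists>q\<in>carrier Q. \<sigma> (e q) \<noteq> \<zero>\<^bsub>N\<^esub>"
proof -
  have "carrier Q \<noteq> {\<zero>\<^bsub>Q\<^esub>}"
  proof
    assume Q0: "carrier Q = {\<zero>\<^bsub>Q\<^esub>}"
    have "p = \<zero>\<^bsub>P\<^esub>" if p: "p \<in> carrier P" for p
    proof (rule separate[OF p M.zero_closed])
      fix \<psi> assume "\<psi> \<in> mod_Hom A P (regular_module A)"
      then have "\<psi> \<in> carrier Q" by simp
      then have "\<psi> = \<zero>\<^bsub>Q\<^esub>" unfolding Q0 by simp
      then show "\<psi> p = \<psi> \<zero>\<^bsub>P\<^esub>" using p by simp
    qed
    then have "carrier P = {\<zero>\<^bsub>P\<^esub>}" using M.zero_closed by blast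
    then show False using indec by (simp add: indecomposable_def)
  qed
  then obtain W where W: "maximal_submodule Aop Q W"
    using fg_module_maximal_submodule[OF Q.fg_module] by auto
  then have "rad \<subseteq> W" and Wn: "W \<noteq> carrier Q" and "W \<subseteq> carrier Q"
    by (auto simp: radical_def maximal_submodule_def Q.submodule_iff)
  then obtain q where "q \<in> carrier Q" "q \<notin> rad" by blast
  then show ?thesis using alpha_zero_iff by blast
qed

text \<open>So the socle lies in every nonzero submodule. A minimal nonzero submodule
  \<open>S\<close> of \<open>U\<close> is simple, hence inside the socle, which is the image of
  \<alpha>. The preimage of \<open>S\<close> in \<open>Q\<close> is not contained in the kernel of
  \<alpha>, which is the radical, and so is all of \<open>Q\<close>.\<close>

lemma alpha_in_submodule:
  assumes U: "submodule U Aop N" "U \<noteq> {\<zero>\<^bsub>N\<^esub>}" and q: "q \<in> carrier Q"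
  shows "\<sigma> (e q) \<in> U"
proof -
  have fgN: "fg_module Aop N" by (rule fg_module_image[OF P0(1) N_rmodule \<sigma>_hom \<sigma>_surj])
  define \<U> where "\<U> = {V. submodule V Aop N \<and> V \<subseteq> U \<and> V \<noteq> {\<zero>\<^bsub>N\<^esub>}}"
  have "submodule V Aop N" if "V \<in> \<U>" for V using that by (simp add: \<U>_def)
  moreover have "U \<in> \<U>" using U by (simp add: \<U>_def)
  ultimately obtain S where S: "S \<in> \<U>" "\<And>V. V \<in> \<U> \<Longrightarrow> V \<subseteq> S \<Longrightarrow> V = S"
    using Op.minimal_submodule[OF fgN, of \<U>] by (metis emptyE)
  have Ssub: "submodule S Aop N" and SU: "S \<subseteq> U" and Sne: "S \<noteq> {\<zero>\<^bsub>N\<^esub>}"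
    using S(1) by (auto simp: \<U>_def)
  have "V = {\<zero>\<^bsub>N\<^esub>} \<or> V = S" if "submodule V Aop N" "V \<subseteq> S" for V
    using S(2)[of V] that SU by (auto simp: \<U>_def)
  then have "simple_submodule Aop N S" using Ssub Sne by (simp add: simple_submodule_def)
  then have Ssoc: "S \<subseteq> socle Aop N" unfolding socle_def by blast
  interpret a: rmodule_hom Aop Q N "compose (carrier Q) \<sigma> e"
    by (rule rmodule_homI[OF Q.rmodule_axioms N_rmodule alpha_hom])
  define T where "T = {q \<in> carrier Q. compose (carrier Q) \<sigma> e q \<in> S}"
  have T: "submodule T Aop Q" unfolding T_def by (rule a.submodule_preimage[OF Ssub])
  have Tmem: "q \<in> T \<longleftrightarrow> q \<in> carrier Q \<and> \<sigma> (e q) \<in> S" for q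
    by (auto simp: T_def compose_def)
  have "\<not> T \<subseteq> rad"
  proof
    assume Tr: "T \<subseteq> rad"
    have "y = \<zero>\<^bsub>N\<^esub>" if y: "y \<in> S" for y
    proof -
      have "y \<in> (\<lambda>q. \<sigma> (e q)) ` carrier Q" using y Ssoc alpha_image by blast
      then obtain q where q: "q \<in> carrier Q" "y = \<sigma> (e q)" by blast
      then have "q \<in> rad" using y Tr Tmem by blast
      then show ?thesis using alpha_zero_iff[OF q(1)] q(2) by blast
    qed
    moreover have "\<zero>\<^bsub>N\<^esub> \<in> S" using Ssub unfolding \<sigma>.N.submodule_iff by blast
    ultimately show False using Sne by blast
  qed
  then have "T = carrier Q" by (rule submodule_not_in_rad[OF T])
  then show ?thesis using q Tmem SU by blast
qed

lemma extend:
  assumes "fg_module Aop L" "rmodule Aop B" "i \<in> mod_Hom Aop B L" "b \<in> mod_Hom Aop B N"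
    and "\<And>y. y \<in> carrier B \<Longrightarrow> i y = \<zero>\<^bsub>L\<^esub> \<Longrightarrow> b y = \<zero>\<^bsub>N\<^esub>"
  shows "\<exists>c\<in>mod_Hom Aop L N. \<forall>y\<in>carrier B. c (i y) = b y"
  using Alg.D_module_extend[OF injE dual_basis_bidual assms(1-3)] assms(4,5) unfolding N_eq by blast

section \<open>The dual maps of \<open>g\<close> and \<open>e\<close>\<close>

abbreviation "P0d \<equiv> dual_module Aop P0"
abbreviation "P1d \<equiv> dual_module Aop P1"
abbreviation "gd \<equiv> dual_map Aop P1 P0 g"
abbreviation "ed \<equiv> compose (carrier P0d) (inv_into (carrier P) (bidual_map A P)) (dual_map Aop Q P0 e)"

lemma P0d: "fg_module A P0d" "projective A P0d" "rmodule A P0d"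
  using dual_module_fg_projective[OF P0(1,2)] by (auto simp: projective_def)

lemma P1d: "fg_module A P1d" "projective A P1d" "rmodule A P1d"
  using dual_module_fg_projective[OF P1(1,2)] by (auto simp: projective_def)

lemma P_fg_proj: "fg_module A P" "projective A P"
  by (rule fg_module projective)+

lemma gd_hom: "gd \<in> mod_Hom A P0d P1d"
  using dual_map_hom[OF P1(3) P0(3) g_hom] by simp

lemma gd_apply:
  assumes "\<xi> \<in> carrier P0d" "z \<in> carrier P1"
  shows "gd \<xi> z = \<xi> (g z)"
proof -
  have "gd \<xi> = compose (carrier P1) \<xi> g"
    unfolding dual_map_def using assms(1) by (rule restrict_apply')
  then show ?thesis using assms(2) by (simp add: compose_eq)
qed

text \<open>The inverse of the bidual map in the definition of \<open>ed\<close> is traded for the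
  transpose of \<open>e\<close>. The resulting pairing formula is what later computations with
  \<open>ed\<close> rest on.\<close>

lemma ed_hom: "ed \<in> mod_Hom A P0d P"
  and ed_apply: "\<xi> \<in> carrier P0d \<Longrightarrow> \<psi> \<in> carrier Q \<Longrightarrow> \<psi> (ed \<xi>) = \<xi> (e \<psi>)"
proof -
  obtain u where u: "u \<in> mod_Hom A P0d P"
    "\<And>\<xi> \<psi>. \<xi> \<in> carrier P0d \<Longrightarrow> \<psi> \<in> carrier Q \<Longrightarrow> \<psi> (u \<xi>) = \<xi> (e \<psi>)"
    using transpose[OF P0(3) e_hom] by metis
  have "ed \<xi> = u \<xi>" if \<xi>: "\<xi> \<in> carrier P0d" for \<xi>
  proof -
    have uP: "u \<xi> \<in> carrier P" by (rule mod_Hom_closed[OF u(1) \<xi>])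
    have "bidual_map A P (u \<xi>) = compose (carrier Q) \<xi> e"
      using uP u(2)[OF \<xi>] by (auto simp: bidual_map_def compose_def intro!: restrict_ext)
    also have "\<dots> = dual_map Aop Q P0 e \<xi>"
      unfolding dual_map_def using \<xi> by (rule restrict_apply'[symmetric])
    finally have "ed \<xi> = inv_into (carrier P) (bidual_map A P) (bidual_map A P (u \<xi>))"
      using \<xi> by (simp only: compose_eq)
    also have "\<dots> = u \<xi>"
      using bij_bidual_map uP by (intro inv_into_f_f) (simp_all only: bij_betw_def)
    finally show ?thesis .
  qed
  then have eq: "ed = u"
    by (intro extensionalityI[of _ "carrier P0d"])
      (use u(1) in \<open>auto simp: compose_def mod_Hom_def PiE_def\<close>)
  show "ed \<in> mod_Hom A P0d P" unfolding eq by (rule u(1))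
  show "\<psi> (ed \<xi>) = \<xi> (e \<psi>)" if "\<xi> \<in> carrier P0d" "\<psi> \<in> carrier Q" for \<xi> \<psi>
    unfolding eq by (rule u(2)[OF that])
qed

sublocale gd: rmodule_hom A P0d P1d gd
  by (rule rmodule_homI[OF P0d(3) P1d(3) gd_hom])

sublocale ed: rmodule_hom A P0d P ed
  by (rule rmodule_homI[OF P0d(3) rmodule_axioms ed_hom])

text \<open>If e* factored through g*, then dually \<open>e\<close> would factor through
  \<open>g\<close>, and \<alpha>, being \<sigma> after \<open>e\<close>, would vanish. Both failures
  of splitting reduce to this.\<close>

lemma ed_not_factor: "\<not> (\<exists>v\<in>mod_Hom A P1d P. \<forall>\<xi>\<in>carrier P0d. v (gd \<xi>) = ed \<xi>)"
proof
  assume "\<exists>v\<in>mod_Hom A P1d P. \<forall>\<xi>\<in>carrier P0d. v (gd \<xi>) = ed \<xi>"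
  then obtain v where v: "v \<in> mod_Hom A P1d P" "\<And>\<xi>. \<xi> \<in> carrier P0d \<Longrightarrow> v (gd \<xi>) = ed \<xi>"
    by blast
  obtain n0 x0 f0 where "dual_basis Aop P0 n0 x0 f0" using exists_dual_basis[OF P0(1,2)] by blast
  then interpret B0: dual_basis Aop P0 n0 x0 f0 .
  obtain n1 x1 f1 where "dual_basis Aop P1 n1 x1 f1" using exists_dual_basis[OF P1(1,2)] by blast
  then interpret B1: dual_basis Aop P1 n1 x1 f1 .
  have "\<sigma> (e \<psi>) = \<zero>\<^bsub>N\<^esub>" if \<psi>: "\<psi> \<in> carrier Q" for \<psi>
  proof -
    have \<psi>H: "\<psi> \<in> mod_Hom A P (regular_module A)" using \<psi> by simp
    \<comment> \<open>A functional on P1* is evaluation at an element of \<open>P1\<close>; that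
      element is the one through which \<open>e \<psi>\<close> passes.\<close>
    have "compose (carrier P1d) \<psi> v \<in> carrier (dual_module A P1d)"
      using mod_Hom_compose[OF v(1) \<psi>H P1d(3)] by simp
    also have "\<dots> = bidual_map Aop P1 ` carrier P1"
      using B1.bij_bidual_map by (simp add: bij_betw_def)
    finally obtain y where y: "y \<in> carrier P1" "compose (carrier P1d) \<psi> v = bidual_map Aop P1 y"
      by blast
    have \<eta>y: "\<psi> (v \<eta>) = \<eta> y" if "\<eta> \<in> carrier P1d" for \<eta>
      using fun_cong[OF y(2), of \<eta>] that y(1) by (simp add: compose_eq bidual_map_def)
    have "e \<psi> = g y"
    proof (rule B0.separate[OF e.closed[OF \<psi>] g.closed[OF y(1)]])
      fix \<xi> assume "\<xi> \<in> mod_Hom Aop P0 (regular_module Aop)"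
      then have \<xi>: "\<xi> \<in> carrier P0d" by simp
      have "\<xi> (e \<psi>) = \<psi> (v (gd \<xi>))" using ed_apply[OF \<xi> \<psi>] v(2)[OF \<xi>] by simp
      also have "\<dots> = gd \<xi> y" using \<xi> by (intro \<eta>y gd.closed)
      also have "\<dots> = \<xi> (g y)" by (rule gd_apply[OF \<xi> y(1)])
      finally show "\<xi> (e \<psi>) = \<xi> (g y)" .
    qed
    then show ?thesis using \<sigma>g[OF y(1)] by simp
  qed
  then show False using alpha_nonzero by blast
qed

end

lemma dual_map_apply:
  assumes "\<psi> \<in> carrier (dual_module A N)" "y \<in> carrier M"
  shows "dual_map A M N h \<psi> y = \<psi> (h y)"
proof -
  have "dual_map A M N h \<psi> = compose (carrier M) \<psi> h"
    unfolding dual_map_def using assms(1) by (rule restrict_apply')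
  then show ?thesis using assms(2) by (simp add: compose_eq)
qed

text \<open>Exchanging the two arguments passes between maps from M to L* and maps from L to M*.
  Thus a map into P0* or P1* is dualized without meeting a bidual.\<close>

lemma flip_hom:
  assumes M: "rmodule A M" and L: "rmodule (op_ring A) L"
    and h: "h \<in> mod_Hom A M (dual_module (op_ring A) L)"
  shows "(\<lambda>y\<in>carrier L. \<lambda>m\<in>carrier M. h m y) \<in> mod_Hom (op_ring A) L (dual_module A M)"
proof -
  interpret M: rmodule A M by fact
  interpret L: rmodule "op_ring A" L by fact
  have hm: "h m \<in> mod_Hom (op_ring A) L (regular_module (op_ring A))" if "m \<in> carrier M" for m
    using mod_Hom_closed[OF h that] by simp
  note reg = mod_Hom_regular[OF hm]
  have mem: "(\<lambda>m\<in>carrier M. h m y) \<in> mod_Hom A M (regular_module A)" if y: "y \<in> carrier L" for y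
  proof (rule mod_HomI[OF M])
    fix m m' assume m: "m \<in> carrier M" "m' \<in> carrier M"
    show "h (m \<oplus>\<^bsub>M\<^esub> m') y = h m y \<oplus>\<^bsub>regular_module A\<^esub> h m' y"
      unfolding mod_Hom_add[OF h m] using y by simp
  next
    fix a m assume am: "a \<in> carrier A" "m \<in> carrier M"
    show "h (a \<odot>\<^bsub>M\<^esub> m) y = a \<odot>\<^bsub>regular_module A\<^esub> h m y"
      unfolding mod_Hom_smult[OF h am] using y by simp
  qed (use y reg(1) in simp)
  show ?thesis
    by (rule mod_HomI[OF L]) (use mem reg in \<open>simp_all cong: restrict_cong\<close>)
qed

context nakayama_presentation
begin

declare dual_module_simps [simp del]

section \<open>The displayed sequence: exactness and failure to split\<close>

abbreviation "X \<equiv> \<lparr>src = zero_module, tgt = P, arr = zero_map zero_module P\<rparr>"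
abbreviation "Y \<equiv> \<lparr>src = P0d, tgt = dsum_module P1d P, arr = \<lambda>\<xi>\<in>carrier P0d. (gd \<xi>, ed \<xi>)\<rparr>"
abbreviation "Z \<equiv> \<lparr>src = P0d, tgt = P1d, arr = gd\<rparr>"
abbreviation "s \<equiv> (zero_map zero_module P0d, \<lambda>p\<in>carrier P. (\<zero>\<^bsub>P1d\<^esub>, p))"
abbreviation "t \<equiv> (\<lambda>\<xi>\<in>carrier P0d. \<xi>, \<lambda>q\<in>carrier P1d \<times> carrier P. fst q)"

lemma zero_rmodule: "rmodule A zero_module"
  by (rule rmodule_zero_module[OF Alg.A.ring_axioms])

lemma dsum_rmodule: "rmodule A (dsum_module P1d P)"
  by (rule rmodule_dsum_module[OF P1d(3) rmodule_axioms])

lemma X: "P_obj A X"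
  unfolding P_obj_def H_obj_def mobj.simps
  using zero_module_fg_projective[OF Alg.A.ring_axioms] P_fg_proj
    mod_Hom_zero_map[OF zero_rmodule rmodule_axioms] by auto

lemma Y: "P_obj A Y"
  unfolding P_obj_def H_obj_def mobj.simps
  using P0d dsum_module_fg[OF P1d(1) P_fg_proj(1)] dsum_module_projective[OF P1d(2) P_fg_proj(2)]
    dsum_pair_hom[OF P0d(3) gd_hom ed_hom] by auto

lemma Z: "P_obj A Z"
  unfolding P_obj_def H_obj_def mobj.simps using P0d P1d gd_hom by auto

lemma s2_hom: "(\<lambda>p\<in>carrier P. (\<zero>\<^bsub>P1d\<^esub>, p)) \<in> mod_Hom A P (dsum_module P1d P)"
  by (rule mod_HomI[OF rmodule_axioms]) simp_all

lemma t2_hom: "(\<lambda>q\<in>carrier P1d \<times> carrier P. fst q) \<in> mod_Hom A (dsum_module P1d P) P1d"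
  using dsum_fst_hom[OF P1d(3) rmodule_axioms] by simp

lemma s_mor: "s \<in> H_mor A X Y"
  unfolding H_mor_iff using s2_hom mod_Hom_zero_map[OF zero_rmodule P0d(3)]
  by (simp add: zero_map_def)

lemma t_mor: "t \<in> H_mor A Y Z"
  unfolding H_mor_iff using t2_hom mod_Hom_id[OF P0d(3)] by simp

lemma exact: "short_exact_H A X Y Z s t"
proof -
  have "short_exact_mod A zero_module P0d P0d (zero_map zero_module P0d) (\<lambda>\<xi>\<in>carrier P0d. \<xi>)"
    unfolding short_exact_mod_def
    using mod_Hom_id[OF P0d(3)] mod_Hom_zero_map[OF zero_rmodule P0d(3)]
    by (auto simp: zero_map_def mem_a_kernel)
  moreover have "short_exact_mod A P (dsum_module P1d P) P1d
    (\<lambda>p\<in>carrier P. (\<zero>\<^bsub>P1d\<^esub>, p)) (\<lambda>q\<in>carrier P1d \<times> carrier P. fst q)"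
    unfolding short_exact_mod_def
  proof (intro conjI s2_hom t2_hom)
    show "inj_on (\<lambda>p\<in>carrier P. (\<zero>\<^bsub>P1d\<^esub>, p)) (carrier P)" by (auto simp: inj_on_def)
    show "(\<lambda>p\<in>carrier P. (\<zero>\<^bsub>P1d\<^esub>, p)) ` carrier P
        = a_kernel (dsum_module P1d P) P1d (\<lambda>q\<in>carrier P1d \<times> carrier P. fst q)"
      by (auto simp: mem_a_kernel image_iff)
    have "(\<lambda>q\<in>carrier P1d \<times> carrier P. fst q) ` carrier (dsum_module P1d P) = fst ` (carrier P1d \<times> carrier P)"
      by simp
    also have "\<dots> = carrier P1d" using M.zero_closed by (auto simp: fst_image_times)
    finally show "(\<lambda>q\<in>carrier P1d \<times> carrier P. fst q) ` carrier (dsum_module P1d P) = carrier P1d" .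
  qed
  ultimately show ?thesis
    unfolding short_exact_H_def using s_mor t_mor by simp
qed

text \<open>A retraction is the identity on the summand \<open>P\<close> and, since its target has
  zero source, kills every \<open>(gd \<xi>, ed \<xi>)\<close>. The negative of its restriction to
  P1* therefore factors e* through g*.\<close>

lemma not_split_mono: "\<not> split_mono A X Y s"
proof
  assume "split_mono A X Y s"
  then obtain r where r: "r \<in> H_mor A Y X" "H_comp X r s = H_id X" by (auto simp: split_mono_def)
  have r2: "snd r \<in> mod_Hom A (dsum_module P1d P) P" using r(1) by (simp add: H_mor_iff)
  interpret r2: rmodule_hom A "dsum_module P1d P" P "snd r"
    by (rule rmodule_homI[OF dsum_rmodule rmodule_axioms r2])
  have rs: "snd r (\<zero>\<^bsub>P1d\<^esub>, p) = p" if "p \<in> carrier P" for p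
    using H_comp_apply(2)[of p X r s] H_id_apply(2)[of p X] that r(2) by simp
  have rc: "snd r (gd \<xi>, ed \<xi>) = \<zero>\<^bsub>P\<^esub>" if "\<xi> \<in> carrier P0d" for \<xi>
    using r(1) that by (simp add: H_mor_iff zero_map_def)
  have i: "(\<lambda>\<eta>\<in>carrier P1d. (\<eta>, \<zero>\<^bsub>P\<^esub>)) \<in> mod_Hom A P1d (dsum_module P1d P)"
    by (rule mod_HomI[OF P1d(3)]) simp_all
  have rH: "compose (carrier P1d) (snd r) (\<lambda>\<eta>\<in>carrier P1d. (\<eta>, \<zero>\<^bsub>P\<^esub>)) \<in> mod_Hom A P1d P"
    by (rule mod_Hom_compose[OF i r2 P1d(3)])
  define v where "v = (\<lambda>\<eta>\<in>carrier P1d. \<ominus>\<^bsub>P\<^esub> compose (carrier P1d) (snd r) (\<lambda>\<eta>\<in>carrier P1d. (\<eta>, \<zero>\<^bsub>P\<^esub>)) \<eta>)"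
  have "v \<in> mod_Hom A P1d P"
    unfolding v_def by (rule mod_Hom_minus[OF P1d(3) rmodule_axioms rH])
  moreover have "v (gd \<xi>) = ed \<xi>" if \<xi>: "\<xi> \<in> carrier P0d" for \<xi>
  proof -
    have "snd r (gd \<xi>, \<zero>\<^bsub>P\<^esub>) \<in> carrier P" using \<xi> by (intro r2.closed) simp
    moreover have "ed \<xi> \<oplus>\<^bsub>P\<^esub> snd r (gd \<xi>, \<zero>\<^bsub>P\<^esub>) = \<zero>\<^bsub>P\<^esub>"
      using r2.add[of "(\<zero>\<^bsub>P1d\<^esub>, ed \<xi>)" "(gd \<xi>, \<zero>\<^bsub>P\<^esub>)"] rc[OF \<xi>] rs[OF ed.closed[OF \<xi>]]
        ed.closed[OF \<xi>] gd.closed[OF \<xi>] by (simp del: ed.closed)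
    ultimately have "\<ominus>\<^bsub>P\<^esub> snd r (gd \<xi>, \<zero>\<^bsub>P\<^esub>) = ed \<xi>"
      using ed.closed[OF \<xi>] by (intro M.minus_equality)
    then show ?thesis using gd.closed[OF \<xi>] by (simp add: v_def compose_eq)
  qed
  ultimately show False using ed_not_factor by blast
qed

text \<open>The first component of a section can only be the identity, so commutativity makes the
  \<open>P\<close>-component of the second one a factorization of e* through g*.\<close>

lemma not_split_epi: "\<not> split_epi A Y Z t"
proof
  assume "split_epi A Y Z t"
  then obtain r where r: "r \<in> H_mor A Z Y" "H_comp Z t r = H_id Z" by (auto simp: split_epi_def)
  have r2: "snd r \<in> mod_Hom A P1d (dsum_module P1d P)" using r(1) by (simp add: H_mor_iff)
  have r1: "fst r \<xi> = \<xi>" if \<xi>: "\<xi> \<in> carrier P0d" for \<xi>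
  proof -
    have "fst r \<xi> \<in> carrier P0d" using H_mor_closed(1)[OF r(1), of \<xi>] \<xi> by simp
    then show ?thesis
      using H_comp_apply(1)[of \<xi> Z t r] H_id_apply(1)[of \<xi> Z] \<xi> r(2) by simp
  qed
  define v where "v = compose (carrier P1d) (\<lambda>z\<in>carrier (dsum_module P1d P). snd z) (snd r)"
  have "v \<in> mod_Hom A P1d P"
    unfolding v_def by (rule mod_Hom_compose[OF r2 dsum_snd_hom[OF P1d(3) rmodule_axioms] P1d(3)])
  moreover have "v (gd \<xi>) = ed \<xi>" if \<xi>: "\<xi> \<in> carrier P0d" for \<xi>
  proof -
    have "snd r (gd \<xi>) = (gd \<xi>, ed \<xi>)"
      using r(1) r1[OF \<xi>] \<xi> by (simp add: H_mor_iff)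
    then show ?thesis
      using gd.closed[OF \<xi>] ed.closed[OF \<xi>] by (simp add: v_def compose_eq del: gd.closed ed.closed)
  qed
  ultimately show False using ed_not_factor by blast
qed

text \<open>With the two lemmas that follow, this frees the dual basis constructions from a chosen
  basis, so that they can be applied to the terms of an arbitrary test object.\<close>

lemma transpose_exists:
  assumes "fg_module A K" "projective A K" "rmodule Aop L" "d \<in> mod_Hom Aop (dual_module A K) L"
  shows "\<exists>u\<in>mod_Hom A (dual_module Aop L) K.
    \<forall>\<xi>\<in>carrier (dual_module Aop L). \<forall>\<psi>\<in>carrier (dual_module A K). \<psi> (u \<xi>) = \<xi> (d \<psi>)"
proof -
  obtain m y \<psi> where "dual_basis A K m y \<psi>" using exists_dual_basis[OF assms(1,2)] by blast
  then interpret K: dual_basis A K m y \<psi> .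
  show ?thesis by (rule K.transpose[OF assms(3,4)])
qed

lemma lift_exists:
  assumes "fg_module B K" "projective B K" "rmodule B L" "rmodule B C" "p \<in> mod_Hom B L C"
    "h \<in> mod_Hom B K C" "\<And>y. y \<in> carrier K \<Longrightarrow> h y \<in> p ` carrier L"
  shows "\<exists>k\<in>mod_Hom B K L. \<forall>y\<in>carrier K. p (k y) = h y"
proof -
  obtain m y \<psi> where "dual_basis B K m y \<psi>" using exists_dual_basis[OF assms(1,2)] by blast
  then interpret K: dual_basis B K m y \<psi> .
  show ?thesis using assms(3-7) by (rule K.lift)
qed

lemma separate_fg_projective:
  assumes "fg_module A K" "projective A K" "p \<in> carrier K" "q \<in> carrier K"
    "\<And>\<psi>. \<psi> \<in> carrier (dual_module A K) \<Longrightarrow> \<psi> p = \<psi> q"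
  shows "p = q"
proof -
  obtain m y \<psi> where "dual_basis A K m y \<psi>" using exists_dual_basis[OF assms(1,2)] by blast
  then interpret K: dual_basis A K m y \<psi> .
  show ?thesis using assms(3-5) by (intro K.separate[of p q]) (auto simp: dual_module_simps)
qed

lemma carrier_dual: "\<psi> \<in> carrier (dual_module A' M) \<longleftrightarrow> \<psi> \<in> mod_Hom A' M (regular_module A')"
  by (simp add: dual_module_simps)

lemma f_mem: "i < n \<Longrightarrow> f i \<in> carrier Q"
  using f_hom by (simp add: carrier_dual)

text \<open>If some \<open>\<chi> \<in> K\<^sub>2\<^sup>*\<close> with \<open>\<chi> k = 0\<close> has \<open>\<chi> h\<^sub>2\<close> outside the radical, then all \<open>f\<^sub>i\<close> are of
  the form \<open>\<chi>\<^sub>i h\<^sub>2\<close> with \<open>\<chi>\<^sub>i k = 0\<close>, and \<open>y \<mapsto> \<Sum>\<^sub>i x\<^sub>i \<chi>\<^sub>i(y)\<close> is a left inverse of \<open>h\<close>.\<close>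

lemma dual_kernel_in_radical:
  assumes K: "P_obj A K" and h: "h \<in> H_mor A X K" and ns: "\<not> split_mono A X K h"
    and \<chi>: "\<chi> \<in> carrier (dual_module A (tgt K))"
      "\<And>y. y \<in> carrier (src K) \<Longrightarrow> \<chi> (arr K y) = \<zero>\<^bsub>A\<^esub>"
  shows "dual_map A P (tgt K) (snd h) \<chi> \<in> rad"
proof (rule ccontr)
  assume nr: "dual_map A P (tgt K) (snd h) \<chi> \<notin> rad"
  note KD = P_objD[OF K]
  let ?K1 = "src K" and ?K2 = "tgt K"
  have h2: "snd h \<in> mod_Hom A P ?K2" using h by (simp add: H_mor_iff)
  interpret h2: rmodule_hom A P ?K2 "snd h" by (rule rmodule_homI[OF rmodule_axioms KD(2) h2])
  interpret k: rmodule_hom A ?K1 ?K2 "arr K" by (rule rmodule_homI[OF KD(1-3)])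
  interpret K1d: rmodule Aop "dual_module A ?K1" by (rule rmodule_dual_module[OF KD(1)])
  interpret K2d: rmodule Aop "dual_module A ?K2" by (rule rmodule_dual_module[OF KD(2)])
  interpret h2d: rmodule_hom Aop "dual_module A ?K2" Q "dual_map A P ?K2 (snd h)"
    by (rule rmodule_homI[OF K2d.rmodule_axioms Q.rmodule_axioms dual_map_hom[OF rmodule_axioms KD(2) h2]])
  interpret kd: rmodule_hom Aop "dual_module A ?K2" "dual_module A ?K1" "dual_map A ?K1 ?K2 (arr K)"
    by (rule rmodule_homI[OF K2d.rmodule_axioms K1d.rmodule_axioms dual_map_hom[OF KD(1-3)]])
  let ?V = "a_kernel (dual_module A ?K2) (dual_module A ?K1) (dual_map A ?K1 ?K2 (arr K))"
  have V: "\<psi> (arr K y) = \<zero>\<^bsub>A\<^esub>" if "\<psi> \<in> ?V" "y \<in> carrier ?K1" for \<psi> y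
  proof -
    have "dual_map A ?K1 ?K2 (arr K) \<psi> y = \<zero>\<^bsub>dual_module A ?K1\<^esub> y" "\<psi> \<in> carrier (dual_module A ?K2)"
      using that(1) by (simp_all add: mem_a_kernel)
    then show ?thesis using that(2) by (simp add: dual_map_apply dual_module_simps(2))
  qed
  have "\<chi> \<in> ?V"
    unfolding mem_a_kernel
  proof
    show "\<chi> \<in> carrier (dual_module A ?K2)" by (rule \<chi>(1))
    show "dual_map A ?K1 ?K2 (arr K) \<chi> = \<zero>\<^bsub>dual_module A ?K1\<^esub>"
    proof (rule mod_Hom_eqI)
      show "dual_map A ?K1 ?K2 (arr K) \<chi> \<in> mod_Hom A ?K1 (regular_module A)"
        using kd.closed[OF \<chi>(1)] by (simp add: carrier_dual)
      show "\<zero>\<^bsub>dual_module A ?K1\<^esub> \<in> mod_Hom A ?K1 (regular_module A)"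
        using K1d.M.zero_closed by (simp add: carrier_dual)
    qed (use \<chi> in \<open>simp add: dual_map_apply dual_module_simps(2)\<close>)
  qed
  then have "\<not> dual_map A P ?K2 (snd h) ` ?V \<subseteq> rad" using nr by blast
  then have Veq: "dual_map A P ?K2 (snd h) ` ?V = carrier Q"
    by (rule submodule_not_in_rad[OF h2d.submodule_image[OF kd.submodule_kernel]])
  define \<beta> where "\<beta> i = inv_into ?V (dual_map A P ?K2 (snd h)) (f i)" for i
  have \<beta>: "\<beta> i \<in> ?V" "dual_map A P ?K2 (snd h) (\<beta> i) = f i" if "i < n" for i
    unfolding \<beta>_def using f_mem[OF that, folded Veq] by (rule inv_into_into f_inv_into_f)+
  have \<beta>c: "\<beta> i \<in> carrier (dual_module A ?K2)" if "i < n" for i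
    using \<beta>(1)[OF that] by (simp add: mem_a_kernel)
  have \<beta>H: "\<beta> i \<in> mod_Hom A ?K2 (regular_module A)" if "i < n" for i
    using \<beta>c[OF that] by (simp add: carrier_dual)
  define r where "r = (\<lambda>y\<in>carrier ?K2. \<Oplus>\<^bsub>P\<^esub>i\<in>{..<n}. \<beta> i y \<odot>\<^bsub>P\<^esub> x i)"
  have rH: "r \<in> mod_Hom A ?K2 P"
    unfolding r_def by (rule comb_hom[OF KD(2) rmodule_axioms \<beta>H x_closed])
  have "r (arr K y) = \<zero>\<^bsub>P\<^esub>" if y: "y \<in> carrier ?K1" for y
  proof -
    have "r (arr K y) = (\<Oplus>\<^bsub>P\<^esub>i\<in>{..<n}. \<beta> i (arr K y) \<odot>\<^bsub>P\<^esub> x i)"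
      using y by (simp add: r_def)
    also have "\<dots> = (\<Oplus>\<^bsub>P\<^esub>i\<in>{..<n}. \<zero>\<^bsub>P\<^esub>)"
      by (rule M.finsum_cong') (use V[OF \<beta>(1) y] in auto)
    finally show ?thesis by simp
  qed
  moreover have "zero_map ?K1 zero_module \<in> mod_Hom A ?K1 zero_module"
    by (rule mod_Hom_zero_map[OF KD(1) zero_rmodule])
  ultimately have rM: "(zero_map ?K1 zero_module, r) \<in> H_mor A K X"
    unfolding H_mor_iff using rH by (simp add: zero_map_def)
  have HX: "H_obj A X" using X by (simp add: P_obj_def)
  have "H_comp X (zero_map ?K1 zero_module, r) h = H_id X"
  proof (rule H_mor_eqI[OF H_comp_mor[OF h rM HX] H_id_mor[OF HX]])
    fix p assume "p \<in> carrier (tgt X)"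
    then have p: "p \<in> carrier P" by simp
    have "r (snd h p) = (\<Oplus>\<^bsub>P\<^esub>i\<in>{..<n}. \<beta> i (snd h p) \<odot>\<^bsub>P\<^esub> x i)"
      using p by (simp add: r_def)
    also have "\<dots> = (\<Oplus>\<^bsub>P\<^esub>i\<in>{..<n}. f i p \<odot>\<^bsub>P\<^esub> x i)"
    proof (rule M.finsum_cong')
      fix i assume i: "i \<in> {..<n}"
      then have "\<beta> i (snd h p) = f i p"
        using dual_map_apply[OF \<beta>c p, of i "snd h"] \<beta>(2)[of i] by simp
      then show "\<beta> i (snd h p) \<odot>\<^bsub>P\<^esub> x i = f i p \<odot>\<^bsub>P\<^esub> x i" by simp
    qed (use p in auto)
    also have "\<dots> = p" by (rule expand[OF p])
    finally show "snd (H_comp X (zero_map ?K1 zero_module, r) h) p = snd (H_id X) p"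
      using p by simp
  qed simp
  then show False using ns rM by (auto simp: split_mono_def)
qed

text \<open>The maps \<delta> and \<zeta> of the overview are \<open>d\<close> and \<open>z\<close>:
  the extension \<open>c\<close> of \<alpha> after h2* lifts along \<sigma> to \<open>d\<close>, the
  remaining difference lifts along \<open>g\<close> to \<open>z\<close>. Their transposes
  \<open>u\<close> and \<open>v\<close> form the extension of \<open>h\<close>.\<close>

lemma left_factor:
  assumes K: "P_obj A K" and h: "h \<in> H_mor A X K" and ns: "\<not> split_mono A X K h"
  shows "\<exists>k\<in>H_mor A Y K. H_comp X k s = h"
proof -
  note KD = P_objD[OF K]
  let ?K1 = "src K" and ?K2 = "tgt K"
  let ?K1d = "dual_module A ?K1" and ?K2d = "dual_module A ?K2"
  have h2: "snd h \<in> mod_Hom A P ?K2" and h1: "fst h \<in> mod_Hom A zero_module ?K1"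
    using h by (simp_all add: H_mor_iff)
  interpret h2: rmodule_hom A P ?K2 "snd h" by (rule rmodule_homI[OF rmodule_axioms KD(2) h2])
  interpret h1: rmodule_hom A zero_module ?K1 "fst h" by (rule rmodule_homI[OF zero_rmodule KD(1) h1])
  interpret k: rmodule_hom A ?K1 ?K2 "arr K" by (rule rmodule_homI[OF KD(1-3)])
  note K1d = dual_module_fg_projective[OF KD(4,6)] rmodule_dual_module[OF KD(1)]
  note K2d = dual_module_fg_projective[OF KD(5,7)] rmodule_dual_module[OF KD(2)]
  define h2d where "h2d = dual_map A P ?K2 (snd h)"
  define kd where "kd = dual_map A ?K1 ?K2 (arr K)"
  have h2dH: "h2d \<in> mod_Hom Aop ?K2d Q"
    unfolding h2d_def by (rule dual_map_hom[OF rmodule_axioms KD(2) h2])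
  have kdH: "kd \<in> mod_Hom Aop ?K2d ?K1d"
    unfolding kd_def by (rule dual_map_hom[OF KD(1-3)])
  interpret h2d: rmodule_hom Aop ?K2d Q h2d by (rule rmodule_homI[OF K2d(3) Q.rmodule_axioms h2dH])
  interpret kd: rmodule_hom Aop ?K2d ?K1d kd by (rule rmodule_homI[OF K2d(3) K1d(3) kdH])
  have h2d_apply: "h2d \<chi> p = \<chi> (snd h p)" if "\<chi> \<in> carrier ?K2d" "p \<in> carrier P" for \<chi> p
    unfolding h2d_def by (rule dual_map_apply[OF that])
  have kd_apply: "kd \<chi> y = \<chi> (arr K y)" if "\<chi> \<in> carrier ?K2d" "y \<in> carrier ?K1" for \<chi> y
    unfolding kd_def by (rule dual_map_apply[OF that])
  have bH: "compose (carrier ?K2d) (compose (carrier Q) \<sigma> e) h2d \<in> mod_Hom Aop ?K2d N"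
    by (rule mod_Hom_compose[OF h2dH alpha_hom K2d(3)])
  have b_eq: "compose (carrier ?K2d) (compose (carrier Q) \<sigma> e) h2d \<chi> = \<sigma> (e (h2d \<chi>))"
    if "\<chi> \<in> carrier ?K2d" for \<chi>
    using that by (simp add: compose_eq)
  have "compose (carrier ?K2d) (compose (carrier Q) \<sigma> e) h2d \<chi> = \<zero>\<^bsub>N\<^esub>"
    if \<chi>: "\<chi> \<in> carrier ?K2d" "kd \<chi> = \<zero>\<^bsub>?K1d\<^esub>" for \<chi>
  proof -
    have "\<chi> (arr K y) = \<zero>\<^bsub>A\<^esub>" if y: "y \<in> carrier ?K1" for y
      using kd_apply[OF \<chi>(1) y] \<chi>(2) y by (simp add: dual_module_simps(2))
    from dual_kernel_in_radical[OF K h ns \<chi>(1) this]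
    have "h2d \<chi> \<in> rad" by (simp add: h2d_def)
    then show ?thesis using alpha_zero_iff[OF h2d.closed[OF \<chi>(1)]] b_eq[OF \<chi>(1)] by simp
  qed
  from extend[OF K1d(1) K2d(3) kdH bH this] obtain c where c: "c \<in> mod_Hom Aop ?K1d N"
    "\<And>\<chi>. \<chi> \<in> carrier ?K2d \<Longrightarrow> c (kd \<chi>) = \<sigma> (e (h2d \<chi>))"
    using b_eq by auto
  have "c \<psi> \<in> \<sigma> ` carrier P0" if "\<psi> \<in> carrier ?K1d" for \<psi>
    unfolding \<sigma>_surj by (rule mod_Hom_closed[OF c(1) that])
  from lift_exists[OF K1d(1,2) P0(3) N_rmodule \<sigma>_hom c(1) this] obtain d where
    d: "d \<in> mod_Hom Aop ?K1d P0" "\<And>\<psi>. \<psi> \<in> carrier ?K1d \<Longrightarrow> \<sigma> (d \<psi>) = c \<psi>" by auto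
  interpret d: rmodule_hom Aop ?K1d P0 d by (rule rmodule_homI[OF K1d(3) P0(3) d(1)])
  \<comment> \<open>Both terms have the same image under \<sigma> because \<open>c\<close> extends
    \<alpha> after h2*. The difference thus lies in the kernel of \<sigma>, the image of
    \<open>g\<close>.\<close>
  define r where "r = (\<lambda>\<chi>\<in>carrier ?K2d. compose (carrier ?K2d) d kd \<chi> \<ominus>\<^bsub>P0\<^esub> compose (carrier ?K2d) e h2d \<chi>)"
  have rH: "r \<in> mod_Hom Aop ?K2d P0"
    unfolding r_def
    by (rule mod_Hom_diff[OF K2d(3) P0(3) mod_Hom_compose[OF kdH d(1) K2d(3)]
          mod_Hom_compose[OF h2dH e_hom K2d(3)]])
  have r_eq: "r \<chi> = d (kd \<chi>) \<ominus>\<^bsub>P0\<^esub> e (h2d \<chi>)" if "\<chi> \<in> carrier ?K2d" for \<chi>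
    using that by (simp add: r_def compose_eq)
  have "r \<chi> \<in> g ` carrier P1" if \<chi>: "\<chi> \<in> carrier ?K2d" for \<chi>
  proof (rule kernel_\<sigma>)
    show "r \<chi> \<in> carrier P0" by (rule mod_Hom_closed[OF rH \<chi>])
    have "\<sigma> (r \<chi>) = \<sigma> (d (kd \<chi>)) \<ominus>\<^bsub>N\<^esub> \<sigma> (e (h2d \<chi>))"
      unfolding r_eq[OF \<chi>] using \<chi> by (intro \<sigma>.diff d.closed kd.closed e.closed h2d.closed)
    also have "\<sigma> (d (kd \<chi>)) = \<sigma> (e (h2d \<chi>))"
      using d(2)[OF kd.closed[OF \<chi>]] c(2)[OF \<chi>] by simp
    also have "\<sigma> (e (h2d \<chi>)) \<ominus>\<^bsub>N\<^esub> \<sigma> (e (h2d \<chi>)) = \<zero>\<^bsub>N\<^esub>"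
      using \<chi> by (simp add: \<sigma>.N.diff_eq_zero_iff)
    finally show "\<sigma> (r \<chi>) = \<zero>\<^bsub>N\<^esub>" .
  qed
  from lift_exists[OF K2d(1,2) P1(3) P0(3) g_hom rH this] obtain z where
    z: "z \<in> mod_Hom Aop ?K2d P1" "\<And>\<chi>. \<chi> \<in> carrier ?K2d \<Longrightarrow> g (z \<chi>) = r \<chi>" by auto
  interpret z: rmodule_hom Aop ?K2d P1 z by (rule rmodule_homI[OF K2d(3) P1(3) z(1)])
  obtain u where u: "u \<in> mod_Hom A P0d ?K1"
    "\<And>\<xi> \<psi>. \<xi> \<in> carrier P0d \<Longrightarrow> \<psi> \<in> carrier ?K1d \<Longrightarrow> \<psi> (u \<xi>) = \<xi> (d \<psi>)"
    using transpose_exists[OF KD(4,6) P0(3) d(1)] by blast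
  obtain v where v: "v \<in> mod_Hom A P1d ?K2"
    "\<And>\<eta> \<chi>. \<eta> \<in> carrier P1d \<Longrightarrow> \<chi> \<in> carrier ?K2d \<Longrightarrow> \<chi> (v \<eta>) = \<eta> (z \<chi>)"
    using transpose_exists[OF KD(5,7) P1(3) z(1)] by blast
  interpret u: rmodule_hom A P0d ?K1 u by (rule rmodule_homI[OF P0d(3) KD(1) u(1)])
  interpret v: rmodule_hom A P1d ?K2 v by (rule rmodule_homI[OF P1d(3) KD(2) v(1)])
  \<comment> \<open>Tested against a functional \<chi>, this becomes \<xi> applied to the sum of
    \<open>g (z \<chi>)\<close> and \<open>e (h2d \<chi>)\<close>, which by the choice of
    \<open>z\<close> is \<open>d (kd \<chi>)\<close>.\<close>
  have com: "v (gd \<xi>) \<oplus>\<^bsub>?K2\<^esub> snd h (ed \<xi>) = arr K (u \<xi>)" if \<xi>: "\<xi> \<in> carrier P0d" for \<xi>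
  proof (rule separate_fg_projective[OF KD(5,7)])
    note cl = gd.closed[OF \<xi>] ed.closed[OF \<xi>] u.closed[OF \<xi>]
    show "v (gd \<xi>) \<oplus>\<^bsub>?K2\<^esub> snd h (ed \<xi>) \<in> carrier ?K2"
      by (intro h2.N.M.add.m_closed v.closed h2.closed cl)
    show "arr K (u \<xi>) \<in> carrier ?K2" by (intro k.closed cl)
    fix \<chi> assume \<chi>: "\<chi> \<in> carrier ?K2d"
    interpret \<chi>: rmodule_hom A ?K2 "regular_module A" \<chi>
      by (rule rmodule_homI[OF KD(2) rmodule_regular_module[OF Alg.A.ring_axioms]])
        (use \<chi> in \<open>simp add: carrier_dual\<close>)
    interpret \<xi>: rmodule_hom Aop P0 "regular_module Aop" \<xi>
      by (rule rmodule_homI[OF P0(3) rmodule_regular_module[OF Op.A.ring_axioms]])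
        (use \<xi> in \<open>simp add: carrier_dual\<close>)
    have "\<chi> (v (gd \<xi>) \<oplus>\<^bsub>?K2\<^esub> snd h (ed \<xi>)) = \<chi> (v (gd \<xi>)) \<oplus>\<^bsub>A\<^esub> \<chi> (snd h (ed \<xi>))"
      using \<chi>.add[OF v.closed[OF cl(1)] h2.closed[OF cl(2)]] by simp
    also have "\<chi> (v (gd \<xi>)) = \<xi> (g (z \<chi>))"
      using v(2)[OF cl(1) \<chi>] gd_apply[OF \<xi> z.closed[OF \<chi>]] by simp
    also have "\<chi> (snd h (ed \<xi>)) = \<xi> (e (h2d \<chi>))"
      using h2d_apply[OF \<chi> cl(2)] ed_apply[OF \<xi> h2d.closed[OF \<chi>]] by simp
    also have "\<xi> (g (z \<chi>)) \<oplus>\<^bsub>A\<^esub> \<xi> (e (h2d \<chi>)) = \<xi> (r \<chi> \<oplus>\<^bsub>P0\<^esub> e (h2d \<chi>))"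
      using \<xi>.add[OF g.closed[OF z.closed[OF \<chi>]] e.closed[OF h2d.closed[OF \<chi>]]] z(2)[OF \<chi>] by simp
    also have "r \<chi> \<oplus>\<^bsub>P0\<^esub> e (h2d \<chi>) = d (kd \<chi>)"
    proof -
      have cl': "e (h2d \<chi>) \<in> carrier P0" "d (kd \<chi>) \<in> carrier P0"
        using \<chi> by (auto intro!: e.closed h2d.closed d.closed kd.closed)
      then have "e (h2d \<chi>) \<oplus>\<^bsub>P0\<^esub> r \<chi> = d (kd \<chi>)"
        unfolding r_eq[OF \<chi>] by (rule \<sigma>.M.add_diff)
      then show ?thesis
        using \<sigma>.M.M.a_comm[OF cl'(1) mod_Hom_closed[OF rH \<chi>]] by simp
    qed
    also have "\<xi> (d (kd \<chi>)) = \<chi> (arr K (u \<xi>))"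
      using u(2)[OF \<xi> kd.closed[OF \<chi>]] kd_apply[OF \<chi> cl(3)] by simp
    finally show "\<chi> (v (gd \<xi>) \<oplus>\<^bsub>?K2\<^esub> snd h (ed \<xi>)) = \<chi> (arr K (u \<xi>))" .
  qed
  \<comment> \<open>On the summand \<open>P\<close>, into which \<open>s\<close> embeds, the
    extension has to be \<open>h\<close>; on P1* it is the transpose of \<open>z\<close>.\<close>
  define w where "w = (\<lambda>q\<in>carrier (dsum_module P1d P). v (fst q) \<oplus>\<^bsub>?K2\<^esub> snd h (snd q))"
  have wH: "w \<in> mod_Hom A (dsum_module P1d P) ?K2"
    unfolding w_def by (rule dsum_case_hom[OF P1d(3) rmodule_axioms KD(2) v(1) h2])
  have uw: "(u, w) \<in> H_mor A Y K"
    unfolding H_mor_iff using u(1) wH com by (simp add: w_def del: gd.closed ed.closed)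
      (simp add: gd.closed ed.closed)
  have HX: "H_obj A X" using X by (simp add: P_obj_def)
  have "H_comp X (u, w) s = h"
  proof (rule H_mor_eqI[OF H_comp_mor[OF s_mor uw HX] h])
    fix y assume "y \<in> carrier (src X)"
    then have y: "y = ()" by simp
    have "fst h () = \<zero>\<^bsub>?K1\<^esub>" using h1.zero by simp
    moreover have "fst (H_comp X (u, w) s) () = u (\<zero>\<^bsub>P0d\<^esub>)" by (simp add: zero_map_def)
    ultimately show "fst (H_comp X (u, w) s) y = fst h y" using u.zero y by simp
  next
    fix p assume "p \<in> carrier (tgt X)"
    then have p: "p \<in> carrier P" by simp
    then have "snd (H_comp X (u, w) s) p = v \<zero>\<^bsub>P1d\<^esub> \<oplus>\<^bsub>?K2\<^esub> snd h p"
      by (simp add: w_def)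
    also have "\<dots> = snd h p" using h2.closed[OF p] v.zero by simp
    finally show "snd (H_comp X (u, w) s) p = snd h p" .
  qed
  then show ?thesis using uw by blast
qed

text \<open>A lift of \<open>h\<close> along \<open>t\<close> amounts to a map \<open>v\<close> into
  \<open>P\<close> whose composite with the arrow of \<open>K\<close> is \<open>ed\<close> after the
  first component of \<open>h\<close>. The coordinate \<open>f i\<close> of that composite is
  \<open>y \<mapsto> fst h y (e (f i))\<close>, so the hypotheses provide \<open>v\<close>
  coordinate by coordinate.\<close>

lemma right_factor_of_factorizations:
  assumes K: "P_obj A K" and h: "h \<in> H_mor A K Z"
    and fac: "\<And>i. i < n \<Longrightarrow> \<exists>\<chi>\<in>carrier (dual_module A (tgt K)).
      \<forall>y\<in>carrier (src K). fst h y (e (f i)) = \<chi> (arr K y)"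
  shows "\<exists>k\<in>H_mor A K Y. H_comp K t k = h"
proof -
  note KD = P_objD[OF K]
  let ?K1 = "src K" and ?K2 = "tgt K"
  have h1: "fst h \<in> mod_Hom A ?K1 P0d" and h2: "snd h \<in> mod_Hom A ?K2 P1d"
    and hc: "\<And>y. y \<in> carrier ?K1 \<Longrightarrow> snd h (arr K y) = gd (fst h y)"
    using h by (simp_all add: H_mor_iff)
  define \<beta> where "\<beta> i = (SOME \<chi>. \<chi> \<in> carrier (dual_module A ?K2) \<and>
    (\<forall>y\<in>carrier ?K1. fst h y (e (f i)) = \<chi> (arr K y)))" for i
  have "\<beta> i \<in> carrier (dual_module A ?K2) \<and> (\<forall>y\<in>carrier ?K1. fst h y (e (f i)) = \<beta> i (arr K y))"
    if "i < n" for i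
  proof -
    have "\<exists>\<chi>. \<chi> \<in> carrier (dual_module A ?K2) \<and>
        (\<forall>y\<in>carrier ?K1. fst h y (e (f i)) = \<chi> (arr K y))"
      using fac[OF that] by blast
    then show ?thesis unfolding \<beta>_def by (rule someI_ex)
  qed
  then have \<beta>H: "\<beta> i \<in> mod_Hom A ?K2 (regular_module A)"
    and \<beta>: "y \<in> carrier ?K1 \<Longrightarrow> \<beta> i (arr K y) = fst h y (e (f i))" if "i < n" for i y
    using that by (auto simp: carrier_dual)
  define v where "v = (\<lambda>y\<in>carrier ?K2. \<Oplus>\<^bsub>P\<^esub>i\<in>{..<n}. \<beta> i y \<odot>\<^bsub>P\<^esub> x i)"
  have vH: "v \<in> mod_Hom A ?K2 P"
    unfolding v_def by (rule comb_hom[OF KD(2) rmodule_axioms \<beta>H x_closed])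
  have v: "v (arr K y) = ed (fst h y)" if y: "y \<in> carrier ?K1" for y
  proof -
    have hy: "fst h y \<in> carrier P0d" by (rule mod_Hom_closed[OF h1 y])
    have "v (arr K y) = (\<Oplus>\<^bsub>P\<^esub>i\<in>{..<n}. \<beta> i (arr K y) \<odot>\<^bsub>P\<^esub> x i)"
      using mod_Hom_closed[OF KD(3) y] by (simp add: v_def)
    also have "\<dots> = (\<Oplus>\<^bsub>P\<^esub>i\<in>{..<n}. f i (ed (fst h y)) \<odot>\<^bsub>P\<^esub> x i)"
    proof (rule M.finsum_cong')
      fix i assume i: "i \<in> {..<n}"
      then have "\<beta> i (arr K y) = f i (ed (fst h y))"
        using \<beta>[OF _ y, of i] ed_apply[OF hy f_mem[of i]] by simp
      then show "\<beta> i (arr K y) \<odot>\<^bsub>P\<^esub> x i = f i (ed (fst h y)) \<odot>\<^bsub>P\<^esub> x i" by (rule arg_cong)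
    qed (use ed.closed[OF hy] in \<open>simp_all del: ed.closed\<close>)
    also have "\<dots> = ed (fst h y)" by (rule expand[OF ed.closed[OF hy]])
    finally show ?thesis .
  qed
  define w where "w = (\<lambda>z\<in>carrier ?K2. (snd h z, v z))"
  have wH: "w \<in> mod_Hom A ?K2 (dsum_module P1d P)"
    unfolding w_def by (rule dsum_pair_hom[OF KD(2) h2 vH])
  have k: "(fst h, w) \<in> H_mor A K Y"
    unfolding H_mor_iff fst_conv snd_conv mobj.simps
  proof (intro conjI ballI h1 wH)
    fix y assume y: "y \<in> carrier ?K1"
    show "w (arr K y) = (\<lambda>\<xi>\<in>carrier P0d. (gd \<xi>, ed \<xi>)) (fst h y)"
      unfolding w_def restrict_apply'[OF mod_Hom_closed[OF KD(3) y]]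
        restrict_apply'[OF mod_Hom_closed[OF h1 y]] v[OF y] hc[OF y] ..
  qed
  have HK: "H_obj A K" using K by (simp add: P_obj_def)
  have "H_comp K t (fst h, w) = h"
  proof (rule H_mor_eqI[OF H_comp_mor[OF k t_mor HK] h])
    fix y assume y: "y \<in> carrier ?K1"
    then show "fst (H_comp K t (fst h, w)) y = fst h y"
      using mod_Hom_closed[OF h1 y] by simp
  next
    fix z assume z: "z \<in> carrier ?K2"
    then show "snd (H_comp K t (fst h, w)) z = snd h z"
      using mod_Hom_closed[OF h2 z] mod_Hom_closed[OF vH z] by (simp add: w_def)
  qed
  then show ?thesis using k by blast
qed

text \<open>By assumption \<open>{\<sigma> y | h\<^sub>1\<^sup>* y \<in> im k\<^sup>*}\<close> is a submodule of the Nakayama module that does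
  not contain its socle, hence zero. So \<open>h\<^sub>1\<^sup>* y + k\<^sup>* \<chi> \<mapsto> \<sigma> y\<close> is well defined and extends to
  \<open>K\<^sub>1\<^sup>*\<close>. Lifting it to the presentation gives left inverses of \<open>h\<^sub>1\<^sup>*\<close> and \<open>h\<^sub>2\<^sup>*\<close> up to
  automorphisms.\<close>

lemma split_epi_of_no_factorization:
  assumes K: "P_obj A K" and h: "h \<in> H_mor A K Z" and i: "i < n"
    and nofac: "\<not> (\<exists>\<chi>\<in>carrier (dual_module A (tgt K)).
      \<forall>y\<in>carrier (src K). fst h y (e (f i)) = \<chi> (arr K y))"
  shows "split_epi A K Z h"
proof -
  note KD = P_objD[OF K]
  let ?K1 = "src K" and ?K2 = "tgt K"
  let ?K1d = "dual_module A ?K1" and ?K2d = "dual_module A ?K2"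
  note K1d = dual_module_fg_projective[OF KD(4,6)] rmodule_dual_module[OF KD(1)]
  note K2d = dual_module_fg_projective[OF KD(5,7)] rmodule_dual_module[OF KD(2)]
  have h1: "fst h \<in> mod_Hom A ?K1 P0d" and h2: "snd h \<in> mod_Hom A ?K2 P1d"
    and hc: "\<And>y. y \<in> carrier ?K1 \<Longrightarrow> snd h (arr K y) = gd (fst h y)"
    using h by (simp_all add: H_mor_iff)
  define h1d where "h1d = (\<lambda>y\<in>carrier P0. \<lambda>m\<in>carrier ?K1. fst h m y)"
  define h2d where "h2d = (\<lambda>z\<in>carrier P1. \<lambda>m\<in>carrier ?K2. snd h m z)"
  define kd where "kd = dual_map A ?K1 ?K2 (arr K)"
  have h1dH: "h1d \<in> mod_Hom Aop P0 ?K1d" unfolding h1d_def by (rule flip_hom[OF KD(1) P0(3) h1])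
  have h2dH: "h2d \<in> mod_Hom Aop P1 ?K2d" unfolding h2d_def by (rule flip_hom[OF KD(2) P1(3) h2])
  have kdH: "kd \<in> mod_Hom Aop ?K2d ?K1d" unfolding kd_def by (rule dual_map_hom[OF KD(1-3)])
  interpret h1: rmodule_hom A ?K1 P0d "fst h" by (rule rmodule_homI[OF KD(1) P0d(3) h1])
  interpret h2: rmodule_hom A ?K2 P1d "snd h" by (rule rmodule_homI[OF KD(2) P1d(3) h2])
  interpret k: rmodule_hom A ?K1 ?K2 "arr K" by (rule rmodule_homI[OF KD(1-3)])
  interpret h1d: rmodule_hom Aop P0 ?K1d h1d by (rule rmodule_homI[OF P0(3) K1d(3) h1dH])
  interpret h2d: rmodule_hom Aop P1 ?K2d h2d by (rule rmodule_homI[OF P1(3) K2d(3) h2dH])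
  interpret kd: rmodule_hom Aop ?K2d ?K1d kd by (rule rmodule_homI[OF K2d(3) K1d(3) kdH])
  have h1d_apply: "h1d y m = fst h m y" if "y \<in> carrier P0" "m \<in> carrier ?K1" for y m
    using that by (simp add: h1d_def)
  have h2d_apply: "h2d z m = snd h m z" if "z \<in> carrier P1" "m \<in> carrier ?K2" for z m
    using that by (simp add: h2d_def)
  have kd_apply: "kd \<chi> y = \<chi> (arr K y)" if "\<chi> \<in> carrier ?K2d" "y \<in> carrier ?K1" for \<chi> y
    unfolding kd_def by (rule dual_map_apply[OF that])
  have K1d_eqI: "\<psi> = \<psi>'" if "\<psi> \<in> carrier ?K1d" "\<psi>' \<in> carrier ?K1d"
      "\<And>y. y \<in> carrier ?K1 \<Longrightarrow> \<psi> y = \<psi>' y" for \<psi> \<psi>'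
    using that unfolding carrier_dual by (rule mod_Hom_eqI)
  have square: "h1d (g z) = kd (h2d z)" if z: "z \<in> carrier P1" for z
  proof (rule K1d_eqI)
    show "h1d (g z) \<in> carrier ?K1d" by (rule h1d.closed[OF g.closed[OF z]])
    show "kd (h2d z) \<in> carrier ?K1d" by (rule kd.closed[OF h2d.closed[OF z]])
    fix y assume y: "y \<in> carrier ?K1"
    have "h1d (g z) y = gd (fst h y) z"
      unfolding h1d_apply[OF g.closed[OF z] y] by (rule gd_apply[OF h1.closed[OF y] z, symmetric])
    also have "\<dots> = h2d z (arr K y)"
      unfolding hc[OF y, symmetric] by (rule h2d_apply[OF z k.closed[OF y], symmetric])
    also have "\<dots> = kd (h2d z) y"
      by (rule kd_apply[OF h2d.closed[OF z] y, symmetric])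
    finally show "h1d (g z) y = kd (h2d z) y" .
  qed
  define W where "W = {y \<in> carrier P0. h1d y \<in> kd ` carrier ?K2d}"
  have Wsub: "submodule W Aop P0"
    unfolding W_def
    by (rule h1d.submodule_preimage[OF kd.submodule_image[OF h2d.N.submodule_carrier]])
  have fi: "f i \<in> carrier Q" by (rule f_mem[OF i])
  have "\<sigma> ` W = {\<zero>\<^bsub>N\<^esub>}"
  proof (rule ccontr)
    assume "\<sigma> ` W \<noteq> {\<zero>\<^bsub>N\<^esub>}"
    from alpha_in_submodule[OF \<sigma>.submodule_image[OF Wsub] this fi]
    obtain y where y: "y \<in> W" "\<sigma> (e (f i)) = \<sigma> y" by blast
    obtain \<chi> where \<chi>: "\<chi> \<in> carrier ?K2d" "h1d y = kd \<chi>" using y(1) by (auto simp: W_def)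
    have yc: "y \<in> carrier P0" using y(1) by (simp add: W_def)
    have ec: "e (f i) \<in> carrier P0" by (rule e.closed[OF fi])
    \<comment> \<open>Now \<open>e (f i)\<close> and \<open>y\<close> agree up to the image of
      \<open>g\<close>, which h1* sends into the image of k*. So h1* takes \<open>e (f i)\<close>
      there too, contrary to the assumption.\<close>
    have "\<sigma> (e (f i) \<ominus>\<^bsub>P0\<^esub> y) = \<zero>\<^bsub>N\<^esub>"
      unfolding \<sigma>.diff[OF ec yc] using \<sigma>.closed[OF ec] \<sigma>.closed[OF yc] y(2)
      by (simp add: \<sigma>.N.diff_eq_zero_iff)
    then obtain z where z: "z \<in> carrier P1" "e (f i) \<ominus>\<^bsub>P0\<^esub> y = g z"
      using kernel_\<sigma>[OF \<sigma>.M.M.minus_closed[OF ec yc]] by blast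
    have "e (f i) = y \<oplus>\<^bsub>P0\<^esub> g z" using \<sigma>.M.add_diff[OF yc ec] z(2) by simp
    then have "h1d (e (f i)) = kd \<chi> \<oplus>\<^bsub>?K1d\<^esub> kd (h2d z)"
      using h1d.add[OF yc g.closed[OF z(1)]] \<chi>(2) square[OF z(1)] by simp
    also have "\<dots> = kd (\<chi> \<oplus>\<^bsub>?K2d\<^esub> h2d z)"
      by (rule kd.add[OF \<chi>(1) h2d.closed[OF z(1)], symmetric])
    finally have eq: "h1d (e (f i)) = kd (\<chi> \<oplus>\<^bsub>?K2d\<^esub> h2d z)" .
    have mem: "\<chi> \<oplus>\<^bsub>?K2d\<^esub> h2d z \<in> carrier ?K2d"
      by (rule h2d.N.M.add.m_closed[OF \<chi>(1) h2d.closed[OF z(1)]])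
    have "fst h y (e (f i)) = (\<chi> \<oplus>\<^bsub>?K2d\<^esub> h2d z) (arr K y)" if y: "y \<in> carrier ?K1" for y
      using h1d_apply[OF ec y] kd_apply[OF mem y] eq by simp
    then show False using nofac mem by blast
  qed
  then have W0: "\<sigma> y = \<zero>\<^bsub>N\<^esub>" if "y \<in> carrier P0" "\<chi> \<in> carrier ?K2d" "h1d y = kd \<chi>" for y \<chi>
    using that by (auto simp: W_def)
  \<comment> \<open>The partial map is presented on the external sum of P0 and K2*, where it is
    simply \<sigma> of the first component; \<open>W0\<close> is what makes it vanish on the kernel
    of the sum of h1* and k*.\<close>
  let ?B = "dsum_module P0 ?K2d"
  have rB: "rmodule Aop ?B" by (rule rmodule_dsum_module[OF P0(3) K2d(3)])
  let ?i = "\<lambda>b\<in>carrier ?B. h1d (fst b) \<oplus>\<^bsub>?K1d\<^esub> kd (snd b)"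
  have iH: "?i \<in> mod_Hom Aop ?B ?K1d" by (rule dsum_case_hom[OF P0(3) K2d(3) K1d(3) h1dH kdH])
  let ?b = "compose (carrier ?B) \<sigma> (\<lambda>b\<in>carrier ?B. fst b)"
  have bH: "?b \<in> mod_Hom Aop ?B N"
    by (rule mod_Hom_compose[OF dsum_fst_hom[OF P0(3) K2d(3)] \<sigma>_hom rB])
  have "?b b = \<zero>\<^bsub>N\<^esub>" if b: "b \<in> carrier ?B" "?i b = \<zero>\<^bsub>?K1d\<^esub>" for b
  proof -
    obtain y \<chi> where y: "b = (y, \<chi>)" "y \<in> carrier P0" "\<chi> \<in> carrier ?K2d" using b(1) by auto
    have "h1d y \<oplus>\<^bsub>?K1d\<^esub> kd \<chi> = \<zero>\<^bsub>?K1d\<^esub>" using b(2) y by simp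
    then have "\<ominus>\<^bsub>?K1d\<^esub> kd \<chi> = h1d y"
      by (rule h1d.N.M.minus_equality[OF _ kd.closed[OF y(3)] h1d.closed[OF y(2)]])
    then have "h1d y = kd (\<ominus>\<^bsub>?K2d\<^esub> \<chi>)" using kd.minus[OF y(3)] by simp
    then have "\<sigma> y = \<zero>\<^bsub>N\<^esub>" by (rule W0[OF y(2) h2d.N.M.a_inv_closed[OF y(3)]])
    then show ?thesis using y by (simp add: compose_eq)
  qed
  from extend[OF K1d(1) rB iH bH this] obtain c where c: "c \<in> mod_Hom Aop ?K1d N"
    and ci: "\<And>b. b \<in> carrier ?B \<Longrightarrow> c (?i b) = ?b b" by blast
  have c1: "c (h1d y) = \<sigma> y" if y: "y \<in> carrier P0" for y
    using ci[of "(y, \<zero>\<^bsub>?K2d\<^esub>)"] y h1d.closed[OF y] kd.zero h2d.N.M.zero_closed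
    by (simp add: compose_eq)
  have c2: "c (kd \<chi>) = \<zero>\<^bsub>N\<^esub>" if \<chi>: "\<chi> \<in> carrier ?K2d" for \<chi>
    using ci[of "(\<zero>\<^bsub>P0\<^esub>, \<chi>)"] \<chi> kd.closed[OF \<chi>] h1d.zero \<sigma>.zero
    by (simp add: compose_eq)
  have "c \<psi> \<in> \<sigma> ` carrier P0" if "\<psi> \<in> carrier ?K1d" for \<psi>
    unfolding \<sigma>_surj by (rule mod_Hom_closed[OF c that])
  from lift_exists[OF K1d(1,2) P0(3) N_rmodule \<sigma>_hom c this] obtain d where
    d: "d \<in> mod_Hom Aop ?K1d P0" "\<And>\<psi>. \<psi> \<in> carrier ?K1d \<Longrightarrow> \<sigma> (d \<psi>) = c \<psi>" by auto
  interpret d: rmodule_hom Aop ?K1d P0 d by (rule rmodule_homI[OF K1d(3) P0(3) d(1)])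
  have dkH: "compose (carrier ?K2d) d kd \<in> mod_Hom Aop ?K2d P0"
    by (rule mod_Hom_compose[OF kdH d(1) K2d(3)])
  have "compose (carrier ?K2d) d kd \<chi> \<in> g ` carrier P1" if \<chi>: "\<chi> \<in> carrier ?K2d" for \<chi>
    unfolding compose_eq[OF \<chi>]
    by (rule kernel_\<sigma>[OF d.closed[OF kd.closed[OF \<chi>]]]) (simp only: d(2)[OF kd.closed[OF \<chi>]] c2[OF \<chi>])
  from lift_exists[OF K2d(1,2) P1(3) P0(3) g_hom dkH this] obtain z where
    z: "z \<in> mod_Hom Aop ?K2d P1" "\<And>\<chi>. \<chi> \<in> carrier ?K2d \<Longrightarrow> g (z \<chi>) = d (kd \<chi>)"
    by (auto simp: compose_eq)
  interpret z: rmodule_hom Aop ?K2d P1 z by (rule rmodule_homI[OF K2d(3) P1(3) z(1)])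
  \<comment> \<open>Endomorphisms of the two terms of the presentation, compatible with
    \<open>g\<close> and inducing the identity on the Nakayama module. Minimality will make both
    bijective.\<close>
  define u0 where "u0 = compose (carrier P0) d h1d"
  define u1 where "u1 = compose (carrier P1) z h2d"
  have u0H: "u0 \<in> mod_Hom Aop P0 P0" unfolding u0_def by (rule mod_Hom_compose[OF h1dH d(1) P0(3)])
  have u1H: "u1 \<in> mod_Hom Aop P1 P1" unfolding u1_def by (rule mod_Hom_compose[OF h2dH z(1) P1(3)])
  have u0_eq: "u0 y = d (h1d y)" if "y \<in> carrier P0" for y using that by (simp add: u0_def compose_eq)
  have u1_eq: "u1 y = z (h2d y)" if "y \<in> carrier P1" for y using that by (simp add: u1_def compose_eq)
  have \<sigma>u0: "\<sigma> (u0 y) = \<sigma> y" if y: "y \<in> carrier P0" for y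
    unfolding u0_eq[OF y] d(2)[OF h1d.closed[OF y]] by (rule c1[OF y])
  have gu1: "g (u1 y) = u0 (g y)" if y: "y \<in> carrier P1" for y
    unfolding u1_eq[OF y] z(2)[OF h2d.closed[OF y]] u0_eq[OF g.closed[OF y]] square[OF y] ..
  have b0: "bij_betw u0 (carrier P0) (carrier P0)"
    by (rule Op.projective_cover_endo_bij[OF covers(1) N_rmodule u0H]) (use \<sigma>u0 in blast)
  have rker: "rmodule Aop (P0\<lparr>carrier := a_kernel P0 N \<sigma>\<rparr>)"
    by (rule \<sigma>.M.rmodule_submodule[OF \<sigma>.submodule_kernel])
  have b1: "bij_betw u1 (carrier P1) (carrier P1)"
  proof (rule Op.projective_cover_endo_bij[OF covers(2) rker u1H])
    fix y assume y: "y \<in> carrier P1"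
    \<comment> \<open>As \<open>u0\<close> does not change \<sigma>, the preimage of
      \<open>g y\<close> under it is again in the kernel of \<sigma>, hence of the form
      \<open>g w\<close>.\<close>
    have "g y \<in> u0 ` carrier P0" using b0 g.closed[OF y] by (simp add: bij_betw_def)
    then obtain y' where y': "y' \<in> carrier P0" "g y = u0 y'" by blast
    then have "\<sigma> y' = \<zero>\<^bsub>N\<^esub>" using \<sigma>u0[OF y'(1)] \<sigma>g[OF y] by simp
    then obtain w where w: "w \<in> carrier P1" "y' = g w" using kernel_\<sigma>[OF y'(1)] by blast
    then show "\<exists>w\<in>carrier P1. g (u1 w) = g y" using gu1 y'(2) by auto
  qed
  define w0 where "w0 = (\<lambda>y\<in>carrier P0. inv_into (carrier P0) u0 y)"
  define w1 where "w1 = (\<lambda>y\<in>carrier P1. inv_into (carrier P1) u1 y)"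
  have w0H: "w0 \<in> mod_Hom Aop P0 P0" and w1H: "w1 \<in> mod_Hom Aop P1 P1"
    using mod_iso_inverse[OF _ P0(3) P0(3), of u0] mod_iso_inverse[OF _ P1(3) P1(3), of u1]
      u0H u1H b0 b1 by (auto simp: mod_iso_def w0_def w1_def)
  have w0u0: "w0 (u0 y) = y" if y: "y \<in> carrier P0" for y
    using b0 y mod_Hom_closed[OF u0H y] by (simp add: w0_def bij_betw_def)
  have w1u1: "w1 (u1 y) = y" if y: "y \<in> carrier P1" for y
    using b1 y mod_Hom_closed[OF u1H y] by (simp add: w1_def bij_betw_def)
  have u1w1: "u1 (w1 y) = y" if y: "y \<in> carrier P1" for y
    using b1 y by (simp add: w1_def bij_betw_def f_inv_into_f)
  \<comment> \<open>Composing with the inverses of \<open>u0\<close> and \<open>u1\<close> corrects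
    \<open>d\<close> and \<open>z\<close> to true left inverses of h1* and h2*. They still commute
    with \<open>g\<close> and k* because \<open>g\<close> intertwines \<open>u1\<close> and
    \<open>u0\<close>.\<close>
  define d' where "d' = compose (carrier ?K1d) w0 d"
  define z' where "z' = compose (carrier ?K2d) w1 z"
  have d'H: "d' \<in> mod_Hom Aop ?K1d P0" unfolding d'_def by (rule mod_Hom_compose[OF d(1) w0H K1d(3)])
  have z'H: "z' \<in> mod_Hom Aop ?K2d P1" unfolding z'_def by (rule mod_Hom_compose[OF z(1) w1H K2d(3)])
  have d'h: "d' (h1d y) = y" if y: "y \<in> carrier P0" for y
    using w0u0[OF y] u0_eq[OF y] h1d.closed[OF y] by (simp add: d'_def compose_eq)
  have z'h: "z' (h2d y) = y" if y: "y \<in> carrier P1" for y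
    using w1u1[OF y] u1_eq[OF y] h2d.closed[OF y] by (simp add: z'_def compose_eq)
  have gz': "g (z' \<chi>) = d' (kd \<chi>)" if \<chi>: "\<chi> \<in> carrier ?K2d" for \<chi>
  proof -
    have zc: "z' \<chi> \<in> carrier P1" by (rule mod_Hom_closed[OF z'H \<chi>])
    have "u0 (g (z' \<chi>)) = g (u1 (z' \<chi>))" by (rule gu1[OF zc, symmetric])
    also have "u1 (z' \<chi>) = z \<chi>" using u1w1[OF z.closed[OF \<chi>]] \<chi> by (simp add: z'_def compose_eq)
    also have "g (z \<chi>) = d (kd \<chi>)" by (rule z(2)[OF \<chi>])
    finally have "w0 (u0 (g (z' \<chi>))) = w0 (d (kd \<chi>))" by simp
    then show ?thesis
      using w0u0[OF g.closed[OF zc]] kd.closed[OF \<chi>] by (simp add: d'_def compose_eq)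
  qed
  \<comment> \<open>Left inverses on the dual side transpose to right inverses, which are the
    components of the section.\<close>
  obtain r1 where r1: "r1 \<in> mod_Hom A P0d ?K1"
    "\<And>\<xi> \<psi>. \<xi> \<in> carrier P0d \<Longrightarrow> \<psi> \<in> carrier ?K1d \<Longrightarrow> \<psi> (r1 \<xi>) = \<xi> (d' \<psi>)"
    using transpose_exists[OF KD(4,6) P0(3) d'H] by blast
  obtain r2 where r2: "r2 \<in> mod_Hom A P1d ?K2"
    "\<And>\<eta> \<chi>. \<eta> \<in> carrier P1d \<Longrightarrow> \<chi> \<in> carrier ?K2d \<Longrightarrow> \<chi> (r2 \<eta>) = \<eta> (z' \<chi>)"
    using transpose_exists[OF KD(5,7) P1(3) z'H] by blast
  interpret r1: rmodule_hom A P0d ?K1 r1 by (rule rmodule_homI[OF P0d(3) KD(1) r1(1)])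
  interpret r2: rmodule_hom A P1d ?K2 r2 by (rule rmodule_homI[OF P1d(3) KD(2) r2(1)])
  have "r2 (gd \<xi>) = arr K (r1 \<xi>)" if \<xi>: "\<xi> \<in> carrier P0d" for \<xi>
  proof (rule separate_fg_projective[OF KD(5,7)])
    show "r2 (gd \<xi>) \<in> carrier ?K2" by (rule r2.closed[OF gd.closed[OF \<xi>]])
    show "arr K (r1 \<xi>) \<in> carrier ?K2" by (rule k.closed[OF r1.closed[OF \<xi>]])
    fix \<chi> assume \<chi>: "\<chi> \<in> carrier ?K2d"
    have "\<chi> (r2 (gd \<xi>)) = gd \<xi> (z' \<chi>)" by (rule r2(2)[OF gd.closed[OF \<xi>] \<chi>])
    also have "\<dots> = \<xi> (g (z' \<chi>))" by (rule gd_apply[OF \<xi> mod_Hom_closed[OF z'H \<chi>]])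
    also have "\<dots> = kd \<chi> (r1 \<xi>)" unfolding gz'[OF \<chi>] by (rule r1(2)[OF \<xi> kd.closed[OF \<chi>], symmetric])
    also have "\<dots> = \<chi> (arr K (r1 \<xi>))" by (rule kd_apply[OF \<chi> r1.closed[OF \<xi>]])
    finally show "\<chi> (r2 (gd \<xi>)) = \<chi> (arr K (r1 \<xi>))" .
  qed
  then have rM: "(r1, r2) \<in> H_mor A Z K"
    unfolding H_mor_iff using r1(1) r2(1) by simp
  have h1r1: "fst h (r1 \<xi>) = \<xi>" if \<xi>: "\<xi> \<in> carrier P0d" for \<xi>
  proof (rule mod_Hom_eqI)
    show "fst h (r1 \<xi>) \<in> mod_Hom Aop P0 (regular_module Aop)" "\<xi> \<in> mod_Hom Aop P0 (regular_module Aop)"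
      using h1.closed[OF r1.closed[OF \<xi>]] \<xi> by (simp_all only: carrier_dual)
    fix y assume y: "y \<in> carrier P0"
    have "fst h (r1 \<xi>) y = h1d y (r1 \<xi>)" by (rule h1d_apply[OF y r1.closed[OF \<xi>], symmetric])
    also have "\<dots> = \<xi> (d' (h1d y))" by (rule r1(2)[OF \<xi> h1d.closed[OF y]])
    finally show "fst h (r1 \<xi>) y = \<xi> y" unfolding d'h[OF y] .
  qed
  have h2r2: "snd h (r2 \<eta>) = \<eta>" if \<eta>: "\<eta> \<in> carrier P1d" for \<eta>
  proof (rule mod_Hom_eqI)
    show "snd h (r2 \<eta>) \<in> mod_Hom Aop P1 (regular_module Aop)" "\<eta> \<in> mod_Hom Aop P1 (regular_module Aop)"
      using h2.closed[OF r2.closed[OF \<eta>]] \<eta> by (simp_all only: carrier_dual)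
    fix y assume y: "y \<in> carrier P1"
    have "snd h (r2 \<eta>) y = h2d y (r2 \<eta>)" by (rule h2d_apply[OF y r2.closed[OF \<eta>], symmetric])
    also have "\<dots> = \<eta> (z' (h2d y))" by (rule r2(2)[OF \<eta> h2d.closed[OF y]])
    finally show "snd h (r2 \<eta>) y = \<eta> y" unfolding z'h[OF y] .
  qed
  have HZ: "H_obj A Z" using Z by (simp add: P_obj_def)
  have "H_comp Z h (r1, r2) = H_id Z"
    by (rule H_mor_eqI[OF H_comp_mor[OF rM h HZ] H_id_mor[OF HZ]]) (simp_all add: h1r1 h2r2)
  then show ?thesis using rM by (auto simp: split_epi_def)
qed

lemma almost_split: "almost_split_sequence A X Y Z s t"
  unfolding almost_split_sequence_def left_almost_split_def right_almost_split_def
proof (intro conjI allI impI X Y Z exact s_mor t_mor not_split_mono not_split_epi)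
  fix K :: "('a, 'a fgu, 'a fgu) mobj" and h
  assume "P_obj A K \<and> h \<in> H_mor A X K \<and> \<not> split_mono A X K h"
  then show "\<exists>k\<in>H_mor A Y K. H_comp X k s = h" by (intro left_factor) simp_all
next
  fix K :: "('a, 'a fgu, 'a fgu) mobj" and h
  assume *: "P_obj A K \<and> h \<in> H_mor A K Z \<and> \<not> split_epi A K Z h"
  show "\<exists>k\<in>H_mor A K Y. H_comp K t k = h"
  proof (rule right_factor_of_factorizations)
    show "P_obj A K" "h \<in> H_mor A K Z" using * by simp_all
    \<comment> \<open>Failure at a single coordinate would already make \<open>h\<close> a split
      epimorphism.\<close>
    fix i assume "i < n"
    then show "\<exists>\<chi>\<in>carrier (dual_module A (tgt K)). \<forall>y\<in>carrier (src K). fst h y (e (f i)) = \<chi> (arr K y)"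
      using split_epi_of_no_factorization[of K h i] * by blast
  qed
qed

end

section \<open>Uniqueness of almost split sequences\<close>

lemma cokernel_factor:
  assumes Y: "rmodule A Y" and Z: "rmodule A Z" and W: "rmodule A W"
    and ex: "short_exact_mod A X Y Z f g" and h: "h \<in> mod_Hom A Y W"
    and hf: "\<And>x. x \<in> carrier X \<Longrightarrow> h (f x) = \<zero>\<^bsub>W\<^esub>"
  shows "\<exists>k\<in>mod_Hom A Z W. \<forall>y\<in>carrier Y. k (g y) = h y"
proof -
  have gH: "g \<in> mod_Hom A Y Z" and im: "f ` carrier X = a_kernel Y Z g" and surj: "g ` carrier Y = carrier Z"
    using ex by (simp_all add: short_exact_mod_def)
  interpret g: rmodule_hom A Y Z g by (rule rmodule_homI[OF Y Z gH])
  interpret h: rmodule_hom A Y W h by (rule rmodule_homI[OF Y W h])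
  have wd: "h y = h y'" if y: "y \<in> carrier Y" "y' \<in> carrier Y" "g y = g y'" for y y'
  proof -
    have "y \<ominus>\<^bsub>Y\<^esub> y' \<in> f ` carrier X"
      unfolding im mem_a_kernel using y by (simp add: g.diff g.N.diff_eq_zero_iff)
    then have "h (y \<ominus>\<^bsub>Y\<^esub> y') = \<zero>\<^bsub>W\<^esub>" using hf by auto
    then show ?thesis using y by (simp add: h.diff h.N.diff_eq_zero_iff)
  qed
  define q where "q = inv_into (carrier Y) g"
  have q: "q z \<in> carrier Y" "g (q z) = z" if "z \<in> carrier Z" for z
    unfolding q_def using that[folded surj] by (rule inv_into_into f_inv_into_f)+
  have hq: "h (q (g y)) = h y" if "y \<in> carrier Y" for y
    using that q[OF g.closed[OF that]] by (intro wd)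
  have "(\<lambda>z\<in>carrier Z. h (q z)) \<in> mod_Hom A Z W"
  proof (rule mod_HomI[OF Z])
    fix y z assume "y \<in> carrier Z" "z \<in> carrier Z"
    then show "h (q (y \<oplus>\<^bsub>Z\<^esub> z)) = h (q y) \<oplus>\<^bsub>W\<^esub> h (q z)"
      using hq[of "q y \<oplus>\<^bsub>Y\<^esub> q z"] by (simp add: q g.add h.add)
  next
    fix a y assume "a \<in> carrier A" "y \<in> carrier Z"
    then show "h (q (a \<odot>\<^bsub>Z\<^esub> y)) = a \<odot>\<^bsub>W\<^esub> h (q y)"
      using hq[of "a \<odot>\<^bsub>Y\<^esub> q y"] by (simp add: q g.smult h.smult)
  qed (use q in auto)
  moreover have "\<forall>y\<in>carrier Y. (\<lambda>z\<in>carrier Z. h (q z)) (g y) = h y" using hq by simp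
  ultimately show ?thesis by (intro bexI[of _ "\<lambda>z\<in>carrier Z. h (q z)"])
qed

lemma kernel_factor:
  assumes X: "rmodule A X" and Y: "rmodule A Y" and W: "rmodule A W"
    and ex: "short_exact_mod A X Y Z f g" and h: "h \<in> mod_Hom A W Y"
    and gh: "\<And>w. w \<in> carrier W \<Longrightarrow> g (h w) = \<zero>\<^bsub>Z\<^esub>"
  shows "\<exists>k\<in>mod_Hom A W X. \<forall>w\<in>carrier W. f (k w) = h w"
proof -
  have fH: "f \<in> mod_Hom A X Y" and im: "f ` carrier X = a_kernel Y Z g" and inj: "inj_on f (carrier X)"
    using ex by (simp_all add: short_exact_mod_def)
  interpret f: rmodule_hom A X Y f by (rule rmodule_homI[OF X Y fH])
  interpret h: rmodule_hom A W Y h by (rule rmodule_homI[OF W Y h])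
  define q where "q = inv_into (carrier X) f"
  have "h w \<in> f ` carrier X" if "w \<in> carrier W" for w
    unfolding im mem_a_kernel using that gh by simp
  then have q: "q (h w) \<in> carrier X" "f (q (h w)) = h w" if "w \<in> carrier W" for w
    unfolding q_def using that by (auto intro: inv_into_into f_inv_into_f)
  have qf: "q (f x) = x" if "x \<in> carrier X" for x
    unfolding q_def using inj that by (rule inv_into_f_f)
  have "(\<lambda>w\<in>carrier W. q (h w)) \<in> mod_Hom A W X"
  proof (rule mod_HomI[OF W])
    fix y z assume "y \<in> carrier W" "z \<in> carrier W"
    then show "q (h (y \<oplus>\<^bsub>W\<^esub> z)) = q (h y) \<oplus>\<^bsub>X\<^esub> q (h z)"
      using qf[of "q (h y) \<oplus>\<^bsub>X\<^esub> q (h z)"] by (simp add: q f.add h.add)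
  next
    fix a y assume "a \<in> carrier A" "y \<in> carrier W"
    then show "q (h (a \<odot>\<^bsub>W\<^esub> y)) = a \<odot>\<^bsub>X\<^esub> q (h y)"
      using qf[of "a \<odot>\<^bsub>X\<^esub> q (h y)"] by (simp add: q f.smult h.smult)
  qed (use q in auto)
  moreover have "\<forall>w\<in>carrier W. f ((\<lambda>w\<in>carrier W. q (h w)) w) = h w" using q by simp
  ultimately show ?thesis by (intro bexI[of _ "\<lambda>w\<in>carrier W. q (h w)"])
qed

text \<open>The five lemma for the identity on the left, \<open>f\<close> in the middle and
  \<open>z\<close> on the right, chased on elements.\<close>

lemma short_exact_endo_bij:
  assumes X: "rmodule A X" and Y: "rmodule A Y" and Z: "rmodule A Z"
    and ex: "short_exact_mod A X Y Z s t" and f: "f \<in> mod_Hom A Y Y"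
    and fs: "\<And>x. x \<in> carrier X \<Longrightarrow> f (s x) = s x"
    and z: "z \<in> mod_Hom A Z Z" "\<And>y. y \<in> carrier Y \<Longrightarrow> z (t y) = t (f y)"
      "bij_betw z (carrier Z) (carrier Z)"
  shows "bij_betw f (carrier Y) (carrier Y)"
proof -
  have sH: "s \<in> mod_Hom A X Y" and tH: "t \<in> mod_Hom A Y Z" and im: "s ` carrier X = a_kernel Y Z t"
    and surj: "t ` carrier Y = carrier Z"
    using ex by (simp_all add: short_exact_mod_def)
  interpret s: rmodule_hom A X Y s by (rule rmodule_homI[OF X Y sH])
  interpret t: rmodule_hom A Y Z t by (rule rmodule_homI[OF Y Z tH])
  interpret f: rmodule_hom A Y Y f by (rule rmodule_homI[OF Y Y f])
  interpret z: rmodule_hom A Z Z z by (rule rmodule_homI[OF Z Z z(1)])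
  have ker: "\<exists>x\<in>carrier X. y = s x" if "y \<in> carrier Y" "t y = \<zero>\<^bsub>Z\<^esub>" for y
  proof -
    have "y \<in> s ` carrier X" unfolding im mem_a_kernel using that by simp
    then show ?thesis by blast
  qed
  have "inj_on f (carrier Y)"
    unfolding f.inj_iff
  proof (intro ballI impI)
    fix y assume y: "y \<in> carrier Y" "f y = \<zero>\<^bsub>Y\<^esub>"
    then have "z (t y) = \<zero>\<^bsub>Z\<^esub>" by (simp add: z(2))
    moreover have "inj_on z (carrier Z)" using z(3) by (simp add: bij_betw_def)
    ultimately have "t y = \<zero>\<^bsub>Z\<^esub>" unfolding z.inj_iff using y by simp
    then obtain x where "x \<in> carrier X" "y = s x" using ker y(1) by blast
    then show "y = \<zero>\<^bsub>Y\<^esub>" using fs y(2) by simp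
  qed
  moreover have "f ` carrier Y = carrier Y"
  proof
    show "carrier Y \<subseteq> f ` carrier Y"
    proof
      fix y assume y: "y \<in> carrier Y"
      have "t y \<in> z ` t ` carrier Y" using z(3) y surj by (simp add: bij_betw_def)
      then obtain y' where y': "y' \<in> carrier Y" "t y = t (f y')" using z(2) by auto
      then have "t (y \<ominus>\<^bsub>Y\<^esub> f y') = \<zero>\<^bsub>Z\<^esub>" using y by (simp add: t.diff t.N.diff_eq_zero_iff)
      then obtain x where x: "x \<in> carrier X" "y \<ominus>\<^bsub>Y\<^esub> f y' = s x"
        using ker[of "y \<ominus>\<^bsub>Y\<^esub> f y'"] y y'(1) by auto
      have "f (y' \<oplus>\<^bsub>Y\<^esub> s x) = f y' \<oplus>\<^bsub>Y\<^esub> (y \<ominus>\<^bsub>Y\<^esub> f y')" using x y'(1) fs by (simp add: f.add)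
      also have "\<dots> = y" by (rule s.N.add_diff[OF f.closed[OF y'(1)] y])
      finally show "y \<in> f ` carrier Y" using x(1) y'(1) by (metis imageI s.N.M.add.m_closed s.closed)
    qed
  qed auto
  ultimately show ?thesis by (simp add: bij_betw_def)
qed

text \<open>The bijection \<open>v\<close> matches the images of \<open>s'\<close> and
  \<open>s\<close>, that is, the kernels of \<open>t'\<close> and \<open>t\<close>; hence the map
  induced on the cokernels is bijective.\<close>

lemma short_exact_quotient_bij:
  assumes Y: "rmodule A Y" and Y': "rmodule A Y'" and Z: "rmodule A Z" and Z': "rmodule A Z'"
    and ex: "short_exact_mod A X Y Z s t" and ex': "short_exact_mod A X Y' Z' s' t'"
    and v: "bij_betw v (carrier Y') (carrier Y)" "\<And>x. x \<in> carrier X \<Longrightarrow> v (s' x) = s x"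
    and w: "w \<in> mod_Hom A Z' Z" "\<And>y. y \<in> carrier Y' \<Longrightarrow> w (t' y) = t (v y)"
  shows "bij_betw w (carrier Z') (carrier Z)"
proof -
  have im: "s ` carrier X = a_kernel Y Z t" and surj: "t ` carrier Y = carrier Z"
    and s'H: "s' \<in> mod_Hom A X Y'" and t'H: "t' \<in> mod_Hom A Y' Z'"
    and im': "s' ` carrier X = a_kernel Y' Z' t'" and surj': "t' ` carrier Y' = carrier Z'"
    using ex ex' by (simp_all add: short_exact_mod_def)
  interpret w: rmodule_hom A Z' Z w by (rule rmodule_homI[OF Z' Z w(1)])
  have "inj_on w (carrier Z')"
    unfolding w.inj_iff
  proof (intro ballI impI)
    fix c assume c: "c \<in> carrier Z'" "w c = \<zero>\<^bsub>Z\<^esub>"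
    then obtain y where y: "y \<in> carrier Y'" "c = t' y" using surj' by blast
    have "v y \<in> s ` carrier X"
      unfolding im mem_a_kernel using c(2) y w(2) v(1) by (auto simp: bij_betw_def)
    then obtain x where x: "x \<in> carrier X" "v y = v (s' x)" using v(2) by auto
    then have "y = s' x"
      using v(1) y(1) mod_Hom_closed[OF s'H x(1)] by (simp add: bij_betw_def inj_on_def)
    then have "y \<in> a_kernel Y' Z' t'" using x(1) im' by blast
    then show "c = \<zero>\<^bsub>Z'\<^esub>" using y(2) by (simp add: mem_a_kernel)
  qed
  moreover have "w ` carrier Z' = carrier Z"
  proof -
    have "w ` carrier Z' = (\<lambda>y. w (t' y)) ` carrier Y'" by (simp add: image_image flip: surj')
    also have "\<dots> = t ` v ` carrier Y'" unfolding image_image by (rule image_cong[OF refl w(2)])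
    also have "\<dots> = carrier Z" using v(1) surj by (simp add: bij_betw_def)
    finally show ?thesis .
  qed
  ultimately show ?thesis by (simp add: bij_betw_def)
qed

text \<open>The factorization exists in each component, and the two induced maps commute with the
  arrows because \<open>fst t\<close> is onto.\<close>

lemma H_cokernel_factor:
  assumes G: "H_obj A G" and K: "H_obj A K" and L: "H_obj A L"
    and ex: "short_exact_H A F G K s t" and h: "h \<in> H_mor A G L"
    and z: "\<And>x. x \<in> carrier (src F) \<Longrightarrow> fst h (fst s x) = \<zero>\<^bsub>src L\<^esub>"
      "\<And>x. x \<in> carrier (tgt F) \<Longrightarrow> snd h (snd s x) = \<zero>\<^bsub>tgt L\<^esub>"
  shows "\<exists>k\<in>H_mor A K L. H_comp G k t = h"
proof -
  note GD = H_objD[OF G] and KD = H_objD[OF K] and LD = H_objD[OF L]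
  have t: "t \<in> H_mor A G K" and e1: "short_exact_mod A (src F) (src G) (src K) (fst s) (fst t)"
    and e2: "short_exact_mod A (tgt F) (tgt G) (tgt K) (snd s) (snd t)"
    using ex by (simp_all add: short_exact_H_def)
  have hH: "fst h \<in> mod_Hom A (src G) (src L)" "snd h \<in> mod_Hom A (tgt G) (tgt L)"
    using h by (simp_all add: H_mor_iff)
  obtain k1 where k1: "k1 \<in> mod_Hom A (src K) (src L)" "\<And>y. y \<in> carrier (src G) \<Longrightarrow> k1 (fst t y) = fst h y"
    using cokernel_factor[OF GD(1) KD(1) LD(1) e1 hH(1) z(1)] by blast
  obtain k2 where k2: "k2 \<in> mod_Hom A (tgt K) (tgt L)" "\<And>y. y \<in> carrier (tgt G) \<Longrightarrow> k2 (snd t y) = snd h y"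
    using cokernel_factor[OF GD(2) KD(2) LD(2) e2 hH(2) z(2)] by blast
  have "k2 (arr K c) = arr L (k1 c)" if c: "c \<in> carrier (src K)" for c
  proof -
    have "c \<in> fst t ` carrier (src G)" using e1 c by (simp add: short_exact_mod_def)
    then obtain y where y: "y \<in> carrier (src G)" "c = fst t y" by blast
    have "k2 (arr K c) = k2 (snd t (arr G y))" using t y by (simp add: H_mor_iff)
    also have "\<dots> = snd h (arr G y)" by (rule k2(2)[OF mod_Hom_closed[OF GD(3) y(1)]])
    also have "\<dots> = arr L (k1 c)" using h y k1(2) by (simp add: H_mor_iff)
    finally show ?thesis .
  qed
  then have k: "(k1, k2) \<in> H_mor A K L" using k1(1) k2(1) by (simp add: H_mor_iff)
  have "H_comp G (k1, k2) t = h"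
    by (rule H_mor_eqI[OF H_comp_mor[OF t k G] h]) (simp_all add: k1(2) k2(2))
  then show ?thesis using k by blast
qed

text \<open>The factorization exists in each component, and the two maps commute with the arrows
  because this can be checked after the injective map \<open>snd s\<close>.\<close>

lemma H_kernel_factor:
  assumes F: "H_obj A F" and G: "H_obj A G" and L: "H_obj A L"
    and ex: "short_exact_H A F G K s t" and h: "h \<in> H_mor A L G"
    and z: "\<And>x. x \<in> carrier (src L) \<Longrightarrow> fst t (fst h x) = \<zero>\<^bsub>src K\<^esub>"
      "\<And>x. x \<in> carrier (tgt L) \<Longrightarrow> snd t (snd h x) = \<zero>\<^bsub>tgt K\<^esub>"
  shows "\<exists>q\<in>H_mor A L F. H_comp L s q = h"
proof -
  note FD = H_objD[OF F] and GD = H_objD[OF G] and LD = H_objD[OF L]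
  have s: "s \<in> H_mor A F G" and e1: "short_exact_mod A (src F) (src G) (src K) (fst s) (fst t)"
    and e2: "short_exact_mod A (tgt F) (tgt G) (tgt K) (snd s) (snd t)"
    using ex by (simp_all add: short_exact_H_def)
  have hH: "fst h \<in> mod_Hom A (src L) (src G)" "snd h \<in> mod_Hom A (tgt L) (tgt G)"
    using h by (simp_all add: H_mor_iff)
  obtain k1 where k1: "k1 \<in> mod_Hom A (src L) (src F)" "\<And>y. y \<in> carrier (src L) \<Longrightarrow> fst s (k1 y) = fst h y"
    using kernel_factor[OF FD(1) GD(1) LD(1) e1 hH(1) z(1)] by blast
  obtain k2 where k2: "k2 \<in> mod_Hom A (tgt L) (tgt F)" "\<And>y. y \<in> carrier (tgt L) \<Longrightarrow> snd s (k2 y) = snd h y"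
    using kernel_factor[OF FD(2) GD(2) LD(2) e2 hH(2) z(2)] by blast
  have inj: "inj_on (snd s) (carrier (tgt F))" using e2 by (simp add: short_exact_mod_def)
  have "k2 (arr L y) = arr F (k1 y)" if y: "y \<in> carrier (src L)" for y
  proof (rule inj_onD[OF inj])
    note ay = mod_Hom_closed[OF LD(3) y] and ky = mod_Hom_closed[OF k1(1) y]
    have "snd s (k2 (arr L y)) = arr G (fst h y)"
      using k2(2)[OF ay] h y by (simp add: H_mor_iff)
    also have "\<dots> = snd s (arr F (k1 y))" using k1(2)[OF y] s ky by (simp add: H_mor_iff)
    finally show "snd s (k2 (arr L y)) = snd s (arr F (k1 y))" .
    show "k2 (arr L y) \<in> carrier (tgt F)" by (rule mod_Hom_closed[OF k2(1) ay])
    show "arr F (k1 y) \<in> carrier (tgt F)" by (rule mod_Hom_closed[OF FD(3) ky])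
  qed
  then have k: "(k1, k2) \<in> H_mor A L F" using k1(1) k2(1) by (simp add: H_mor_iff)
  have "H_comp L s (k1, k2) = h"
    by (rule H_mor_eqI[OF H_comp_mor[OF k s L] h]) (simp_all add: k1(2) k2(2))
  then show ?thesis using k by blast
qed

lemma H_diff:
  assumes F: "H_obj A F" and G: "H_obj A G" and h: "h \<in> H_mor A F G" and h': "h' \<in> H_mor A F G"
  shows "\<exists>d\<in>H_mor A F G. (\<forall>x\<in>carrier (src F). fst d x = fst h x \<ominus>\<^bsub>src G\<^esub> fst h' x) \<and>
    (\<forall>y\<in>carrier (tgt F). snd d y = snd h y \<ominus>\<^bsub>tgt G\<^esub> snd h' y)"
proof -
  note FD = H_objD[OF F] and GD = H_objD[OF G]
  have H: "fst h \<in> mod_Hom A (src F) (src G)" "snd h \<in> mod_Hom A (tgt F) (tgt G)"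
    "\<And>x. x \<in> carrier (src F) \<Longrightarrow> snd h (arr F x) = arr G (fst h x)"
    using h by (simp_all add: H_mor_iff)
  have H': "fst h' \<in> mod_Hom A (src F) (src G)" "snd h' \<in> mod_Hom A (tgt F) (tgt G)"
    "\<And>x. x \<in> carrier (src F) \<Longrightarrow> snd h' (arr F x) = arr G (fst h' x)"
    using h' by (simp_all add: H_mor_iff)
  interpret G: rmodule_hom A "src G" "tgt G" "arr G" by (rule rmodule_homI[OF GD])
  let ?d = "(\<lambda>x\<in>carrier (src F). fst h x \<ominus>\<^bsub>src G\<^esub> fst h' x,
    \<lambda>y\<in>carrier (tgt F). snd h y \<ominus>\<^bsub>tgt G\<^esub> snd h' y)"
  have "?d \<in> H_mor A F G"
    unfolding H_mor_iff fst_conv snd_conv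
  proof (intro conjI ballI)
    show "(\<lambda>x\<in>carrier (src F). fst h x \<ominus>\<^bsub>src G\<^esub> fst h' x) \<in> mod_Hom A (src F) (src G)"
      by (rule mod_Hom_diff[OF FD(1) GD(1) H(1) H'(1)])
    show "(\<lambda>y\<in>carrier (tgt F). snd h y \<ominus>\<^bsub>tgt G\<^esub> snd h' y) \<in> mod_Hom A (tgt F) (tgt G)"
      by (rule mod_Hom_diff[OF FD(2) GD(2) H(2) H'(2)])
    fix x assume x: "x \<in> carrier (src F)"
    show "(\<lambda>y\<in>carrier (tgt F). snd h y \<ominus>\<^bsub>tgt G\<^esub> snd h' y) (arr F x)
        = arr G ((\<lambda>x\<in>carrier (src F). fst h x \<ominus>\<^bsub>src G\<^esub> fst h' x) x)"
      using x mod_Hom_closed[OF FD(3) x] mod_Hom_closed[OF H(1) x] mod_Hom_closed[OF H'(1) x]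
      by (simp add: H(3) H'(3) G.diff)
  qed
  then show ?thesis by (intro bexI[of _ ?d]) simp_all
qed

lemma short_exact_H_zero:
  assumes "short_exact_H A F G K s t"
  shows "x \<in> carrier (src F) \<Longrightarrow> fst t (fst s x) = \<zero>\<^bsub>src K\<^esub>"
    and "y \<in> carrier (tgt F) \<Longrightarrow> snd t (snd s y) = \<zero>\<^bsub>tgt K\<^esub>"
proof -
  have "fst s ` carrier (src F) = a_kernel (src G) (src K) (fst t)"
    "snd s ` carrier (tgt F) = a_kernel (tgt G) (tgt K) (snd t)"
    using assms by (simp_all add: short_exact_H_def short_exact_mod_def)
  then show "x \<in> carrier (src F) \<Longrightarrow> fst t (fst s x) = \<zero>\<^bsub>src K\<^esub>"
    and "y \<in> carrier (tgt F) \<Longrightarrow> snd t (snd s y) = \<zero>\<^bsub>tgt K\<^esub>"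
    by (metis imageI mem_a_kernel)+
qed

text \<open>Having the left inverse \<open>z\<close>, the surjection \<open>y\<close> is bijective,
  and \<open>z\<close> is its inverse.\<close>

lemma bij_betw_of_right_inverse:
  assumes "y ` S = S" "\<And>x. x \<in> S \<Longrightarrow> z (y x) = x"
  shows "bij_betw z S S"
proof -
  have "bij_betw y S S"
    unfolding bij_betw_def using assms by (intro conjI inj_on_inverseI[of _ z])
  then have "bij_betw (inv_into S y) S S" by (rule bij_betw_inv_into)
  moreover have "inv_into S y a = z a" if "a \<in> S" for a
  proof -
    obtain b where b: "b \<in> S" "a = y b" using assms(1) \<open>a \<in> S\<close> by blast
    then show ?thesis using \<open>bij_betw y S S\<close> assms(2) by (simp add: bij_betw_def)
  qed
  ultimately show ?thesis by (simp cong: bij_betw_cong)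
qed

lemma bij_betw_of_comp:
  assumes "bij_betw (\<lambda>x. v' (v x)) S S" "bij_betw (\<lambda>y. v (v' y)) T T" "v ` S \<subseteq> T" "v' ` T \<subseteq> S"
  shows "bij_betw v S T"
  unfolding bij_betw_def
proof
  show "inj_on v S" using assms(1) by (auto simp: bij_betw_def inj_on_def)
  have "T = (\<lambda>y. v (v' y)) ` T" using assms(2) by (simp add: bij_betw_def)
  then show "v ` S = T" using assms(3,4) by blast
qed

context artin_alg
begin

text \<open>The components of a section are injective endomorphisms of finitely generated modules,
  hence onto by the chain condition.\<close>

lemma split_epi_endo_bij:
  assumes K: "P_obj A K" and z: "z \<in> H_mor A K K" "split_epi A K K z"
  shows "bij_betw (fst z) (carrier (src K)) (carrier (src K))"
    "bij_betw (snd z) (carrier (tgt K)) (carrier (tgt K))"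
proof -
  note KD = P_objD[OF K]
  obtain y where y: "y \<in> H_mor A K K" "H_comp K z y = H_id K" using z(2) by (auto simp: split_epi_def)
  have yH: "fst y \<in> mod_Hom A (src K) (src K)" "snd y \<in> mod_Hom A (tgt K) (tgt K)"
    using y(1) by (simp_all add: H_mor_iff)
  have zy: "fst z (fst y x) = x" if "x \<in> carrier (src K)" for x
    using H_comp_apply(1)[of x K z y] H_id_apply(1)[of x K] that y(2) by simp
  have zy2: "snd z (snd y x) = x" if "x \<in> carrier (tgt K)" for x
    using H_comp_apply(2)[of x K z y] H_id_apply(2)[of x K] that y(2) by simp
  have "fst y ` carrier (src K) = carrier (src K)"
    by (rule injective_endo_surj[OF KD(4) yH(1)]) (rule inj_on_inverseI[of _ "fst z"], rule zy)
  then show "bij_betw (fst z) (carrier (src K)) (carrier (src K))"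
    using zy by (rule bij_betw_of_right_inverse)
  have "snd y ` carrier (tgt K) = carrier (tgt K)"
    by (rule injective_endo_surj[OF KD(5) yH(2)]) (rule inj_on_inverseI[of _ "snd z"], rule zy2)
  then show "bij_betw (snd z) (carrier (tgt K)) (carrier (tgt K))"
    using zy2 by (rule bij_betw_of_right_inverse)
qed

text \<open>An endomorphism \<open>f\<close> of the middle term with \<open>f s = s\<close> induces a split epimorphism \<open>z\<close> of
  the right term: otherwise \<open>z = t r\<close>, so \<open>f - r t = s q\<close> and \<open>q s = 1\<close>.\<close>

lemma almost_split_endo_bij:
  fixes F :: "('a, 'x, 'y) mobj" and G :: "('a, 'x1, 'y1) mobj" and K :: "('a, 'x2, 'y2) mobj"
  assumes as: "almost_split_sequence A F G K s t"
    and f: "f \<in> H_mor A G G" "H_comp F f s = s"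
  shows "bij_betw (fst f) (carrier (src G)) (carrier (src G))"
    "bij_betw (snd f) (carrier (tgt G)) (carrier (tgt G))"
proof -
  have PF: "P_obj A F" and PG: "P_obj A G" and PK: "P_obj A K" and ex: "short_exact_H A F G K s t"
    and las: "left_almost_split A F G s" and ras: "right_almost_split A G K t"
    using as by (simp_all add: almost_split_sequence_def)
  have F: "H_obj A F" and G: "H_obj A G" and K: "H_obj A K" using PF PG PK by (simp_all add: P_obj_def)
  note FD = H_objD[OF F] and GD = H_objD[OF G] and KD = H_objD[OF K]
  have s: "s \<in> H_mor A F G" and t: "t \<in> H_mor A G K"
    and e1: "short_exact_mod A (src F) (src G) (src K) (fst s) (fst t)"
    and e2: "short_exact_mod A (tgt F) (tgt G) (tgt K) (snd s) (snd t)"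
    using ex by (simp_all add: short_exact_H_def)
  note sc = H_mor_closed[OF s] and tc = H_mor_closed[OF t] and fc = H_mor_closed[OF f(1)]
  have fs: "fst f (fst s x) = fst s x" if "x \<in> carrier (src F)" for x
    using H_comp_apply(1)[of x F f s] that f(2) by simp
  have fs2: "snd f (snd s x) = snd s x" if "x \<in> carrier (tgt F)" for x
    using H_comp_apply(2)[of x F f s] that f(2) by simp
  have "\<exists>z\<in>H_mor A K K. H_comp G z t = H_comp G t f"
    by (rule H_cokernel_factor[OF G K K ex H_comp_mor[OF f(1) t G]])
      (simp_all add: sc fs fs2 short_exact_H_zero[OF ex])
  then obtain z where z: "z \<in> H_mor A K K" "H_comp G z t = H_comp G t f" by blast
  have zt: "fst z (fst t y) = fst t (fst f y)" if "y \<in> carrier (src G)" for y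
    using H_comp_apply(1)[of y G z t] H_comp_apply(1)[of y G t f] that z(2) by simp
  have zt2: "snd z (snd t y) = snd t (snd f y)" if "y \<in> carrier (tgt G)" for y
    using H_comp_apply(2)[of y G z t] H_comp_apply(2)[of y G t f] that z(2) by simp
  have "split_epi A K K z"
  proof (rule ccontr)
    assume "\<not> split_epi A K K z"
    then obtain r where r: "r \<in> H_mor A K G" "H_comp K t r = z"
      using right_almost_split_factor[OF ras PG PK PK z(1)] by blast
    note rc = H_mor_closed[OF r(1)]
    obtain d where d: "d \<in> H_mor A G G"
      "\<And>y. y \<in> carrier (src G) \<Longrightarrow> fst d y = fst f y \<ominus>\<^bsub>src G\<^esub> fst (H_comp G r t) y"
      "\<And>y. y \<in> carrier (tgt G) \<Longrightarrow> snd d y = snd f y \<ominus>\<^bsub>tgt G\<^esub> snd (H_comp G r t) y"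
      using H_diff[OF G G f(1) H_comp_mor[OF t r(1) G]] by blast
    interpret t1: rmodule_hom A "src G" "src K" "fst t"
      by (rule rmodule_homI[OF GD(1) KD(1)]) (use t in \<open>simp add: H_mor_iff\<close>)
    interpret t2: rmodule_hom A "tgt G" "tgt K" "snd t"
      by (rule rmodule_homI[OF GD(2) KD(2)]) (use t in \<open>simp add: H_mor_iff\<close>)
    interpret r1: rmodule_hom A "src K" "src G" "fst r"
      by (rule rmodule_homI[OF KD(1) GD(1)]) (use r in \<open>simp add: H_mor_iff\<close>)
    interpret r2: rmodule_hom A "tgt K" "tgt G" "snd r"
      by (rule rmodule_homI[OF KD(2) GD(2)]) (use r in \<open>simp add: H_mor_iff\<close>)
    have tr: "fst t (fst r c) = fst z c" if "c \<in> carrier (src K)" for c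
      using H_comp_apply(1)[of c K t r] that r(2) by simp
    have tr2: "snd t (snd r c) = snd z c" if "c \<in> carrier (tgt K)" for c
      using H_comp_apply(2)[of c K t r] that r(2) by simp
    have "\<exists>q\<in>H_mor A G F. H_comp G s q = d"
    proof (rule H_kernel_factor[OF F G G ex d(1)])
      fix y assume y: "y \<in> carrier (src G)"
      then show "fst t (fst d y) = \<zero>\<^bsub>src K\<^esub>"
        using fc tc by (simp add: d(2) t1.diff tr zt t1.N.diff_eq_zero_iff)
    next
      fix y assume y: "y \<in> carrier (tgt G)"
      then show "snd t (snd d y) = \<zero>\<^bsub>tgt K\<^esub>"
        using fc tc by (simp add: d(3) t2.diff tr2 zt2 t2.N.diff_eq_zero_iff)
    qed
    then obtain q where q: "q \<in> H_mor A G F" "H_comp G s q = d" by blast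
    note qc = H_mor_closed[OF q(1)]
    have "H_comp F q s = H_id F"
    proof (rule H_mor_eqI[OF H_comp_mor[OF s q(1) F] H_id_mor[OF F]])
      fix y assume y: "y \<in> carrier (src F)"
      have "fst s (fst q (fst s y)) = fst d (fst s y)"
        using H_comp_apply(1)[of "fst s y" G s q] q(2) sc y by simp
      also have "\<dots> = fst s y"
        using y sc by (simp add: d(2) fs short_exact_H_zero[OF ex] t1.M.diff_zero)
      finally show "fst (H_comp F q s) y = fst (H_id F) y"
        using e1 y sc qc by (simp add: short_exact_mod_def inj_on_def)
    next
      fix y assume y: "y \<in> carrier (tgt F)"
      have "snd s (snd q (snd s y)) = snd d (snd s y)"
        using H_comp_apply(2)[of "snd s y" G s q] q(2) sc y by simp
      also have "\<dots> = snd s y"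
        using y sc by (simp add: d(3) fs2 short_exact_H_zero[OF ex] t2.M.diff_zero)
      finally show "snd (H_comp F q s) y = snd (H_id F) y"
        using e2 y sc qc by (simp add: short_exact_mod_def inj_on_def)
    qed
    then have "split_mono A F G s" using q(1) by (auto simp: split_mono_def)
    then show False using las by (simp add: left_almost_split_def)
  qed
  \<comment> \<open>So \<open>f\<close> sits between the identity on the left term and a bijection
    on the right term.\<close>
  note bz = split_epi_endo_bij[OF PK z(1) this]
  have fH: "fst f \<in> mod_Hom A (src G) (src G)" "snd f \<in> mod_Hom A (tgt G) (tgt G)"
    and zH: "fst z \<in> mod_Hom A (src K) (src K)" "snd z \<in> mod_Hom A (tgt K) (tgt K)"
    using f(1) z(1) by (simp_all add: H_mor_iff)
  show "bij_betw (fst f) (carrier (src G)) (carrier (src G))"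
    by (rule short_exact_endo_bij[OF FD(1) GD(1) KD(1) e1 fH(1) fs zH(1) zt bz(1)])
  show "bij_betw (snd f) (carrier (tgt G)) (carrier (tgt G))"
    by (rule short_exact_endo_bij[OF FD(2) GD(2) KD(2) e2 fH(2) fs2 zH(2) zt2 bz(2)])
qed

text \<open>Neither \<open>s\<close> nor \<open>s'\<close> is a split monomorphism, so each factors
  through the other. Both composites of the comparison maps fix a left map and are therefore
  bijective, so the comparison \<open>v\<close> is bijective too; the map on the right terms is
  induced on cokernels.\<close>

lemma almost_split_unique:
  fixes F :: "('a, 'x, 'y) mobj" and G :: "('a, 'x1, 'y1) mobj" and K :: "('a, 'x2, 'y2) mobj"
    and G' :: "('a, 'x3, 'y3) mobj" and K' :: "('a, 'x4, 'y4) mobj"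
  assumes as: "almost_split_sequence A F G K s t" and as': "almost_split_sequence A F G' K' s' t'"
  shows "isomorphic_sequences A F G' K' s' t' F G K s t"
proof -
  have PF: "P_obj A F" and PG: "P_obj A G" and PK: "P_obj A K" and ex: "short_exact_H A F G K s t"
    and las: "left_almost_split A F G s"
    using as by (simp_all add: almost_split_sequence_def)
  have PG': "P_obj A G'" and PK': "P_obj A K'" and ex': "short_exact_H A F G' K' s' t'"
    and las': "left_almost_split A F G' s'"
    using as' by (simp_all add: almost_split_sequence_def)
  have F: "H_obj A F" and G: "H_obj A G" and K: "H_obj A K" and G': "H_obj A G'" and K': "H_obj A K'"
    using PF PG PK PG' PK' by (simp_all add: P_obj_def)
  note FD = H_objD[OF F] and GD = H_objD[OF G] and KD = H_objD[OF K]
    and GD' = H_objD[OF G'] and KD' = H_objD[OF K']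
  have s: "s \<in> H_mor A F G" and t: "t \<in> H_mor A G K" and s': "s' \<in> H_mor A F G'" and t': "t' \<in> H_mor A G' K'"
    using ex ex' by (simp_all add: short_exact_H_def)
  have "\<not> split_mono A F G s" "\<not> split_mono A F G' s'"
    using las las' by (simp_all add: left_almost_split_def)
  then obtain v v' where v: "v \<in> H_mor A G' G" "H_comp F v s' = s"
    and v': "v' \<in> H_mor A G G'" "H_comp F v' s = s'"
    using left_almost_split_factor[OF las' PF PG' PG s] left_almost_split_factor[OF las PF PG PG' s']
    by blast
  note vc = H_mor_closed[OF v(1)] and vc' = H_mor_closed[OF v'(1)]
  have "H_comp F (H_comp G v v') s = s" by (simp add: H_comp_assoc[OF s] v(2) v'(2))
  note b = almost_split_endo_bij[OF as H_comp_mor[OF v'(1) v(1) G] this]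
  have "H_comp F (H_comp G' v' v) s' = s'" by (simp add: H_comp_assoc[OF s'] v(2) v'(2))
  note b' = almost_split_endo_bij[OF as' H_comp_mor[OF v(1) v'(1) G'] this]
  have bv1: "bij_betw (fst v) (carrier (src G')) (carrier (src G))"
  proof (rule bij_betw_of_comp)
    show "bij_betw (\<lambda>x. fst v' (fst v x)) (carrier (src G')) (carrier (src G'))"
      using b'(1) by (simp cong: bij_betw_cong)
    show "bij_betw (\<lambda>y. fst v (fst v' y)) (carrier (src G)) (carrier (src G))"
      using b(1) by (simp cong: bij_betw_cong)
  qed (use vc vc' in auto)
  have bv2: "bij_betw (snd v) (carrier (tgt G')) (carrier (tgt G))"
  proof (rule bij_betw_of_comp)
    show "bij_betw (\<lambda>x. snd v' (snd v x)) (carrier (tgt G')) (carrier (tgt G'))"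
      using b'(2) by (simp cong: bij_betw_cong)
    show "bij_betw (\<lambda>y. snd v (snd v' y)) (carrier (tgt G)) (carrier (tgt G))"
      using b(2) by (simp cong: bij_betw_cong)
  qed (use vc vc' in auto)
  have vs: "fst v (fst s' x) = fst s x" if "x \<in> carrier (src F)" for x
    using H_comp_apply(1)[of x F v s'] that v(2) by simp
  have vs2: "snd v (snd s' x) = snd s x" if "x \<in> carrier (tgt F)" for x
    using H_comp_apply(2)[of x F v s'] that v(2) by simp
  have "\<exists>w\<in>H_mor A K' K. H_comp G' w t' = H_comp G' t v"
    by (rule H_cokernel_factor[OF G' K' K ex' H_comp_mor[OF v(1) t G']])
      (simp_all add: H_mor_closed[OF s'] vs vs2 short_exact_H_zero[OF ex])
  then obtain w where w: "w \<in> H_mor A K' K" "H_comp G' w t' = H_comp G' t v" by blast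
  have wt: "fst w (fst t' y) = fst t (fst v y)" if "y \<in> carrier (src G')" for y
    using H_comp_apply(1)[of y G' w t'] H_comp_apply(1)[of y G' t v] that w(2) by simp
  have wt2: "snd w (snd t' y) = snd t (snd v y)" if "y \<in> carrier (tgt G')" for y
    using H_comp_apply(2)[of y G' w t'] H_comp_apply(2)[of y G' t v] that w(2) by simp
  have wH: "fst w \<in> mod_Hom A (src K') (src K)" "snd w \<in> mod_Hom A (tgt K') (tgt K)"
    using w(1) by (simp_all add: H_mor_iff)
  have e: "short_exact_mod A (src F) (src G) (src K) (fst s) (fst t)"
    "short_exact_mod A (tgt F) (tgt G) (tgt K) (snd s) (snd t)"
    "short_exact_mod A (src F) (src G') (src K') (fst s') (fst t')"
    "short_exact_mod A (tgt F) (tgt G') (tgt K') (snd s') (snd t')"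
    using ex ex' by (simp_all add: short_exact_H_def)
  have bw1: "bij_betw (fst w) (carrier (src K')) (carrier (src K))"
    by (rule short_exact_quotient_bij[OF GD(1) GD'(1) KD(1) KD'(1) e(1,3) bv1 vs wH(1) wt])
  have bw2: "bij_betw (snd w) (carrier (tgt K')) (carrier (tgt K))"
    by (rule short_exact_quotient_bij[OF GD(2) GD'(2) KD(2) KD'(2) e(2,4) bv2 vs2 wH(2) wt2])
  have "H_id F \<in> H_iso A F F"
    by (rule H_isoI[OF F F H_id_mor[OF F]]) (auto simp: H_id_def bij_betw_def inj_on_def)
  moreover have "v \<in> H_iso A G' G" by (rule H_isoI[OF G' G v(1) bv1 bv2])
  moreover have "w \<in> H_iso A K' K" by (rule H_isoI[OF K' K w(1) bw1 bw2])
  moreover have "H_comp F v s' = H_comp F s (H_id F)"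
    using v(2) H_comp_id_right[OF s F] by simp
  ultimately show ?thesis
    unfolding isomorphic_sequences_def using w(2) by blast
qed

end

theorem proposition5p8:
  fixes R :: "'r ring" and \<phi> :: "'r \<Rightarrow> 'a" and \<Lambda> :: "'a ring"
    and E :: "('r, 'e) module" and \<iota> :: "'r set \<Rightarrow> 'e"
    and P :: "('a, 'p) module" and P\<^sub>0 :: "('a, 'n) module" and P\<^sub>1 :: "('a, 'k) module"
    and g :: "'k \<Rightarrow> 'n" and \<sigma> :: "'n \<Rightarrow> (('p \<Rightarrow> 'a) \<Rightarrow> 'a) \<Rightarrow> 'e"
    and \<theta> :: "('p \<Rightarrow> 'a) set \<Rightarrow> (('p \<Rightarrow> 'a) \<Rightarrow> 'a) \<Rightarrow> 'e" and e :: "('p \<Rightarrow> 'a) \<Rightarrow> 'n"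
  assumes \<comment> \<open>\<open>\<Lambda>\<close> is an Artin \<open>R\<close>-algebra, and \<open>D = Hom\<^sub>R(-, E)\<close> is its standard duality\<close>
    "artin_algebra R \<phi> \<Lambda>"
    "injective_envelope R (top_module R (regular_module R)) E \<iota>"
    and "fg_module \<Lambda> P" "projective \<Lambda> P" "indecomposable \<Lambda> P"
    and "minimal_projective_presentation (op_ring \<Lambda>) P\<^sub>1 P\<^sub>0
           (nakayama R \<phi> E (op_ring \<Lambda>) (dual_module \<Lambda> P)) g \<sigma>"
    and \<comment> \<open>\<open>\<theta>\<close> is the isomorphism entering the definition of \<open>\<alpha>\<close>\<close>
    "\<theta> \<in> mod_iso (op_ring \<Lambda>) (top_module (op_ring \<Lambda>) (dual_module \<Lambda> P))
           (soc_module (op_ring \<Lambda>) (nakayama R \<phi> E (op_ring \<Lambda>) (dual_module \<Lambda> P)))"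
    and "e \<in> mod_Hom (op_ring \<Lambda>) (dual_module \<Lambda> P) P\<^sub>0"
    and "compose (carrier (dual_module \<Lambda> P)) \<sigma> e
           = via_top_soc (op_ring \<Lambda>) (dual_module \<Lambda> P) \<theta>"
  shows
    "let P\<^sub>0' = dual_module (op_ring \<Lambda>) P\<^sub>0;
         P\<^sub>1' = dual_module (op_ring \<Lambda>) P\<^sub>1;
         g' = dual_map (op_ring \<Lambda>) P\<^sub>1 P\<^sub>0 g;
         e' = compose (carrier P\<^sub>0') (inv_into (carrier P) (bidual_map \<Lambda> P))
                (dual_map (op_ring \<Lambda>) (dual_module \<Lambda> P) P\<^sub>0 e);
         X = \<lparr>src = zero_module, tgt = P, arr = zero_map zero_module P\<rparr>;
         Y = \<lparr>src = P\<^sub>0', tgt = dsum_module P\<^sub>1' P, arr = \<lambda>x\<in>carrier P\<^sub>0'. (g' x, e' x)\<rparr>;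
         Z = \<lparr>src = P\<^sub>0', tgt = P\<^sub>1', arr = g'\<rparr>;
         s = (zero_map zero_module P\<^sub>0', \<lambda>p\<in>carrier P. (\<zero>\<^bsub>P\<^sub>1'\<^esub>, p));
         t = (\<lambda>x\<in>carrier P\<^sub>0'. x, \<lambda>q\<in>carrier P\<^sub>1' \<times> carrier P. fst q)
     in almost_split_sequence \<Lambda> X Y Z s t \<and>
        (\<forall>(Y' :: ('a, 'u, 'v) mobj) (Z' :: ('a, 'w, 'z) mobj) s' t'.
           almost_split_sequence \<Lambda> X Y' Z' s' t'
           \<longrightarrow> isomorphic_sequences \<Lambda> X Y' Z' s' t' X Y Z s t)"
proof -
  \<comment> \<open>The sequence makes no reference to the dual basis chosen here, so the result of
    the locale is the claim itself.\<close>
  obtain n x f where "dual_basis \<Lambda> P n x f"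
    using exists_dual_basis assms(3,4) by blast
  moreover have "artin_alg R \<phi> \<Lambda>" using assms(1) by (rule artin_alg.intro)
  moreover have "injective R E" using assms(2) by (simp add: injective_envelope_def)
  ultimately have "nakayama_presentation R \<phi> \<Lambda> P n x f E P\<^sub>0 P\<^sub>1 g \<sigma> \<theta> e"
    using assms(5-9) by (intro nakayama_presentation.intro nakayama_presentation_axioms.intro)
  then interpret nakayama_presentation R \<phi> \<Lambda> P n x f E P\<^sub>0 P\<^sub>1 g \<sigma> \<theta> e .
  show ?thesis
    unfolding Let_def
    by (intro conjI allI impI almost_split Alg.almost_split_unique[OF almost_split])
qed

end
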